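(* Let $1/4<H<1/2$, $\alpha=\frac12-H$, $n\ge2$, and let $b,\sigma,\bar X$ be as in the context, where the nonconstant $T$-periodic solution $\bar X$ of $\dot{\bar X}_t=b(\bar X_t)$ with $\bar X_0=\bar X_T=x_0$ is transversally hyperbolic. Assume that $\nabla(\nabla\cdot b)(\bar X_t)=0$ for all $t$. Let $P$ be a $T$-periodic Floquet matrix whose first column is $\bar X'$, and suppose that $$\sigma^{-1}P,\ P^{-1}\sigma\in H^r(\mathbb T_T;\mathbb R^{n\times n})$$ for some $r>\alpha+1/2$. Then there exists $\epsilon_*>0$, independent of $N$, such that, for every $N\in\mathbb N^+$ and every $0<\epsilon<\epsilon_*$, $$\delta^2J_{\epsilon,N}(\bar X)[\eta,\eta]>0$$ for every nonzero $\eta\in\mathcal H_{H,0}^\sigma([0,NT];\mathbb R^n)$.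
   Context: Setting. $b:\mathbb R^n\to\mathbb R^n$ is autonomous and of class $C_b^3$ (bounded with bounded continuous derivatives up to order three); $\sigma_t=\operatorname{diag}(\sigma^1_t,\dots,\sigma^n_t)$, $t\ge0$, is deterministic, $C^1$ and $T$-periodic with $0<m_i\le\sigma^i_t\le M_i$. $\mathbb T_T=\mathbb R/T\mathbb Z$ and $H^r(\mathbb T_T)$ is the usual periodic Sobolev space. Transversally hyperbolic: for the variational equation $\dot v=\nabla b(\bar X_t)v$, the Floquet multiplier $1$ is simple and every other Floquet multiplier $\mu$ satisfies $|\mu|\ne1$. Floquet matrix: $P(t)$ is $T$-periodic, invertible for each $t$, and $P'(t)=\nabla b(\bar X_t)P(t)-P(t)R$ with constant $R=\begin{pmatrix}0&0\\0&R_\perp\end{pmatrix}$, where $R_\perp$ is $(n-1)\times(n-1)$ with no eigenvalue on the imaginary axis. Spaces. Kernel, for $0<s<t$: $K_H(t,s)=c_H\left[(t/s)^{H-\frac12}(t-s)^{H-\frac12}-(H-\frac12)s^{\frac12-H}\int_s^tu^{H-\frac32}(u-s)^{H-\frac12}du\right]$, $c_H=\sqrt{\frac{2H\Gamma(3/2-H)}{\Gamma(H+1/2)\Gamma(2-2H)}}$. For $u\in L^2([0,NT];\mathbb R^n)$: $(K_Hu)(t)=\int_0^tK_H(t,s)u(s)ds$, $(K_H^\sigma u)(t)=\int_0^t\sigma_s\,d(K_Hu)(s)$ (Young integral). $K_H^\sigma$ is injective; $\mathcal H_H^\sigma([0,NT];\mathbb R^n):=K_H^\sigma(L^2)$ and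 $\mathcal H_{H,0}^\sigma([0,NT];\mathbb R^n)=\{\eta\in\mathcal H_H^\sigma([0,NT];\mathbb R^n):\eta_0=\eta_{NT}=0\}$. Second variation. With $d_H=\sqrt{2H\Gamma(H+\frac12)\Gamma(\frac32-H)/\Gamma(2-2H)}$, the second variation at (the periodic extension of) $\bar X$ of $$J_{\epsilon,N}(\phi)=\frac1{2\epsilon}\int_0^{NT}\left|(K_H^\sigma)^{-1}\left(\phi_\cdot-x_0-\int_0^\cdot b(\phi_s)ds\right)(t)\right|^2dt+\frac{d_H}2\int_0^{NT}\nabla\cdot b(\phi_t)\,dt$$ is $$\delta^2J_{\epsilon,N}(\bar X)[\eta,\eta]=\frac1\epsilon\int_0^{NT}\left|(K_H^\sigma)^{-1}\left(\eta_\cdot-\int_0^\cdot\nabla b(\bar X_s)\eta_s\,ds\right)(t)\right|^2dt+\frac{d_H}2\int_0^{NT}\eta_t^T\nabla^2(\nabla\cdot b)(\bar X_t)\eta_t\,dt .$$ *)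

theory Defs
  imports
    "HOL-Analysis.Analysis"
    "HOL-Computational_Algebra.Polynomial"
begin

section \<open>Vector calculus\<close>

definition gradient :: "(real ^ 'n \<Rightarrow> real) \<Rightarrow> real ^ 'n \<Rightarrow> real ^ 'n" where
  "gradient f x = (\<chi> i. frechet_derivative f (at x) (axis i 1))"

definition hessian :: "(real ^ 'n \<Rightarrow> real) \<Rightarrow> real ^ 'n \<Rightarrow> real ^ 'n ^ 'n" where
  "hessian f x = jacobian (gradient f) (at x)"

definition divergence :: "(real ^ 'n \<Rightarrow> real ^ 'n) \<Rightarrow> real ^ 'n \<Rightarrow> real" where
  "divergence f x = trace (jacobian f (at x))"

text \<open>\<open>C_b k f\<close>: the map \<open>f\<close> and all its iterated partial derivatives up to order \<open>k\<close>
  exist, are continuous, and are bounded on the whole space.\<close>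

primrec C_b :: "nat \<Rightarrow> ('a::euclidean_space \<Rightarrow> 'b::real_normed_vector) \<Rightarrow> bool" where
  "C_b 0 f \<longleftrightarrow> continuous_on UNIV f \<and> bounded (range f)"
| "C_b (Suc k) f \<longleftrightarrow>
     continuous_on UNIV f \<and> bounded (range f) \<and> (\<forall>x. f differentiable (at x)) \<and>
     (\<forall>e\<in>Basis. C_b k (\<lambda>x. frechet_derivative f (at x) e))"

definition diag_matrix :: "real ^ 'n \<Rightarrow> real ^ 'n ^ 'n" where
  "diag_matrix v = (\<chi> i j. if i = j then v $ i else 0)"

section \<open>Floquet theory\<close>

text \<open>The complex characteristic polynomial \<open>det (z I - A)\<close> of a real matrix; the algebraic
  multiplicity of an eigenvalue \<open>z\<close> is the library's \<^const>\<open>order\<close> of \<open>z\<close> as a root.\<close>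

definition charpoly :: "real ^ 'n ^ 'n \<Rightarrow> complex poly" where
  "charpoly A =
     det (\<chi> i j. (if i = j then [:0, 1:] else 0) - [:complex_of_real (A $ i $ j):])"

text \<open>\<open>\<Phi>\<close> is the principal fundamental matrix of \<open>v' = A(t) v\<close>. If \<open>A\<close> is \<open>T\<close>-periodic,
  \<open>\<Phi> T\<close> is the monodromy matrix, and its eigenvalues are the Floquet multipliers.\<close>

definition fundamental_matrix :: "(real \<Rightarrow> real ^ 'n ^ 'n) \<Rightarrow> (real \<Rightarrow> real ^ 'n ^ 'n) \<Rightarrow> bool" where
  "fundamental_matrix A \<Phi> \<longleftrightarrow>
     \<Phi> 0 = mat 1 \<and> (\<forall>t. (\<Phi> has_vector_derivative A t ** \<Phi> t) (at t))"

definition transversally_hyperbolic ::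
    "real \<Rightarrow> (real ^ 'n \<Rightarrow> real ^ 'n) \<Rightarrow> (real \<Rightarrow> real ^ 'n) \<Rightarrow> bool" where
  "transversally_hyperbolic T b X \<longleftrightarrow>
     (\<exists>\<Phi>. fundamental_matrix (\<lambda>t. jacobian b (at (X t))) \<Phi> \<and>
        order 1 (charpoly (\<Phi> T)) = 1 \<and>
        (\<forall>\<mu>. poly (charpoly (\<Phi> T)) \<mu> = 0 \<and> \<mu> \<noteq> 1 \<longrightarrow> cmod \<mu> \<noteq> 1))"

text \<open>\<open>z\<close> is a complex eigenvalue of the principal submatrix of \<open>A\<close> with rows and columns
  in \<open>S\<close>; vectors indexed by \<open>S\<close> are encoded as vectors that vanish outside \<open>S\<close>.\<close>

definition eigenvalue_on :: "'n set \<Rightarrow> real ^ 'n ^ 'n \<Rightarrow> complex \<Rightarrow> bool" where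
  "eigenvalue_on S A z \<longleftrightarrow>
     (\<exists>v :: complex ^ 'n. v \<noteq> 0 \<and> (\<forall>i. i \<notin> S \<longrightarrow> v $ i = 0) \<and>
        (\<forall>i\<in>S. (\<Sum>j\<in>S. complex_of_real (A $ i $ j) * v $ j) = z * v $ i))"

text \<open>The index \<open>k\<close> plays the role of the first coordinate: \<open>R\<close> has a zero row and a zero
  column at \<open>k\<close>, and \<open>R\<^sub>\<bottom>\<close> is the submatrix of \<open>R\<close> on the remaining indices.\<close>

definition floquet_matrix ::
    "real \<Rightarrow> (real \<Rightarrow> real ^ 'n ^ 'n) \<Rightarrow> 'n \<Rightarrow> (real \<Rightarrow> real ^ 'n ^ 'n) \<Rightarrow> real ^ 'n ^ 'n \<Rightarrow> bool" where
  "floquet_matrix T A k P R \<longleftrightarrow>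
     (\<forall>t. P (t + T) = P t) \<and>
     (\<forall>t. invertible (P t)) \<and>
     (\<forall>t. (P has_vector_derivative (A t ** P t - P t ** R)) (at t)) \<and>
     (\<forall>i. R $ i $ k = 0 \<and> R $ k $ i = 0) \<and>
     (\<forall>z. eigenvalue_on (- {k}) R z \<longrightarrow> Re z \<noteq> 0)"

section \<open>Periodic Sobolev spaces\<close>

definition L2_on :: "real \<Rightarrow> (real \<Rightarrow> 'a::euclidean_space) \<Rightarrow> bool" where
  "L2_on L u \<longleftrightarrow>
     set_borel_measurable lebesgue {0..L} u \<and> set_integrable lebesgue {0..L} (\<lambda>t. (norm (u t))\<^sup>2)"

definition fourier_coeff :: "real \<Rightarrow> (real \<Rightarrow> real) \<Rightarrow> int \<Rightarrow> complex" where
  "fourier_coeff T f m =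
     (1 / complex_of_real T) *
     (LINT t:{0..T}|lebesgue. complex_of_real (f t) * cis (- 2 * pi * real_of_int m * t / T))"

text \<open>A function on the circle \<open>\<real>/T\<int>\<close> is given by its values on one period \<open>[0,T]\<close>.\<close>

definition periodic_sobolev :: "real \<Rightarrow> real \<Rightarrow> (real \<Rightarrow> real) \<Rightarrow> bool" where
  "periodic_sobolev T r f \<longleftrightarrow>
     L2_on T f \<and>
     (\<lambda>m::int. (1 + (real_of_int m)\<^sup>2) powr r * (cmod (fourier_coeff T f m))\<^sup>2) summable_on UNIV"

definition periodic_sobolev_matrix :: "real \<Rightarrow> real \<Rightarrow> (real \<Rightarrow> real ^ 'n ^ 'n) \<Rightarrow> bool" where
  "periodic_sobolev_matrix T r F \<longleftrightarrow> (\<forall>i j. periodic_sobolev T r (\<lambda>t. F t $ i $ j))"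

section \<open>The fractional operators\<close>

definition c_H :: "real \<Rightarrow> real" where
  "c_H H = sqrt (2 * H * Gamma (3/2 - H) / (Gamma (H + 1/2) * Gamma (2 - 2 * H)))"

definition d_H :: "real \<Rightarrow> real" where
  "d_H H = sqrt (2 * H * Gamma (H + 1/2) * Gamma (3/2 - H) / Gamma (2 - 2 * H))"

definition kernel_H :: "real \<Rightarrow> real \<Rightarrow> real \<Rightarrow> real" where
  "kernel_H H t s =
     c_H H * ((t / s) powr (H - 1/2) * (t - s) powr (H - 1/2)
       - (H - 1/2) * s powr (1/2 - H) *
         (LINT u:{s..t}|lebesgue. u powr (H - 3/2) * (u - s) powr (H - 1/2)))"

definition K_H :: "real \<Rightarrow> (real \<Rightarrow> real ^ 'n) \<Rightarrow> real \<Rightarrow> real ^ 'n" where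
  "K_H H u t = (LINT s:{0..t}|lebesgue. kernel_H H t s *\<^sub>R u s)"

text \<open>The Young integral \<open>\<integral>\<^sub>a\<^sup>b F dg\<close>: the limit of Riemann-Stieltjes sums over tagged
  partitions as the mesh tends to zero.\<close>

definition has_young_integral ::
    "(real \<Rightarrow> real ^ 'n ^ 'n) \<Rightarrow> (real \<Rightarrow> real ^ 'n) \<Rightarrow> real \<Rightarrow> real \<Rightarrow> real ^ 'n \<Rightarrow> bool" where
  "has_young_integral F g a b I \<longleftrightarrow>
     (\<forall>e>0. \<exists>d>0. \<forall>p. p tagged_division_of {a..b} \<and> (\<lambda>x. ball x d) fine p \<longrightarrow>
        norm ((\<Sum>(x, K)\<in>p. F x *v (g (Sup K) - g (Inf K))) - I) < e)"

definition young_integral ::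
    "(real \<Rightarrow> real ^ 'n ^ 'n) \<Rightarrow> (real \<Rightarrow> real ^ 'n) \<Rightarrow> real \<Rightarrow> real \<Rightarrow> real ^ 'n" where
  "young_integral F g a b = (THE I. has_young_integral F g a b I)"

definition K_H_\<sigma> ::
    "real \<Rightarrow> (real \<Rightarrow> real ^ 'n ^ 'n) \<Rightarrow> (real \<Rightarrow> real ^ 'n) \<Rightarrow> real \<Rightarrow> real ^ 'n" where
  "K_H_\<sigma> H \<Sigma> u t = young_integral \<Sigma> (K_H H u) 0 t"

text \<open>Elements of function spaces over \<open>[0,L]\<close> are functions on \<open>\<real>\<close> of which only the values
  on \<open>[0,L]\<close> matter.\<close>

definition \<H>_H_\<sigma> :: "real \<Rightarrow> (real \<Rightarrow> real ^ 'n ^ 'n) \<Rightarrow> real \<Rightarrow> (real \<Rightarrow> real ^ 'n) set" where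
  "\<H>_H_\<sigma> H \<Sigma> L = {\<eta>. \<exists>u. L2_on L u \<and> (\<forall>t\<in>{0..L}. \<eta> t = K_H_\<sigma> H \<Sigma> u t)}"

definition \<H>_H_\<sigma>_0 :: "real \<Rightarrow> (real \<Rightarrow> real ^ 'n ^ 'n) \<Rightarrow> real \<Rightarrow> (real \<Rightarrow> real ^ 'n) set" where
  "\<H>_H_\<sigma>_0 H \<Sigma> L = {\<eta> \<in> \<H>_H_\<sigma> H \<Sigma> L. \<eta> 0 = 0 \<and> \<eta> L = 0}"

text \<open>A preimage is determined up to a Lebesgue null set (injectivity on \<open>L\<^sup>2\<close>), so the
  integrals below do not depend on the representative that is picked.\<close>

definition K_H_\<sigma>_inv ::
    "real \<Rightarrow> (real \<Rightarrow> real ^ 'n ^ 'n) \<Rightarrow> real \<Rightarrow> (real \<Rightarrow> real ^ 'n) \<Rightarrow> real \<Rightarrow> real ^ 'n" where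
  "K_H_\<sigma>_inv H \<Sigma> L \<phi> = (SOME u. L2_on L u \<and> (\<forall>t\<in>{0..L}. K_H_\<sigma> H \<Sigma> u t = \<phi> t))"

section \<open>The second variation\<close>

text \<open>The second variation, at a solution \<open>X\<close> of \<open>X' = b(X)\<close> and for \<open>L = NT\<close>, of the functional
  \<open>J(\<phi>) = (1/(2\<epsilon>)) \<integral>\<^sub>0\<^sup>L |(K\<^sub>H\<^sup>\<sigma>)\<^sup>-\<^sup>1 (\<phi> - x\<^sub>0 - \<integral>\<^sub>0 b(\<phi>\<^sub>s) ds)|\<^sup>2 dt
    + (d\<^sub>H/2) \<integral>\<^sub>0\<^sup>L (\<nabla>\<cdot>b)(\<phi>\<^sub>t) dt\<close>.
  The argument of \<open>(K\<^sub>H\<^sup>\<sigma>)\<^sup>-\<^sup>1\<close> vanishes at \<open>X\<close>, so the second derivative of \<open>b\<close> does not enter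
  through the first integral.\<close>

definition second_variation ::
    "real \<Rightarrow> (real \<Rightarrow> real ^ 'n ^ 'n) \<Rightarrow> (real ^ 'n \<Rightarrow> real ^ 'n) \<Rightarrow> (real \<Rightarrow> real ^ 'n) \<Rightarrow>
     real \<Rightarrow> real \<Rightarrow> (real \<Rightarrow> real ^ 'n) \<Rightarrow> real" where
  "second_variation H \<Sigma> b X \<epsilon> L \<eta> =
     1 / \<epsilon> * (LINT t:{0..L}|lebesgue.
       (norm (K_H_\<sigma>_inv H \<Sigma> L
         (\<lambda>t. \<eta> t - (LINT s:{0..t}|lebesgue. jacobian b (at (X s)) *v \<eta> s)) t))\<^sup>2)
     + d_H H / 2 * (LINT t:{0..L}|lebesgue. \<eta> t \<bullet> (hessian (divergence b) (X t) *v \<eta> t))"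

end

theory Submission
  imports Defs "HOL-Computational_Algebra.Fundamental_Theorem_Algebra"
begin

text \<open>
  Let \<open>w\<close> be the preimage of \<open>\<eta> - \<integral> \<nabla>b(X) \<eta>\<close> and \<open>g = K\<^sub>H w\<close>, so that
  \<open>d\<eta> = \<nabla>b(X) \<eta> dt + \<sigma> dg\<close>. Since \<open>\<nabla>(\<nabla>\<cdot>b)\<close> vanishes along the orbit, its (symmetric)
  Hessian annihilates \<open>X'\<close>, and the potential term is bounded by the \<open>L\<^sup>2\<close>-norm of the transversal
  part of \<open>P\<^sup>-\<^sup>1 \<eta>\<close>. It remains to bound that norm by the one of \<open>w\<close>, uniformly in \<open>N\<close>.
  For \<open>s < t\<close> the increments of the kernel are dominated by those of \<open>c (t - s)\<^sup>-\<^sup>\<alpha>\<close>, so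
  \<open>w \<mapsto> g(\<cdot> + h) - g\<close> is bounded on \<open>L\<^sup>2\<close> uniformly for \<open>h \<le> 1\<close> and all interval
  lengths. With the error \<open>l\<close> of the moving average \<open>\<integral>\<^sub>t\<^sup>t\<^sup>+\<^sup>1 g\<close> of \<open>g\<close>, the function
  \<open>y = P\<^sup>-\<^sup>1(\<eta> - \<sigma> l)\<close> solves \<open>y' = R y + f\<close> with \<open>f\<close> controlled by \<open>w\<close> in \<open>L\<^sup>2\<close>. As
  \<open>R\<^sub>\<bottom>\<close> is hyperbolic, \<open>f\<close> and the boundary values of \<open>y\<close> control its transversal part.
\<close>

section \<open>The fractional kernel\<close>

text \<open>On \<open>[0,L]\<close> the norm of K_H grows like \<open>L^(H+1/2)\<close> by
  self-similarity, because \<open>(t - s)^-\<alpha>\<close> is not integrable at infinity; no bound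
  of g itself can be uniform in N. The difference \<open>x^-\<alpha> - (x + 1)^-\<alpha>\<close>
  decays like \<open>x^(-\<alpha>-1)\<close>, so unit increments pass a Schur test whose constant
  does not see L. This dictates the averaging: g is only Hoelder continuous and \<eta> need not be
  differentiable, but the moving average is C^1 with derivative \<open>g(t + 1) - g(t)\<close>, and
  its error l is a mean of increments; nothing else of g enters the transversal equation. The price
  is paid at the ends: \<eta> vanishes there, y does not, so l must also be bounded pointwise. The
  tangential component of \<open>P^-1 \<eta>\<close> belongs to the eigenvalue 0 of R and has no
  N-uniform bound, so the potential term must not see it. If that term is at most
  \<open>K W\<close>, with W the energy of w, positivity follows from
  \<open>1/\<epsilon> > K\<close> and \<open>W > 0\<close>; the latter is a uniqueness statement for
  an integral equation.\<close>

lemma has_integral_powr_diff: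
  fixes s t p :: real
  assumes "s \<le> t" "p > -1"
  shows "((\<lambda>u. (u - s) powr p) has_integral (t - s) powr (p + 1) / (p + 1)) {s..t}"
proof -
  have "((\<lambda>u. (u - s) powr p) has_integral (t - s) powr (p + 1) / (p + 1) - (s - s) powr (p + 1) / (p + 1)) {s..t}"
  proof (rule fundamental_theorem_of_calculus_interior)
    show "continuous_on {s..t} (\<lambda>u. (u - s) powr (p + 1) / (p + 1))"
      using assms by (intro continuous_intros continuous_on_powr') auto
    show "((\<lambda>u. (u - s) powr (p + 1) / (p + 1)) has_vector_derivative (x - s) powr p) (at x)"
      if "x \<in> {s<..<t}" for x
      unfolding has_real_derivative_iff_has_vector_derivative[symmetric]
      using that assms by (auto intro!: derivative_eq_intros)
  qed (use assms in auto)
  then show ?thesis using assms by simp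
qed

lemma has_integral_powr_diff_right:
  fixes s t p :: real
  assumes "s \<le> t" "p > -1"
  shows "((\<lambda>u. (t - u) powr p) has_integral (t - s) powr (p + 1) / (p + 1)) {s..t}"
  using has_integral_powr_diff[of "- t" "- s" p] assms
    has_integral_reflect_real[of "\<lambda>u. (t - u) powr p" "(t - s) powr (p + 1) / (p + 1)" t s]
  by (simp add: add.commute)

locale fractional_kernel =
  fixes a :: real
  assumes a_pos: "0 < a" and a_less: "a < 1/2"
begin

abbreviation c :: real where "c \<equiv> c_H (1/2 - a)"
abbreviation k :: "real \<Rightarrow> real \<Rightarrow> real" where "k \<equiv> kernel_H (1/2 - a)"

abbreviation KH :: "(real \<Rightarrow> real ^ 'n) \<Rightarrow> real \<Rightarrow> real ^ 'n" where "KH \<equiv> K_H (1/2 - a)"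

text \<open>The inner integral of the kernel for \<open>H = 1/2 - a\<close>, taken as a gauge
  integral so that the fundamental theorem and additivity over intervals apply. Its prefactor
  \<open>- (H - 1/2) = a\<close> is positive, so for \<open>H < 1/2\<close> the kernel is a sum of
  two nonnegative terms.\<close>

definition J :: "real \<Rightarrow> real \<Rightarrow> real" where
  "J t s = integral {s..t} (\<lambda>u. u powr (- a - 1) * (u - s) powr (- a))"

lemma c_pos: "0 < c"
  using a_pos a_less unfolding c_H_def
  by (intro real_sqrt_gt_zero divide_pos_pos mult_pos_pos Gamma_real_pos) auto

lemma J_integrable:
  assumes "0 < s"
  shows "(\<lambda>u. u powr (- a - 1) * (u - s) powr (- a)) absolutely_integrable_on {s..t}"
proof (cases "s \<le> t")
  case True
  have "(\<lambda>u. s powr (- a - 1) * (u - s) powr (- a)) integrable_on {s..t}"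
    using has_integral_powr_diff[OF True, of "- a"] a_less
    by (intro integrable_on_mult_right) (auto simp: has_integral_integrable)
  then show ?thesis
  proof (rule measurable_bounded_by_integrable_imp_absolutely_integrable[rotated 2])
    show "(\<lambda>u. u powr (- a - 1) * (u - s) powr (- a)) \<in> borel_measurable (lebesgue_on {s..t})"
      by (intro measurable_restrict_space1 measurable_completion) measurable
    show "norm (x powr (- a - 1) * (x - s) powr (- a)) \<le> s powr (- a - 1) * (x - s) powr (- a)"
      if "x \<in> {s..t}" for x
      using that assms a_pos by (auto simp: abs_mult intro!: mult_right_mono powr_mono2')
  qed auto
qed (auto simp: absolutely_integrable_on_def)

lemma k_eq:
  assumes "0 < s" "s \<le> t"
  shows "k t s = c * s powr a * (t powr (- a) * (t - s) powr (- a) + a * J t s)"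
proof -
  have 1: "(LINT u:{s..t}|lebesgue. u powr (1/2 - a - 3/2) * (u - s) powr (1/2 - a - 1/2)) = J t s"
    using set_lebesgue_integral_eq_integral(2)[OF J_integrable[OF assms(1), of t]] unfolding J_def
    by (simp add: add.commute minus_diff_commute)
  have 2: "(t / s) powr (- a) = t powr (- a) * s powr a"
    using assms by (simp add: powr_divide powr_minus field_simps)
  show ?thesis unfolding kernel_H_def 1
    by (simp add: 2 algebra_simps)
qed

lemma J_nonneg: "0 \<le> J t s"
  \<comment> \<open>Where the integrand is not integrable, the gauge integral is 0 by
    convention.\<close>
  unfolding J_def by (cases "(\<lambda>u. u powr (- a - 1) * (u - s) powr (- a)) integrable_on {s..t}") (auto intro!: integral_nonneg simp: not_integrable_integral) 

text \<open>The derivative of the kernel in \<open>t\<close> is the classical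
  \<open>- c \<alpha> (s/t)\<^sup>\<alpha> (t - s)\<^sup>-\<^sup>\<alpha>\<^sup>-\<^sup>1\<close>, stated in integrated form to avoid differentiating under the
  integral that defines \<open>J\<close>.\<close>

lemma k_diff_eq:
  assumes "0 < s" "s < t" "t \<le> t'"
  shows "((\<lambda>u. c * s powr a * (a * u powr (- a) * (u - s) powr (- a - 1))) has_integral k t s - k t' s) {t..t'}"
proof -
  let ?\<psi> = "\<lambda>u. u powr (- a) * (u - s) powr (- a)"
  \<comment> \<open>The first summand of the derivative is minus a times the integrand of J, so it
    cancels in \<open>?\<psi> + a * J\<close>; only the second survives.\<close>
  have 1: "((\<lambda>u. - (a * u powr (- a - 1) * (u - s) powr (- a)) - a * u powr (- a) * (u - s) powr (- a - 1))
      has_integral ?\<psi> t' - ?\<psi> t) {t..t'}"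
  proof (rule fundamental_theorem_of_calculus)
    fix x assume "x \<in> {t..t'}"
    then show "(?\<psi> has_vector_derivative - (a * x powr (- a - 1) * (x - s) powr (- a)) - a * x powr (- a) * (x - s) powr (- a - 1))
      (at x within {t..t'})"
      unfolding has_real_derivative_iff_has_vector_derivative[symmetric]
      using assms by (auto intro!: derivative_eq_intros simp: powr_diff)
  qed (use assms in auto)
  have int: "(\<lambda>u. u powr (- a - 1) * (u - s) powr (- a)) integrable_on {x..y}" if "s \<le> x" for x y
    by (rule integrable_on_subinterval[OF absolutely_integrable_on_def[THEN iffD1, OF J_integrable, THEN conjunct1, of s y]])
      (use that assms in auto)
  have 2: "J t s + integral {t..t'} (\<lambda>u. u powr (- a - 1) * (u - s) powr (- a)) = J t' s"
    unfolding J_def using assms by (intro Henstock_Kurzweil_Integration.integral_combine int) auto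
  have 3: "((\<lambda>u. u powr (- a - 1) * (u - s) powr (- a)) has_integral J t' s - J t s) {t..t'}"
  proof -
    have "integral {t..t'} (\<lambda>u. u powr (- a - 1) * (u - s) powr (- a)) = J t' s - J t s" using 2 by linarith
    then show ?thesis using integrable_integral[OF int[of t t']] assms by simp
  qed
  have "((\<lambda>u. (c * s powr a) * (- ((- (a * u powr (- a - 1) * (u - s) powr (- a)) - a * u powr (- a) * (u - s) powr (- a - 1))
         + a * (u powr (- a - 1) * (u - s) powr (- a))))) has_integral
        (c * s powr a) * (- (?\<psi> t' - ?\<psi> t + a * (J t' s - J t s)))) {t..t'}"
    by (intro has_integral_mult_right has_integral_neg has_integral_add 1 3)
  moreover have "k t s - k t' s = (c * s powr a) * (- (?\<psi> t' - ?\<psi> t + a * (J t' s - J t s)))"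
    using assms by (simp add: k_eq algebra_simps)
  moreover have "(\<lambda>u. (c * s powr a) * (- ((- (a * u powr (- a - 1) * (u - s) powr (- a)) - a * u powr (- a) * (u - s) powr (- a - 1))
         + a * (u powr (- a - 1) * (u - s) powr (- a))))) = (\<lambda>u. c * s powr a * (a * u powr (- a) * (u - s) powr (- a - 1)))"
    by (simp add: fun_eq_iff algebra_simps)
  ultimately show ?thesis by simp
qed

lemma k_antimono:
  assumes "0 < s" "s < t" "t \<le> t'"
  shows "k t' s \<le> k t s"
proof -
  have "0 \<le> k t s - k t' s"
    by (rule has_integral_nonneg[OF k_diff_eq[OF assms]]) (use c_pos a_pos in simp)
  then show ?thesis by simp
qed

text \<open>The factor \<open>(s / u)^a\<close> in the derivative of the kernel is at most 1;
  without it the derivative of \<open>c * (u - s)^-a\<close> remains, which depends on the lag only.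
  All estimates uniform in the length of the interval rest on this comparison with a convolution
  kernel.\<close>

lemma k_diff_le:
  assumes "0 < s" "s < t" "t \<le> t'"
  shows "k t s - k t' s \<le> c * ((t - s) powr (- a) - (t' - s) powr (- a))"
proof -
  have "((\<lambda>u. c * (a * (u - s) powr (- a - 1))) has_integral
      c * (- ((t' - s) powr (- a)) - - ((t - s) powr (- a)))) {t..t'}"
  proof (intro has_integral_mult_right fundamental_theorem_of_calculus)
    fix x assume "x \<in> {t..t'}"
    then show "((\<lambda>u. - ((u - s) powr (- a))) has_vector_derivative a * (x - s) powr (- a - 1)) (at x within {t..t'})"
      unfolding has_real_derivative_iff_has_vector_derivative[symmetric]
      using assms by (auto intro!: derivative_eq_intros simp: powr_diff)
  qed (use assms in auto)
  then have "k t s - k t' s \<le> c * (- ((t' - s) powr (- a)) - - ((t - s) powr (- a)))"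
  proof (rule has_integral_le[OF k_diff_eq[OF assms]])
    fix u assume u: "u \<in> {t..t'}"
    have "s powr a * u powr (- a) \<le> 1"
      using u assms a_pos by (simp add: powr_minus field_simps powr_mono2)
    then have "c * (a * (u - s) powr (- a - 1)) * (s powr a * u powr (- a)) \<le> c * (a * (u - s) powr (- a - 1)) * 1"
      using c_pos a_pos by (intro mult_left_mono) auto
    then show "c * s powr a * (a * u powr (- a) * (u - s) powr (- a - 1)) \<le> c * (a * (u - s) powr (- a - 1))"
      by (simp add: algebra_simps)
  qed
  then show ?thesis by simp
qed

lemma k_nonneg:
  assumes "0 < s" "s \<le> t"
  shows "0 \<le> k t s"
  using assms c_pos a_pos J_nonneg by (simp add: k_eq)

text \<open>Up to \<open>u = 2 * s\<close> the ratio \<open>(u - s) / s\<close> is at most 1, which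
  bounds the J term by the first one; beyond that, monotonicity in t reduces to
  \<open>u = 2 * s\<close>. The summand \<open>s^-a\<close> cannot be dropped: as t grows,
  \<open>k t s\<close> tends to a positive multiple of it.\<close>

lemma k_le:
  assumes s: "0 < s" and t: "s < t"
  shows "k t s \<le> c / (1 - a) * ((t - s) powr (- a) + s powr (- a))"
proof -
  have near: "k u s \<le> c / (1 - a) * (u - s) powr (- a)" if u: "s < u" "u \<le> 2 * s" for u
  proof -
    have "J u s \<le> s powr (- a - 1) * ((u - s) powr (- a + 1) / (- a + 1))"
      unfolding J_def
    proof (rule has_integral_le)
      show "((\<lambda>x. x powr (- a - 1) * (x - s) powr (- a)) has_integral
          integral {s..u} (\<lambda>x. x powr (- a - 1) * (x - s) powr (- a))) {s..u}"
        using J_integrable[OF s, of u] by (simp add: absolutely_integrable_on_def integrable_integral)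
      show "((\<lambda>x. s powr (- a - 1) * (x - s) powr (- a)) has_integral
          s powr (- a - 1) * ((u - s) powr (- a + 1) / (- a + 1))) {s..u}"
        using u a_less by (intro has_integral_mult_right has_integral_powr_diff) auto
      show "x powr (- a - 1) * (x - s) powr (- a) \<le> s powr (- a - 1) * (x - s) powr (- a)"
        if "x \<in> {s..u}" for x
        using that s a_pos by (auto intro!: mult_right_mono powr_mono2')
    qed
    also have "\<dots> = s powr (- a) * (u - s) powr (- a) * ((u - s) / s) / (1 - a)"
    proof -
      have "s powr (- a - 1) = s powr (- a) / s" using s by (simp add: powr_diff)
      moreover have "(u - s) powr (- a + 1) = (u - s) powr (- a) * (u - s)" using u by (simp only: powr_add) simp
      ultimately show ?thesis by simp
    qed
    also have "\<dots> \<le> s powr (- a) * (u - s) powr (- a) * 1 / (1 - a)"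
      using u s a_less by (intro divide_right_mono mult_left_mono) auto
    finally have J: "J u s \<le> s powr (- a) * (u - s) powr (- a) / (1 - a)" by simp
    have "u powr (- a) \<le> s powr (- a)" using u s a_pos by (intro powr_mono2') auto
    then have "k u s \<le> c * s powr a * (s powr (- a) * (u - s) powr (- a) + a * (s powr (- a) * (u - s) powr (- a) / (1 - a)))"
      unfolding k_eq[OF s less_imp_le[OF u(1)]] using c_pos a_pos J
      by (intro mult_left_mono add_mono mult_right_mono) auto
    also have "\<dots> = c * (s powr a * s powr (- a)) * (u - s) powr (- a) * (1 + a / (1 - a))"
      by (simp add: algebra_simps)
    also have "s powr a * s powr (- a) = 1" using s by (simp add: powr_add[symmetric])
    also have "1 + a / (1 - a) = 1 / (1 - a)" using a_less by (simp add: field_simps)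
    finally show ?thesis by (simp add: field_simps)
  qed
  have C: "0 < c / (1 - a)" using c_pos a_less by simp
  show ?thesis
  proof (cases "t \<le> 2 * s")
    case True
    then have "k t s \<le> c / (1 - a) * (t - s) powr (- a)" using near[OF t] by simp
    also have "\<dots> \<le> c / (1 - a) * ((t - s) powr (- a) + s powr (- a))"
      using C by (intro mult_left_mono) auto
    finally show ?thesis .
  next
    case False
    then have "k t s \<le> k (2 * s) s" using s by (intro k_antimono) auto
    also have "\<dots> \<le> c / (1 - a) * s powr (- a)" using near[of "2 * s"] s by simp
    also have "\<dots> \<le> c / (1 - a) * ((t - s) powr (- a) + s powr (- a))"
      using C by (intro mult_left_mono) auto
    finally show ?thesis .
  qed
qed

text \<open>The domain of integration in J moves with s; it is written as an indicator defined by
  two inequalities, so that J becomes a parameter integral of a jointly measurable function.\<close>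

lemma k_measurable: "(\<lambda>s. indicator {0<..<t} s * k t s) \<in> borel_measurable borel"
proof -
  have Jm: "(\<lambda>s. \<integral>u. indicator {u. s \<le> u \<and> u \<le> t} u * (u powr (- a - 1) * (u - s) powr (- a)) \<partial>lborel)
      \<in> borel_measurable borel"
    by measurable
  have J: "J t s = (\<integral>u. indicator {u. s \<le> u \<and> u \<le> t} u * (u powr (- a - 1) * (u - s) powr (- a)) \<partial>lborel)"
    if "0 < s" for s
  proof -
    have "J t s = (LINT u:{s..t}|lebesgue. u powr (- a - 1) * (u - s) powr (- a))"
      unfolding J_def using set_lebesgue_integral_eq_integral(2)[OF J_integrable[OF that, of t]] by simp
    also have "\<dots> = (\<integral>u. indicator {s..t} u *\<^sub>R (u powr (- a - 1) * (u - s) powr (- a)) \<partial>lborel)"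
      unfolding set_lebesgue_integral_def by (subst integral_completion) auto
    finally show ?thesis by (simp add: atLeastAtMost_def atLeast_def atMost_def Collect_conj_eq)
  qed
  have "(\<lambda>s. indicator {0<..<t} s * k t s) = (\<lambda>s. indicator {0<..<t} s * (c * s powr a * (t powr (- a) * (t - s) powr (- a) + a * (\<integral>u. indicator {u. s \<le> u \<and> u \<le> t} u * (u powr (- a - 1) * (u - s) powr (- a)) \<partial>lborel))))"
    by (rule ext) (auto simp: indicator_def k_eq J)
  also have "\<dots> \<in> borel_measurable borel" using Jm by measurable
  finally show ?thesis .
qed

end

section \<open>Power and Beta integrals, and the inversion identity of the kernel\<close>

lemma nn_integral_powr_diff:
  fixes s t p :: real
  assumes "s \<le> t" "p > -1"
  shows "(\<integral>\<^sup>+u\<in>{s<..<t}. ennreal ((u - s) powr p) \<partial>lborel) = ennreal ((t - s) powr (p + 1) / (p + 1))"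
    and "(\<integral>\<^sup>+u\<in>{s<..<t}. ennreal ((t - u) powr p) \<partial>lborel) = ennreal ((t - s) powr (p + 1) / (p + 1))"
  using has_integral_powr_diff[OF assms] has_integral_powr_diff_right[OF assms]
  by (auto intro!: nn_integral_has_integral_lebesgue' simp: has_integral_Icc_iff_Ioo)

text \<open>The substitution \<open>u = s + (t - s) * v\<close> reduces it to Euler's integral; the
  Jacobian and the two powers of \<open>t - s\<close> add up to the exponent
  \<open>x + y - 1\<close>.\<close>

lemma nn_integral_Beta_affine:
  fixes s t x y :: real
  assumes "s < t" "0 < x" "0 < y"
  shows "(\<integral>\<^sup>+u\<in>{s<..<t}. ennreal ((t - u) powr (y - 1) * (u - s) powr (x - 1)) \<partial>lborel)
     = ennreal ((t - s) powr (x + y - 1) * Beta x y)"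
proof -
  let ?l = "\<lambda>v. ennreal ((t - (s + (t - s) * v)) powr (y - 1) * (s + (t - s) * v - s) powr (x - 1))
         * indicator {s<..<t} (s + (t - s) * v)"
  let ?r = "\<lambda>v. ennreal ((t - s) powr (x + y - 2)) * (ennreal (v powr (x - 1) * (1 - v) powr (y - 1)) * indicator {0<..<1} v)"
  have "(\<integral>\<^sup>+u\<in>{s<..<t}. ennreal ((t - u) powr (y - 1) * (u - s) powr (x - 1)) \<partial>lborel)
     = ennreal \<bar>t - s\<bar> * (\<integral>\<^sup>+v. ?l v \<partial>lborel)"
    using assms by (intro nn_integral_real_affine) auto
  also have "(\<lambda>v. ?l v) =
      (\<lambda>v. ?r v)"
  proof
    fix v
    have 0: "s + (t - s) * v < t \<longleftrightarrow> v < 1"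
    proof -
      have "s + (t - s) * v < t \<longleftrightarrow> (t - s) * v < (t - s) * 1" by auto
      then show ?thesis using assms mult_less_cancel_left_pos[of "t - s" v 1] by simp
    qed
    have 1: "indicator {s<..<t} (s + (t - s) * v) = (indicator {0<..<1} v :: ennreal)"
      using assms 0 by (auto simp: indicator_def zero_less_mult_iff)
    have 2: "(t - (s + (t - s) * v)) powr (y - 1) * (s + (t - s) * v - s) powr (x - 1) =
        (t - s) powr (x + y - 2) * (v powr (x - 1) * (1 - v) powr (y - 1))" if "v \<in> {0<..<1}"
    proof -
      have "t - (s + (t - s) * v) = (t - s) * (1 - v)" by (simp add: algebra_simps)
      moreover have "(t - s) powr (x + y - 2) = (t - s) powr (y - 1) * (t - s) powr (x - 1)"
        by (simp add: powr_add[symmetric] algebra_simps)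
      ultimately show ?thesis using assms that by (simp add: powr_mult)
    qed
    show "?l v =
       ?r v"
      unfolding 1 by (cases "v \<in> {0<..<1}") (simp only: 2 indicator_simps mult_1_right, simp add: ennreal_mult', simp)
  qed
  also have "(\<integral>\<^sup>+v. ?r v \<partial>lborel)
      = ennreal ((t - s) powr (x + y - 2)) * ennreal (Beta x y)"
    using has_integral_Beta_real[OF assms(2,3)]
    by (subst nn_integral_cmult, simp, subst nn_integral_has_integral_lebesgue')
       (auto simp: has_integral_Icc_iff_Ioo)
  also have "ennreal \<bar>t - s\<bar> * \<dots> = ennreal ((t - s) powr (x + y - 1) * Beta x y)"
  proof -
    have "(t - s) powr (x + y - 1) = (t - s) * (t - s) powr (x + y - 2)"
      using powr_add[of "t - s" 1 "x + y - 2"] assms by (simp add: add.commute)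
    then show ?thesis using assms by (simp add: ennreal_mult' mult.assoc)
  qed
  finally show ?thesis .
qed

context fractional_kernel begin

text \<open>Vanishing off \<open>0 < s < t\<close> makes K_H an integral over the whole line and
  discards the values that \<open>powr\<close> takes for other arguments.\<close>

definition ker :: "real \<Rightarrow> real \<Rightarrow> real" where
  "ker t s = indicator {0<..<t} s * k t s"

lemma ker_measurable [measurable]: "ker t \<in> borel_measurable borel"
  using k_measurable[of t] by (simp add: ker_def[abs_def])

lemma ker_nonneg: "0 \<le> ker t s"
  by (auto simp: ker_def indicator_def intro: k_nonneg)

text \<open>This is the identity behind the inversion formula
  \<open>K\<^sub>H\<^sup>-\<^sup>1 h = const \<cdot> s\<^sup>-\<^sup>\<alpha> I\<^sup>\<alpha> (s\<^sup>\<alpha> h')\<close> for absolutely continuous \<open>h\<close>.\<close>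

lemma nn_integral_ker_Beta:
  assumes r: "0 < r" "r < t"
  shows "(\<integral>\<^sup>+s\<in>{r<..}. ennreal (ker t s * s powr (- a) * (s - r) powr (a - 1)) \<partial>lborel)
      = ennreal (c * Beta a (1 - a) * r powr (- a))"
proof -
  let ?B = "Beta a (1 - a)"
  have B: "0 \<le> ?B" unfolding Beta_def using a_pos a_less
    by (intro divide_nonneg_nonneg mult_nonneg_nonneg less_imp_le[OF Gamma_real_pos]) auto
  \<comment> \<open>f and h are the two summands of \<open>k_eq\<close>. The first integrates to
    \<open>t^-a\<close> times \<open>?B\<close>; the second, after exchanging the integrals, to
    \<open>?B\<close> times \<open>r^-a - t^-a\<close>, so t drops out of the sum.\<close>
  define f where "f s = ennreal (t powr (- a)) * (ennreal ((t - s) powr (- a) * (s - r) powr (a - 1)) * indicator {r<..<t} s)" for s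
  define h where "h s u = ennreal (a * u powr (- a - 1)) * (ennreal ((u - s) powr (- a) * (s - r) powr (a - 1)) * indicator {r<..<u} s) * indicator {r<..<t} u" for s u
  have Jn: "ennreal (J t s) = (\<integral>\<^sup>+u. ennreal (u powr (- a - 1) * (u - s) powr (- a)) * indicator {s<..<t} u \<partial>lborel)"
    if "0 < s" for s
  proof (rule sym, rule nn_integral_has_integral_lebesgue')
    show "((\<lambda>u. u powr (- a - 1) * (u - s) powr (- a)) has_integral J t s) {s<..<t}"
      unfolding has_integral_Icc_iff_Ioo[symmetric] J_def
      using J_integrable[OF that, of t] by (simp add: absolutely_integrable_on_def integrable_integral)
  qed auto
  have eq: "ennreal (ker t s * s powr (- a) * (s - r) powr (a - 1)) * indicator {r<..} s
      = ennreal c * (f s + (\<integral>\<^sup>+u. h s u \<partial>lborel))" for s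
  proof (cases "r < s \<and> s < t")
    case True
    have ss: "s powr a * s powr (- a) = 1" using True r by (simp add: powr_add[symmetric])
    have "ker t s * s powr (- a) * (s - r) powr (a - 1)
        = c * (s powr a * s powr (- a)) * (t powr (- a) * (t - s) powr (- a) + a * J t s) * (s - r) powr (a - 1)"
      using True r by (simp add: ker_def k_eq)
    also have "\<dots> = c * (t powr (- a) * ((t - s) powr (- a) * (s - r) powr (a - 1)) + a * (s - r) powr (a - 1) * J t s)"
      unfolding ss by (simp add: algebra_simps)
    finally have 1: "ennreal (ker t s * s powr (- a) * (s - r) powr (a - 1)) =
       ennreal c * (f s + ennreal (a * (s - r) powr (a - 1)) * ennreal (J t s))"
      using c_pos a_pos J_nonneg True by (simp add: f_def ennreal_mult' ennreal_mult'')
    have "ennreal (a * (s - r) powr (a - 1)) * ennreal (J t s) = (\<integral>\<^sup>+u. h s u \<partial>lborel)"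
      using True r a_pos
      by (subst Jn) (auto simp: h_def nn_integral_cmult[symmetric] ennreal_mult'[symmetric] indicator_def mult_ac
          intro!: nn_integral_cong)
    with 1 show ?thesis using True by simp
  next
    case False
    then have "h s u = 0" for u by (auto simp: h_def indicator_def)
    with False show ?thesis by (auto simp: f_def ker_def indicator_def)
  qed
  have [measurable]: "f \<in> borel_measurable borel" unfolding f_def by measurable
  have hm [measurable]: "case_prod h \<in> borel_measurable (lborel \<Otimes>\<^sub>M lborel)"
  proof -
    have "case_prod h = (\<lambda>(s, u). ennreal (a * u powr (- a - 1)) * (ennreal ((u - s) powr (- a) * (s - r) powr (a - 1)) * (if r < s \<and> s < u then 1 else 0)) * indicator {r<..<t} u)"
      by (auto simp: h_def indicator_def fun_eq_iff)
    also have "\<dots> \<in> borel_measurable (lborel \<Otimes>\<^sub>M lborel)" by measurable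
    finally show ?thesis .
  qed
  have If: "(\<integral>\<^sup>+s. f s \<partial>lborel) = ennreal (t powr (- a) * ?B)"
    unfolding f_def using r nn_integral_Beta_affine[of r t a "1 - a"] a_pos a_less B
    by (subst nn_integral_cmult) (auto simp: ennreal_mult')
  have "(\<integral>\<^sup>+s. (\<integral>\<^sup>+u. h s u \<partial>lborel) \<partial>lborel) = (\<integral>\<^sup>+u. (\<integral>\<^sup>+s. h s u \<partial>lborel) \<partial>lborel)"
    by (rule lborel_pair.Fubini'[symmetric]) (rule hm)
  also have "\<dots> = (\<integral>\<^sup>+u. ennreal (a * ?B * u powr (- a - 1)) * indicator {r<..<t} u \<partial>lborel)"
  proof (rule nn_integral_cong)
    fix u :: real
    show "(\<integral>\<^sup>+s. h s u \<partial>lborel) = ennreal (a * ?B * u powr (- a - 1)) * indicator {r<..<t} u"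
    proof (cases "u \<in> {r<..<t}")
      case True
      then have "(\<integral>\<^sup>+s. h s u \<partial>lborel) = ennreal (a * u powr (- a - 1)) * ennreal ?B"
        unfolding h_def using nn_integral_Beta_affine[of r u a "1 - a"] a_pos a_less
        by (simp add: nn_integral_cmult)
      then show ?thesis using True a_pos B by (simp add: ennreal_mult'' [symmetric] mult_ac)
    qed (simp add: h_def)
  qed
  also have "\<dots> = ennreal (- (?B * t powr (- a)) - - (?B * r powr (- a)))"
  proof (rule nn_integral_has_integral_lebesgue')
    show "((\<lambda>u. a * ?B * u powr (- a - 1)) has_integral - (?B * t powr (- a)) - - (?B * r powr (- a))) {r<..<t}"
      unfolding has_integral_Icc_iff_Ioo[symmetric]
    proof (rule fundamental_theorem_of_calculus)
      fix x assume "x \<in> {r..t}"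
      then show "((\<lambda>u. - (?B * u powr (- a))) has_vector_derivative a * ?B * x powr (- a - 1)) (at x within {r..t})"
        unfolding has_real_derivative_iff_has_vector_derivative[symmetric]
        using r by (auto intro!: derivative_eq_intros simp: powr_diff)
    qed (use r in auto)
  qed (use a_pos B in auto)
  finally have Ih: "(\<integral>\<^sup>+s. (\<integral>\<^sup>+u. h s u \<partial>lborel) \<partial>lborel) = ennreal (?B * (r powr (- a) - t powr (- a)))"
    by (simp add: algebra_simps)
  have mono: "t powr (- a) \<le> r powr (- a)" using r a_pos by (intro powr_mono2') auto
  have "(\<integral>\<^sup>+s\<in>{r<..}. ennreal (ker t s * s powr (- a) * (s - r) powr (a - 1)) \<partial>lborel)
      = ennreal c * (ennreal (t powr (- a) * ?B) + ennreal (?B * (r powr (- a) - t powr (- a))))"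
    unfolding eq using If Ih by (simp add: nn_integral_cmult nn_integral_add)
  also have "\<dots> = ennreal (c * ?B * r powr (- a))"
    using B mono c_pos
    by (subst ennreal_plus[symmetric]) (auto simp: ennreal_mult'[symmetric] algebra_simps intro!: mult_right_mono)
  finally show ?thesis .
qed

end

lemma ennreal_square_add_le: "(x + y)\<^sup>2 \<le> 2 * (x\<^sup>2 + y\<^sup>2)" for x y :: ennreal
proof (cases "x = top \<or> y = top")
  case True
  then show ?thesis by (auto simp: power2_eq_square top_add ennreal_mult_top ennreal_mult_eq_top_iff)
next
  case False
  then obtain u v where uv: "x = ennreal u" "y = ennreal v" "0 \<le> u" "0 \<le> v"
    by (metis ennreal_cases)
  have "(u + v)\<^sup>2 \<le> 2 * (u\<^sup>2 + v\<^sup>2)"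
    using sum_squares_bound[of u v] by (simp add: power2_sum)
  then show ?thesis using uv
    by (simp add: ennreal_power ennreal_plus[symmetric] ennreal_mult'[symmetric] ennreal_numeral[symmetric]
      ennreal_leI del: ennreal_plus ennreal_numeral)
qed

section \<open>Square integrals of the kernel and integrals of its increments\<close>

context fractional_kernel begin

text \<open>The 4 is one factor 2 from squaring the sum in \<open>k_le\<close> and one from its two
  singular powers; \<open>1 / (1 - 2 * a)\<close> comes from integrating the power
  \<open>- 2 * a\<close>.\<close>

definition ker_const :: real where "ker_const = 4 * (c / (1 - a))\<^sup>2 / (1 - 2 * a)"

lemma ker_const_pos: "0 < ker_const"
  using c_pos a_less by (simp add: ker_const_def)

text \<open>Both singular powers in the square of \<open>k_le\<close> are integrable since
  \<open>2 * a < 1\<close>. As \<open>x \<ge> 0\<close>, the singularity at 0 may be moved to x, so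
  that the bound depends on \<open>t - x\<close> alone.\<close>

lemma nn_integral_ker_square:
  assumes "0 \<le> x" "x \<le> t"
  shows "(\<integral>\<^sup>+s\<in>{x<..}. ennreal ((ker t s)\<^sup>2) \<partial>lborel) \<le> ennreal (ker_const * (t - x) powr (1 - 2 * a))"
proof -
  let ?D = "(c / (1 - a))\<^sup>2 * 2"
  have D: "0 \<le> ?D" by simp
  have le: "ennreal ((ker t s)\<^sup>2) * indicator {x<..} s \<le>
      ennreal ?D * (ennreal ((t - s) powr (- 2 * a)) * indicator {x<..<t} s + ennreal ((s - 0) powr (- 2 * a)) * indicator {x<..<t} s)" for s
  proof (cases "s \<in> {x<..<t}")
    case True
    with assms have s: "0 < s" "s < t" by auto
    have "(ker t s)\<^sup>2 \<le> (c / (1 - a) * ((t - s) powr (- a) + s powr (- a)))\<^sup>2"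
      using k_le[OF s] k_nonneg[of s t] s by (intro power_mono) (auto simp: ker_def)
    also have "\<dots> = (c / (1 - a))\<^sup>2 * ((t - s) powr (- a) + s powr (- a))\<^sup>2"
      by (rule power_mult_distrib)
    also have "\<dots> \<le> (c / (1 - a))\<^sup>2 * (2 * (((t - s) powr (- a))\<^sup>2 + (s powr (- a))\<^sup>2))"
      using sum_squares_bound[of "(t - s) powr (- a)" "s powr (- a)"]
      by (intro mult_left_mono) (auto simp: power2_sum)
    also have "((t - s) powr (- a))\<^sup>2 = (t - s) powr (- 2 * a)"
      using s by (simp add: powr_power)
    also have "(s powr (- a))\<^sup>2 = s powr (- 2 * a)"
      using s by (simp add: powr_power)
    also have "(c / (1 - a))\<^sup>2 * (2 * ((t - s) powr (- 2 * a) + s powr (- 2 * a))) =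
        ?D * ((t - s) powr (- 2 * a) + s powr (- 2 * a))" by (simp only: mult_ac)
    finally have "(ker t s)\<^sup>2 \<le> ?D * ((t - s) powr (- 2 * a) + s powr (- 2 * a))" .
    then have "ennreal ((ker t s)\<^sup>2) \<le> ennreal (?D * ((t - s) powr (- 2 * a) + s powr (- 2 * a)))"
      by (rule ennreal_leI)
    with True D show ?thesis by (simp add: ennreal_mult')
  qed (use assms in \<open>auto simp: ker_def indicator_def\<close>)
  have 2: "(\<integral>\<^sup>+s\<in>{x<..<t}. ennreal ((s - 0) powr (- 2 * a)) \<partial>lborel) \<le> ennreal ((t - x) powr (- 2 * a + 1) / (- 2 * a + 1))"
  proof -
    have "(\<integral>\<^sup>+s\<in>{x<..<t}. ennreal ((s - 0) powr (- 2 * a)) \<partial>lborel) \<le> (\<integral>\<^sup>+s\<in>{x<..<t}. ennreal ((s - x) powr (- 2 * a)) \<partial>lborel)"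
      using assms a_pos by (intro nn_integral_mono) (auto simp: indicator_def intro!: ennreal_leI powr_mono2')
    then show ?thesis using nn_integral_powr_diff(1)[OF assms(2), of "- 2 * a"] a_less by simp
  qed
  have "(\<integral>\<^sup>+s\<in>{x<..}. ennreal ((ker t s)\<^sup>2) \<partial>lborel) \<le>
    ennreal ?D * ((\<integral>\<^sup>+s\<in>{x<..<t}. ennreal ((t - s) powr (- 2 * a)) \<partial>lborel) + (\<integral>\<^sup>+s\<in>{x<..<t}. ennreal ((s - 0) powr (- 2 * a)) \<partial>lborel))"
    by (rule order_trans[OF nn_integral_mono[OF le]])
       (subst nn_integral_cmult, simp, subst nn_integral_add, auto)
  also have "\<dots> \<le> ennreal ?D * (ennreal ((t - x) powr (- 2 * a + 1) / (- 2 * a + 1)) + ennreal ((t - x) powr (- 2 * a + 1) / (- 2 * a + 1)))"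
    using nn_integral_powr_diff(2)[OF assms(2), of "- 2 * a"] a_less 2
    by (intro mult_left_mono add_mono) auto
  also have "\<dots> = ennreal (ker_const * (t - x) powr (1 - 2 * a))"
    using a_less D
    by (subst ennreal_plus[symmetric], simp, simp, subst ennreal_mult'[symmetric], simp)
       (simp add: ker_const_def field_simps)
  finally show ?thesis .
qed

text \<open>The dominating kernel of \<open>k_diff_le\<close> as a function of the lag
  \<open>x = t - s\<close>. It decays like \<open>x^(-a-1)\<close> and is therefore integrable on
  the half-line, which \<open>x^-a\<close> is not.\<close>

definition incr :: "real \<Rightarrow> real \<Rightarrow> real" where
  "incr h x = indicator {0<..} x * (c * (x powr (- a) - (x + h) powr (- a)))"

lemma incr_measurable [measurable]: "(\<lambda>(h, x). incr h x) \<in> borel_measurable (borel \<Otimes>\<^sub>M borel)"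
  unfolding incr_def by measurable

lemma incr_nonneg: "0 \<le> h \<Longrightarrow> 0 \<le> incr h x"
  using c_pos a_pos by (auto simp: incr_def indicator_def intro!: mult_nonneg_nonneg powr_mono2')

lemma incr_mono: "0 \<le> h \<Longrightarrow> h \<le> h' \<Longrightarrow> incr h x \<le> incr h' x"
  using c_pos a_pos by (auto simp: incr_def indicator_def intro!: mult_left_mono powr_mono2')

text \<open>The exact value is \<open>(t^(1-p) - (t + h)^(1-p) + h^(1-p)) / (1 - p)\<close>, and the
  first difference is at most 0; hence the bound is free of t. It serves with \<open>p = a\<close>
  and with \<open>p = 2 * a\<close>.\<close>

lemma nn_integral_powr_increment:
  assumes "0 \<le> h" "0 \<le> t" "0 < p" "p < 1"
  shows "(\<integral>\<^sup>+s\<in>{0<..<t}. ennreal ((t - s) powr (- p) - (t - s + h) powr (- p)) \<partial>lborel)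
     \<le> ennreal (h powr (1 - p) / (1 - p))"
proof -
  have "((\<lambda>s. (t - s) powr (- p) - (t + h - s) powr (- p)) has_integral
      (t - 0) powr (- p + 1) / (- p + 1) - ((t + h - 0) powr (- p + 1) / (- p + 1) - (t + h - t) powr (- p + 1) / (- p + 1))) {0..t}"
  proof (rule has_integral_diff)
    show "((\<lambda>s. (t - s) powr (- p)) has_integral (t - 0) powr (- p + 1) / (- p + 1)) {0..t}"
      using assms by (intro has_integral_powr_diff_right) auto
    have "((\<lambda>s. (t + h - s) powr (- p)) has_integral - ((t + h - t) powr (- p + 1) / (- p + 1)) - - ((t + h - 0) powr (- p + 1) / (- p + 1))) {0..t}"
    proof (rule fundamental_theorem_of_calculus_interior)
      show "continuous_on {0..t} (\<lambda>u. - ((t + h - u) powr (- p + 1) / (- p + 1)))"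
        using assms by (intro continuous_intros continuous_on_powr') auto
      show "((\<lambda>u. - ((t + h - u) powr (- p + 1) / (- p + 1))) has_vector_derivative (t + h - x) powr (- p)) (at x)"
        if "x \<in> {0<..<t}" for x
        unfolding has_real_derivative_iff_has_vector_derivative[symmetric]
        using that assms by (auto intro!: derivative_eq_intros)
    qed (use assms in auto)
    then show "((\<lambda>s. (t + h - s) powr (- p)) has_integral ((t + h - 0) powr (- p + 1) / (- p + 1) - (t + h - t) powr (- p + 1) / (- p + 1))) {0..t}"
      by simp
  qed
  then have 1: "((\<lambda>s. (t - s) powr (- p) - (t - s + h) powr (- p)) has_integral
      (t powr (1 - p) - (t + h) powr (1 - p) + h powr (1 - p)) / (1 - p)) {0<..<t}"
    by (simp add: has_integral_Icc_iff_Ioo algebra_simps diff_divide_distrib add_divide_distrib)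
  have "(\<integral>\<^sup>+s\<in>{0<..<t}. ennreal ((t - s) powr (- p) - (t - s + h) powr (- p)) \<partial>lborel)
     = ennreal ((t powr (1 - p) - (t + h) powr (1 - p) + h powr (1 - p)) / (1 - p))"
    by (rule nn_integral_has_integral_lebesgue'[OF _ 1]) (use assms in \<open>auto intro!: powr_mono2'\<close>)
  also have "\<dots> \<le> ennreal (h powr (1 - p) / (1 - p))"
    using assms by (intro ennreal_leI divide_right_mono) (auto intro!: powr_mono2)
  finally show ?thesis .
qed

lemma nn_integral_incr:
  assumes "0 \<le> h" "0 \<le> t"
  shows "(\<integral>\<^sup>+s\<in>{0<..}. ennreal (incr h (t - s)) \<partial>lborel) \<le> ennreal (c * h powr (1 - a) / (1 - a))"
proof -
  have "(\<integral>\<^sup>+s\<in>{0<..}. ennreal (incr h (t - s)) \<partial>lborel)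
     = (\<integral>\<^sup>+s. ennreal c * (ennreal ((t - s) powr (- a) - (t - s + h) powr (- a)) * indicator {0<..<t} s) \<partial>lborel)"
    using c_pos by (intro nn_integral_cong) (auto simp: incr_def indicator_def ennreal_mult')
  also have "\<dots> \<le> ennreal c * ennreal (h powr (1 - a) / (1 - a))"
    using nn_integral_powr_increment[OF assms, of a] a_pos a_less
    by (subst nn_integral_cmult) (auto intro!: mult_left_mono)
  finally show ?thesis using c_pos by (simp add: ennreal_mult'[symmetric])
qed

text \<open>For \<open>0 \<le> y \<le> x\<close> one has \<open>(x - y)^2 \<le> x^2 - y^2\<close>,
  which reduces the square to an increment of the power \<open>- 2 * a\<close>.\<close>

lemma nn_integral_incr_square:
  assumes "0 \<le> h" "0 \<le> t"
  shows "(\<integral>\<^sup>+s\<in>{0<..}. ennreal ((incr h (t - s))\<^sup>2) \<partial>lborel) \<le> ennreal (c\<^sup>2 * h powr (1 - 2 * a) / (1 - 2 * a))"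
proof -
  have le: "ennreal ((incr h (t - s))\<^sup>2) * indicator {0<..} s \<le>
     ennreal (c\<^sup>2) * (ennreal ((t - s) powr (- (2 * a)) - (t - s + h) powr (- (2 * a))) * indicator {0<..<t} s)" for s
  proof (cases "s \<in> {0<..<t}")
    case True
    let ?x = "(t - s) powr (- a)" and ?y = "(t - s + h) powr (- a)"
    have xy: "?y \<le> ?x" "0 \<le> ?y" using True a_pos assms by (auto intro!: powr_mono2')
    have "(?x - ?y)\<^sup>2 \<le> ?x\<^sup>2 - ?y\<^sup>2"
      using mult_left_mono[OF xy] by (simp add: power2_eq_square algebra_simps)
    also have "?x\<^sup>2 = (t - s) powr (- (2 * a))"  using True by (simp add: powr_power)
    also have "?y\<^sup>2 = (t - s + h) powr (- (2 * a))"  using True assms by (simp add: powr_power)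
    finally have "(incr h (t - s))\<^sup>2 \<le> c\<^sup>2 * ((t - s) powr (- (2 * a)) - (t - s + h) powr (- (2 * a)))"
      using True by (simp add: incr_def power_mult_distrib mult_left_mono)
    then have "ennreal ((incr h (t - s))\<^sup>2) \<le> ennreal (c\<^sup>2 * ((t - s) powr (- (2 * a)) - (t - s + h) powr (- (2 * a))))"
      by (rule ennreal_leI)
    with True show ?thesis by (simp add: ennreal_mult')
  qed (auto simp: incr_def indicator_def)
  have "(\<integral>\<^sup>+s\<in>{0<..}. ennreal ((incr h (t - s))\<^sup>2) \<partial>lborel)
     \<le> ennreal (c\<^sup>2) * (\<integral>\<^sup>+s\<in>{0<..<t}. ennreal ((t - s) powr (- (2 * a)) - (t - s + h) powr (- (2 * a))) \<partial>lborel)"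
    by (rule order_trans[OF nn_integral_mono[OF le]]) (subst nn_integral_cmult, auto)
  also have "\<dots> \<le> ennreal (c\<^sup>2) * ennreal (h powr (1 - 2 * a) / (1 - 2 * a))"
    using nn_integral_powr_increment[OF assms, of "2 * a"] a_pos a_less
    by (intro mult_left_mono) auto
  finally show ?thesis by (simp add: ennreal_mult'[symmetric])
qed

lemma ker_diff:
  assumes "0 \<le> t" "0 \<le> h" "s < t"
  shows "\<bar>ker (t + h) s - ker t s\<bar> \<le> incr h (t - s)"
proof (cases "0 < s")
  case True
  then show ?thesis
    using k_antimono[of s t "t + h"] k_diff_le[of s t "t + h"] assms
    by (simp add: ker_def incr_def indicator_def algebra_simps)
next
  case False
  then show ?thesis using incr_nonneg[of h] assms by (simp add: ker_def)
qed

section \<open>Increments of the fractional integral\<close>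

text \<open>Only \<open>s = 0\<close> and \<open>s = t\<close> are lost in passing to
  \<open>ker\<close>; the completed measure can be replaced by the Borel one because w is
  Borel.\<close>

lemma K_H_eq:
  fixes w :: "real \<Rightarrow> real ^ 'n"
  assumes [measurable]: "w \<in> borel_measurable borel"
  shows "KH w t = (\<integral>s. ker t s *\<^sub>R w s \<partial>lborel)"
proof -
  have "KH w t = (\<integral>s. ker t s *\<^sub>R w s \<partial>lebesgue)"
    unfolding K_H_def set_lebesgue_integral_def
    by (rule integral_discrete_difference[of "{0, t}"]) (auto simp: ker_def indicator_def)
  also have "\<dots> = (\<integral>s. ker t s *\<^sub>R w s \<partial>lborel)"
    by (rule integral_completion) measurable
  finally show ?thesis .
qed

lemma ker_eq_0: "s \<le> 0 \<or> t \<le> s \<Longrightarrow> ker t s = 0"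
  by (auto simp: ker_def)

lemma ker_square_integrable: "integrable lborel (\<lambda>s. (ker t s)\<^sup>2)"
proof (cases "0 \<le> t")
  case True
  have "(\<integral>\<^sup>+s. ennreal ((ker t s)\<^sup>2) \<partial>lborel) = (\<integral>\<^sup>+s\<in>{0<..}. ennreal ((ker t s)\<^sup>2) \<partial>lborel)"
    by (intro nn_integral_cong) (auto simp: indicator_def ker_eq_0)
  also have "\<dots> \<le> ennreal (ker_const * (t - 0) powr (1 - 2 * a))"
    using True by (intro nn_integral_ker_square) auto
  also have "\<dots> < \<infinity>" by simp
  finally show ?thesis by (intro integrableI_bounded) auto
qed (auto simp: ker_def indicator_def)

text \<open>Here and in \<open>local_const\<close> the two summands stand for the past noise on
  \<open>(0,t)\<close>, seen through increments of the kernel, and for the fresh noise on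
  \<open>(t,t+h)\<close>; the 2 comes from squaring their sum.\<close>

definition Hoelder_const :: real where "Hoelder_const = 2 * (c\<^sup>2 / (1 - 2 * a) + ker_const)"

lemma Hoelder_const_pos: "0 < Hoelder_const"
  using c_pos ker_const_pos a_less by (simp add: Hoelder_const_def add_pos_pos)

definition local_const :: real where "local_const = 2 * (c / (1 - a) + ker_const)"

lemma local_const_pos: "0 < local_const"
  using c_pos ker_const_pos a_less by (simp add: local_const_def add_pos_pos)

text \<open>\<open>c / (1 - a)\<close> bounds the L^1 norm of \<open>incr 1\<close>, and 1 is the
  length of the window of fresh noise.\<close>

definition increment_const :: real where "increment_const = local_const * (c / (1 - a) + 1)"

lemma increment_const_pos: "0 < increment_const"
  using c_pos local_const_pos a_less by (simp add: increment_const_def add_pos_pos)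

end

text \<open>w lives on the whole line, so g is defined and controlled past the end of any interval;
  averages over \<open>[t, t + 1]\<close> use this near the right end.\<close>

locale fractional_integrand = fractional_kernel +
  fixes w :: "real \<Rightarrow> real ^ 'n"
  assumes w_measurable [measurable]: "w \<in> borel_measurable borel"
    and w_square: "integrable lborel (\<lambda>s. (norm (w s))\<^sup>2)"
begin

abbreviation g :: "real \<Rightarrow> real ^ 'n" where "g \<equiv> KH w"

definition W :: real where "W = (\<integral>s. (norm (w s))\<^sup>2 \<partial>lborel)"

lemma W_nonneg: "0 \<le> W"
  by (simp add: W_def)

abbreviation w2 :: "real \<Rightarrow> ennreal" where "w2 s \<equiv> ennreal ((norm (w s))\<^sup>2)"

lemma W_eq: "(\<integral>\<^sup>+s. w2 s \<partial>lborel) = ennreal W"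
  unfolding W_def by (rule nn_integral_eq_integral[OF w_square]) auto

lemma ker_w_integrable: "integrable lborel (\<lambda>s. ker t s *\<^sub>R w s)"
proof (rule Bochner_Integration.integrable_bound)
  show "integrable lborel (\<lambda>s. (ker t s)\<^sup>2 + (norm (w s))\<^sup>2)"
    by (intro Bochner_Integration.integrable_add ker_square_integrable w_square)
  show "AE s in lborel. norm (ker t s *\<^sub>R w s) \<le> norm ((ker t s)\<^sup>2 + (norm (w s))\<^sup>2)"
  proof (intro AE_I2)
    fix s
    have "ker t s * norm (w s) \<le> (ker t s)\<^sup>2 + (norm (w s))\<^sup>2"
      using sum_squares_bound[of "ker t s" "norm (w s)"] mult_nonneg_nonneg[OF ker_nonneg norm_ge_zero, of t s "w s"]
      by linarith
    then show "norm (ker t s *\<^sub>R w s) \<le> norm ((ker t s)\<^sup>2 + (norm (w s))\<^sup>2)"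
      using ker_nonneg[of t s] by simp
  qed
qed measurable

lemma g_0: "g 0 = 0"
  unfolding K_H_eq[OF w_measurable] by (simp add: ker_def)

text \<open>The increment splits at \<open>s = t\<close>: before t the kernels differ by at most
  \<open>incr h\<close>, after t the earlier kernel vanishes. The indicators are distributed over
  the factors as Cauchy-Schwarz will need them.\<close>

abbreviation head :: "real \<Rightarrow> real \<Rightarrow> ennreal" where
  "head h t \<equiv> \<integral>\<^sup>+s. (ennreal (incr h (t - s)) * indicator {0<..} s) * ennreal (norm (w s)) \<partial>lborel"

abbreviation tail :: "real \<Rightarrow> real \<Rightarrow> ennreal" where
  "tail h t \<equiv> \<integral>\<^sup>+s. (ennreal (ker (t + h) s) * indicator {t<..} s) * (ennreal (norm (w s)) * indicator {t<..<t + h} s) \<partial>lborel"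

lemma g_increment:
  assumes "0 \<le> t" "0 \<le> h"
  shows "ennreal (norm (g (t + h) - g t)) \<le>
     (head h t) +
     (tail h t)"
proof -
  have 1: "g (t + h) - g t = (\<integral>s. ker (t + h) s *\<^sub>R w s - ker t s *\<^sub>R w s \<partial>lborel)"
    unfolding K_H_eq[OF w_measurable] by (rule Bochner_Integration.integral_diff[symmetric]; rule ker_w_integrable)
  have "ennreal (norm (g (t + h) - g t)) \<le> (\<integral>\<^sup>+s. ennreal (norm (ker (t + h) s *\<^sub>R w s - ker t s *\<^sub>R w s)) \<partial>lborel)"
    unfolding 1 by (intro integral_norm_bound_ennreal Bochner_Integration.integrable_diff ker_w_integrable)
  also have "\<dots> \<le> (\<integral>\<^sup>+s. (ennreal (incr h (t - s)) * indicator {0<..} s) * ennreal (norm (w s)) +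
     (ennreal (ker (t + h) s) * indicator {t<..} s) * (ennreal (norm (w s)) * indicator {t<..<t + h} s) \<partial>lborel)"
  proof (rule nn_integral_mono_AE)
    \<comment> \<open>The point \<open>s = t\<close> belongs to neither regime and is discarded as a
      null set.\<close>
    show "AE s in lborel. ennreal (norm (ker (t + h) s *\<^sub>R w s - ker t s *\<^sub>R w s)) \<le>
       (ennreal (incr h (t - s)) * indicator {0<..} s) * ennreal (norm (w s)) +
     (ennreal (ker (t + h) s) * indicator {t<..} s) * (ennreal (norm (w s)) * indicator {t<..<t + h} s)"
      using AE_lborel_singleton[of t]
    proof eventually_elim
      case (elim s)
      have n: "norm (ker (t + h) s *\<^sub>R w s - ker t s *\<^sub>R w s) = \<bar>ker (t + h) s - ker t s\<bar> * norm (w s)"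
        by (simp add: scaleR_left_diff_distrib[symmetric])
      consider "s \<le> 0" | "0 < s" "s < t" | "t < s" "0 < s" "s < t + h" | "t < s" "t + h \<le> s"
        using elim assms by linarith
      then show ?case
      proof cases
        case 2
        have "\<bar>ker (t + h) s - ker t s\<bar> * norm (w s) \<le> incr h (t - s) * norm (w s)"
          using ker_diff[OF assms 2(2)] by (intro mult_right_mono) auto
        then have "ennreal (\<bar>ker (t + h) s - ker t s\<bar> * norm (w s)) \<le> ennreal (incr h (t - s)) * ennreal (norm (w s))"
          using incr_nonneg[OF assms(2)] by (simp add: ennreal_mult'[symmetric] ennreal_leI)
        then show ?thesis unfolding n using 2 by simp
      next
        case 3
        then show ?thesis unfolding n using ker_nonneg[of "t + h" s]
          by (simp add: ker_eq_0 ennreal_mult')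
      qed (use elim assms in \<open>auto simp: ker_eq_0\<close>)
    qed
  qed
  also have "\<dots> = (head h t) +
     (tail h t)"
    by (rule nn_integral_add) auto
  finally show ?thesis .
qed

lemma g_tail:
  assumes "0 \<le> t" "0 \<le> h"
  shows "(tail h t)\<^sup>2
    \<le> ennreal (ker_const * h powr (1 - 2 * a)) * (\<integral>\<^sup>+s\<in>{t<..<t + h}. w2 s \<partial>lborel)"
proof -
  have "(tail h t)\<^sup>2
    \<le> (\<integral>\<^sup>+s. (ennreal (ker (t + h) s) * indicator {t<..} s)\<^sup>2 \<partial>lborel) * (\<integral>\<^sup>+s. (ennreal (norm (w s)) * indicator {t<..<t + h} s)\<^sup>2 \<partial>lborel)"
    by (rule Cauchy_Schwarz_nn_integral) auto
  also have "(\<integral>\<^sup>+s. (ennreal (ker (t + h) s) * indicator {t<..} s)\<^sup>2 \<partial>lborel) = (\<integral>\<^sup>+s\<in>{t<..}. ennreal ((ker (t + h) s)\<^sup>2) \<partial>lborel)"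
    using ker_nonneg by (intro nn_integral_cong) (auto simp: indicator_def ennreal_power)
  also have "(\<integral>\<^sup>+s. (ennreal (norm (w s)) * indicator {t<..<t + h} s)\<^sup>2 \<partial>lborel) = (\<integral>\<^sup>+s\<in>{t<..<t + h}. w2 s \<partial>lborel)"
    by (intro nn_integral_cong) (auto simp: indicator_def ennreal_power)
  also have "(\<integral>\<^sup>+s\<in>{t<..}. ennreal ((ker (t + h) s)\<^sup>2) \<partial>lborel) \<le> ennreal (ker_const * h powr (1 - 2 * a))"
    using nn_integral_ker_square[of t "t + h"] assms by simp
  finally show ?thesis by (simp add: mult_right_mono)
qed

text \<open>Cauchy-Schwarz on both parts against the full energy W. Since
  \<open>1 - 2 * a = 2 * H\<close>, this is Hoelder continuity of order H. It gives the continuity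
  of g and the pointwise control at the ends of the interval, but integrating it in t would cost the
  length of the interval.\<close>

lemma g_Hoelder:
  assumes "0 \<le> t" "0 \<le> h"
  shows "(norm (g (t + h) - g t))\<^sup>2 \<le> Hoelder_const * h powr (1 - 2 * a) * W"
proof -
  have "(head h t)\<^sup>2 \<le> (\<integral>\<^sup>+s. (ennreal (incr h (t - s)) * indicator {0<..} s)\<^sup>2 \<partial>lborel) * (\<integral>\<^sup>+s. (ennreal (norm (w s)))\<^sup>2 \<partial>lborel)"
    by (rule Cauchy_Schwarz_nn_integral) auto
  also have "(\<integral>\<^sup>+s. (ennreal (incr h (t - s)) * indicator {0<..} s)\<^sup>2 \<partial>lborel) = (\<integral>\<^sup>+s\<in>{0<..}. ennreal ((incr h (t - s))\<^sup>2) \<partial>lborel)"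
    using incr_nonneg[OF assms(2)] by (intro nn_integral_cong) (auto simp: indicator_def ennreal_power)
  also have "(\<integral>\<^sup>+s. (ennreal (norm (w s)))\<^sup>2 \<partial>lborel) = ennreal W"
    by (simp add: W_eq ennreal_power)
  also have "(\<integral>\<^sup>+s\<in>{0<..}. ennreal ((incr h (t - s))\<^sup>2) \<partial>lborel) \<le> ennreal (c\<^sup>2 * h powr (1 - 2 * a) / (1 - 2 * a))"
    using assms by (intro nn_integral_incr_square)
  finally have I1: "(head h t)\<^sup>2 \<le> ennreal (c\<^sup>2 * h powr (1 - 2 * a) / (1 - 2 * a)) * ennreal W"
    by (simp add: mult_right_mono)
  have I2: "(tail h t)\<^sup>2 \<le> ennreal (ker_const * h powr (1 - 2 * a)) * ennreal W"
  proof (rule order_trans[OF g_tail[OF assms]], intro mult_left_mono)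
    show "(\<integral>\<^sup>+s\<in>{t<..<t + h}. w2 s \<partial>lborel) \<le> ennreal W"
      unfolding W_eq[symmetric] by (intro nn_integral_mono) (auto simp: indicator_def)
  qed auto
  have "ennreal ((norm (g (t + h) - g t))\<^sup>2) = (ennreal (norm (g (t + h) - g t)))\<^sup>2"
    by (simp add: ennreal_power)
  also have "\<dots> \<le> ((head h t) + (tail h t))\<^sup>2"
    using g_increment[OF assms] by (intro power_mono) auto
  also have "\<dots> \<le> 2 * ((head h t)\<^sup>2 + (tail h t)\<^sup>2)" by (rule ennreal_square_add_le)
  also have "\<dots> \<le> 2 * (ennreal (c\<^sup>2 * h powr (1 - 2 * a) / (1 - 2 * a)) * ennreal W + ennreal (ker_const * h powr (1 - 2 * a)) * ennreal W)"
    by (intro mult_left_mono add_mono I1 I2) auto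
  also have "\<dots> = ennreal (Hoelder_const * h powr (1 - 2 * a) * W)"
    using W_nonneg ker_const_pos a_less
    by (simp add: Hoelder_const_def ennreal_mult'[symmetric] ennreal_plus[symmetric] ennreal_numeral[symmetric] field_simps
        del: ennreal_plus ennreal_numeral)
  finally show ?thesis using Hoelder_const_pos W_nonneg by (simp add: ennreal_le_iff)
qed

lemma g_continuous: "continuous_on {0..} g"
proof -
  have "continuous (at x within {0..}) g" if x: "0 \<le> x" for x
  proof -
    have "((\<lambda>y. g y - g x) \<longlongrightarrow> 0) (at x within {0..})"
    proof (rule Lim_null_comparison)
      have "(norm (g y - g x))\<^sup>2 \<le> Hoelder_const * \<bar>y - x\<bar> powr (1 - 2 * a) * W" if "0 \<le> y" for y
        using g_Hoelder[of x "y - x"] g_Hoelder[of y "x - y"] that x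
        by (cases "x \<le> y") (auto simp: norm_minus_commute)
      then show "eventually (\<lambda>y. norm (g y - g x) \<le> sqrt (Hoelder_const * \<bar>y - x\<bar> powr (1 - 2 * a) * W)) (at x within {0..})"
        by (auto simp: eventually_at_filter intro!: always_eventually real_le_rsqrt)
      have "((\<lambda>y. sqrt (Hoelder_const * \<bar>y - x\<bar> powr (1 - 2 * a) * W)) \<longlongrightarrow> sqrt (Hoelder_const * \<bar>x - x\<bar> powr (1 - 2 * a) * W)) (at x within {0..})"
        using a_less by (intro tendsto_intros tendsto_powr') auto
      then show "((\<lambda>y. sqrt (Hoelder_const * \<bar>y - x\<bar> powr (1 - 2 * a) * W)) \<longlongrightarrow> 0) (at x within {0..})"
        by simp
    qed
    then show ?thesis unfolding continuous_within by (rule LIM_zero_cancel)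
  qed
  then show ?thesis by (simp add: continuous_on_eq_continuous_within)
qed

text \<open>G1 and G2 are local energies: \<open>w^2\<close> smoothed by the integrable kernel
  \<open>incr 1\<close>, and \<open>w^2\<close> on a unit window. Put in place of W, they can be
  integrated in t without a factor for the length.\<close>

definition G1 :: "real \<Rightarrow> ennreal" where
  "G1 t = (\<integral>\<^sup>+s. (ennreal (incr 1 (t - s)) * indicator {0<..} s) * w2 s \<partial>lborel)"

definition G2 :: "real \<Rightarrow> ennreal" where
  "G2 t = (\<integral>\<^sup>+s\<in>{t<..<t + 1}. w2 s \<partial>lborel)"

text \<open>The core of a Schur test: \<open>incr 1\<close> is split into two square roots; one
  factor integrates to \<open>c / (1 - a)\<close>, the other carries \<open>w^2\<close> into G1.
  Lags \<open>h \<le> 1\<close> reduce to lag 1 because \<open>incr\<close> is monotone in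
  h.\<close>

lemma g_increment_local:
  assumes "0 \<le> t" "0 \<le> h" "h \<le> 1"
  shows "ennreal ((norm (g (t + h) - g t))\<^sup>2) \<le> ennreal local_const * (G1 t + G2 t)"
proof -
  let ?q = "\<lambda>s. ennreal (sqrt (incr 1 (t - s))) * indicator {0<..} s"
  have q2: "(?q s)\<^sup>2 = ennreal (incr 1 (t - s)) * indicator {0<..} s" for s
    using incr_nonneg[of 1 "t - s"] by (auto simp: indicator_def ennreal_power)
  have "(head h t) \<le> (\<integral>\<^sup>+s. ?q s * (?q s * ennreal (norm (w s))) \<partial>lborel)"
  proof (intro nn_integral_mono)
    fix s
    have "?q s * (?q s * ennreal (norm (w s))) = ennreal (incr 1 (t - s)) * indicator {0<..} s * ennreal (norm (w s))"
      unfolding q2[symmetric] by (simp add: power2_eq_square mult.assoc)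
    then show "(ennreal (incr h (t - s)) * indicator {0<..} s) * ennreal (norm (w s)) \<le> ?q s * (?q s * ennreal (norm (w s)))"
      using incr_mono[OF assms(2,3)] by (auto intro!: mult_right_mono ennreal_leI)
  qed
  then have "(head h t)\<^sup>2 \<le> (\<integral>\<^sup>+s. ?q s * (?q s * ennreal (norm (w s))) \<partial>lborel)\<^sup>2"
    by (intro power_mono) auto
  also have "\<dots> \<le> (\<integral>\<^sup>+s. (?q s)\<^sup>2 \<partial>lborel) * (\<integral>\<^sup>+s. (?q s * ennreal (norm (w s)))\<^sup>2 \<partial>lborel)"
    by (rule Cauchy_Schwarz_nn_integral) auto
  also have "(\<integral>\<^sup>+s. (?q s * ennreal (norm (w s)))\<^sup>2 \<partial>lborel) = G1 t"
  proof -
    have "(?q s * ennreal (norm (w s)))\<^sup>2 = (?q s)\<^sup>2 * (ennreal (norm (w s)))\<^sup>2" for s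
      by (rule power_mult_distrib)
    then show ?thesis unfolding G1_def by (simp only: q2 ennreal_power norm_ge_zero)
  qed
  also have "(\<integral>\<^sup>+s. (?q s)\<^sup>2 \<partial>lborel) \<le> ennreal (c / (1 - a))"
    unfolding q2 using nn_integral_incr[of 1 t] assms by simp
  finally have I1: "(head h t)\<^sup>2 \<le> ennreal (c / (1 - a)) * G1 t" by (simp add: mult_right_mono)
  have "(tail h t)\<^sup>2 \<le> ennreal (ker_const * h powr (1 - 2 * a)) * (\<integral>\<^sup>+s\<in>{t<..<t + h}. w2 s \<partial>lborel)"
    by (rule g_tail[OF assms(1,2)])
  also have "\<dots> \<le> ennreal ker_const * G2 t"
  proof (intro mult_mono ennreal_leI)
    have "h powr (1 - 2 * a) \<le> 1" using assms a_less by (simp add: powr_le1)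
    then show "ker_const * h powr (1 - 2 * a) \<le> ker_const" using ker_const_pos by simp
    show "(\<integral>\<^sup>+s\<in>{t<..<t + h}. w2 s \<partial>lborel) \<le> G2 t"
      unfolding G2_def using assms by (intro nn_integral_mono) (auto simp: indicator_def)
  qed auto
  finally have I2: "(tail h t)\<^sup>2 \<le> ennreal ker_const * G2 t" .
  have "ennreal ((norm (g (t + h) - g t))\<^sup>2) = (ennreal (norm (g (t + h) - g t)))\<^sup>2"
    by (simp add: ennreal_power)
  also have "\<dots> \<le> ((head h t) + (tail h t))\<^sup>2"
    using g_increment[OF assms(1,2)] by (intro power_mono) auto
  also have "\<dots> \<le> 2 * ((head h t)\<^sup>2 + (tail h t)\<^sup>2)" by (rule ennreal_square_add_le)
  also have "\<dots> \<le> 2 * (ennreal (c / (1 - a)) * G1 t + ennreal ker_const * G2 t)"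
    by (intro mult_left_mono add_mono I1 I2) auto
  also have "\<dots> \<le> 2 * (ennreal (c / (1 - a) + ker_const) * G1 t + ennreal (c / (1 - a) + ker_const) * G2 t)"
    using ker_const_pos c_pos a_less by (intro mult_left_mono add_mono mult_right_mono ennreal_leI) auto
  also have "\<dots> = ennreal local_const * (G1 t + G2 t)"
  proof -
    have "ennreal local_const = 2 * ennreal (c / (1 - a) + ker_const)"
      unfolding local_const_def by (subst ennreal_mult') auto
    then show ?thesis by (simp add: distrib_left mult.assoc del: ennreal_plus)
  qed
  finally show ?thesis .
qed

text \<open>The other half of the Schur test, with s fixed and t integrated. The reflection
  \<open>t = L - x\<close> turns it into the integral over s, whose bound does not depend on the
  remaining length \<open>L - s\<close>.\<close>

lemma nn_integral_incr_left:
  "(\<integral>\<^sup>+t. ennreal (incr 1 (t - s)) * indicator {0..L} t \<partial>lborel) \<le> ennreal (c / (1 - a))"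
proof (cases "s \<le> L")
  case True
  have "(\<integral>\<^sup>+t. ennreal (incr 1 (t - s)) * indicator {0..L} t \<partial>lborel) =
    ennreal \<bar>- 1\<bar> * (\<integral>\<^sup>+x. ennreal (incr 1 (L + - 1 * x - s)) * indicator {0..L} (L + - 1 * x) \<partial>lborel)"
    by (rule nn_integral_real_affine) auto
  also have "\<dots> = (\<integral>\<^sup>+x. ennreal (incr 1 (L - x - s)) * indicator {0..L} (L - x) \<partial>lborel)"
    by simp
  also have "\<dots> \<le> (\<integral>\<^sup>+x\<in>{0<..}. ennreal (incr 1 ((L - s) - x)) \<partial>lborel)"
  proof (rule nn_integral_mono_AE)
    show "AE x in lborel. ennreal (incr 1 (L - x - s)) * indicator {0..L} (L - x) \<le> ennreal (incr 1 ((L - s) - x)) * indicator {0<..} x"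
      using AE_lborel_singleton[of 0]
      by eventually_elim (auto simp: indicator_def algebra_simps)
  qed
  also have "\<dots> \<le> ennreal (c * 1 powr (1 - a) / (1 - a))"
    using True by (intro nn_integral_incr) auto
  finally show ?thesis by simp
next
  case False
  then have "(\<integral>\<^sup>+t. ennreal (incr 1 (t - s)) * indicator {0..L} t \<partial>lborel) = (\<integral>\<^sup>+(t::real). 0 \<partial>lborel)"
    by (intro nn_integral_cong) (auto simp: indicator_def incr_def)
  then show ?thesis by simp
qed

lemma G1_measurable [measurable]: "G1 \<in> borel_measurable borel"
  unfolding G1_def by measurable

lemma G2_measurable [measurable]: "G2 \<in> borel_measurable borel"
proof -
  have "G2 = (\<lambda>t. \<integral>\<^sup>+s. w2 s * (if t < s \<and> s < t + 1 then 1 else 0) \<partial>lborel)"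
    by (auto simp: G2_def fun_eq_iff indicator_def intro!: nn_integral_cong)
  also have "\<dots> \<in> borel_measurable borel" by measurable
  finally show ?thesis .
qed

lemma nn_integral_G1: "(\<integral>\<^sup>+t\<in>{0..L}. G1 t \<partial>lborel) \<le> ennreal (c / (1 - a)) * ennreal W"
proof -
  let ?F = "\<lambda>s t. (ennreal (incr 1 (t - s)) * indicator {0<..} s) * w2 s * indicator {0..L} t"
  have "(\<integral>\<^sup>+t\<in>{0..L}. G1 t \<partial>lborel) =
     (\<integral>\<^sup>+t. (\<integral>\<^sup>+s. ?F s t \<partial>lborel) \<partial>lborel)"
    unfolding G1_def by (subst nn_integral_multc[symmetric]) auto
  also have "\<dots> = (\<integral>\<^sup>+s. (\<integral>\<^sup>+t. ?F s t \<partial>lborel) \<partial>lborel)"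
    by (rule lborel_pair.Fubini') measurable
  also have "\<dots> \<le> (\<integral>\<^sup>+s. ennreal (c / (1 - a)) * w2 s \<partial>lborel)"
  proof (rule nn_integral_mono)
    fix s :: real
    have "(\<integral>\<^sup>+t. ?F s t \<partial>lborel)
      \<le> (\<integral>\<^sup>+t. w2 s * (ennreal (incr 1 (t - s)) * indicator {0..L} t) \<partial>lborel)"
      by (intro nn_integral_mono) (auto simp: indicator_def mult_ac)
    also have "\<dots> = w2 s * (\<integral>\<^sup>+t. ennreal (incr 1 (t - s)) * indicator {0..L} t \<partial>lborel)"
      by (rule nn_integral_cmult) auto
    also have "\<dots> \<le> w2 s * ennreal (c / (1 - a))"
      by (intro mult_left_mono nn_integral_incr_left) auto
    finally show "(\<integral>\<^sup>+t. ?F s t \<partial>lborel)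
      \<le> ennreal (c / (1 - a)) * w2 s" by (simp add: mult.commute)
  qed
  also have "\<dots> = ennreal (c / (1 - a)) * ennreal W"
    by (subst nn_integral_cmult) (auto simp: W_eq)
  finally show ?thesis .
qed

lemma nn_integral_G2: "(\<integral>\<^sup>+t\<in>{0..L}. G2 t \<partial>lborel) \<le> ennreal W"
proof -
  have "(\<integral>\<^sup>+t\<in>{0..L}. G2 t \<partial>lborel) \<le> (\<integral>\<^sup>+t. G2 t \<partial>lborel)"
    by (intro nn_integral_mono) (auto simp: indicator_def)
  also have "\<dots> = (\<integral>\<^sup>+t. (\<integral>\<^sup>+s. w2 s * (if t < s \<and> s < t + 1 then 1 else 0) \<partial>lborel) \<partial>lborel)"
    unfolding G2_def by (auto simp: indicator_def intro!: nn_integral_cong)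
  also have "\<dots> = (\<integral>\<^sup>+s. (\<integral>\<^sup>+t. w2 s * (if t < s \<and> s < t + 1 then 1 else 0) \<partial>lborel) \<partial>lborel)"
    by (rule lborel_pair.Fubini') measurable
  also have "\<dots> = (\<integral>\<^sup>+s. w2 s \<partial>lborel)"
  proof (rule nn_integral_cong)
    fix s :: real
    have "(\<integral>\<^sup>+t. w2 s * (if t < s \<and> s < t + 1 then 1 else 0) \<partial>lborel)
      = (\<integral>\<^sup>+t. w2 s * indicator {s - 1<..<s} t \<partial>lborel)"
      by (intro nn_integral_cong) (auto simp: indicator_def)
    then show "(\<integral>\<^sup>+t. w2 s * (if t < s \<and> s < t + 1 then 1 else 0) \<partial>lborel) = w2 s"
      by (simp add: nn_integral_cmult)
  qed
  also have "\<dots> = ennreal W" by (rule W_eq)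
  finally show ?thesis .
qed

text \<open>Domination is phrased through an arbitrary bound m instead of a supremum over h, whose
  measurability would have to be discussed; only p itself is integrated. Suitable p are the
  averaging error and the normalized forcing.\<close>

lemma integral_dominated_by_increments:
  fixes p :: "real \<Rightarrow> real"
  assumes p: "continuous_on {0..L} p" "\<And>t. 0 \<le> p t"
    and dom: "\<And>t m. t \<in> {0..L} \<Longrightarrow> (\<And>h. 0 \<le> h \<Longrightarrow> h \<le> 1 \<Longrightarrow> norm (g (t + h) - g t) \<le> m) \<Longrightarrow> p t \<le> m"
  shows "integral {0..L} (\<lambda>t. (p t)\<^sup>2) \<le> increment_const * W"
proof -
  \<comment> \<open>G1 can be infinite at some t, since \<open>incr\<close> is unbounded near 0; the
    claim is trivial there.\<close>
  have le: "ennreal ((p t)\<^sup>2) \<le> ennreal local_const * (G1 t + G2 t)" if t: "t \<in> {0..L}" for t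
  proof (cases "ennreal local_const * (G1 t + G2 t) = top")
    case False
    then obtain m where m: "ennreal local_const * (G1 t + G2 t) = ennreal m" "0 \<le> m" by (metis ennreal_cases)
    have "norm (g (t + h) - g t) \<le> sqrt m" if "0 \<le> h" "h \<le> 1" for h
      using g_increment_local[of t h] that t m by (auto intro!: real_le_rsqrt simp: ennreal_le_iff)
    then have "p t \<le> sqrt m" using dom[OF t] by blast
    then have "(p t)\<^sup>2 \<le> m" using p(2)[of t] m(2) by (simp add: sqrt_ge_absD abs_of_nonneg)
    then show ?thesis using m by (simp add: ennreal_leI)
  qed simp
  have "((\<lambda>t. (p t)\<^sup>2) has_integral integral {0..L} (\<lambda>t. (p t)\<^sup>2)) {0..L}"
    by (intro integrable_integral integrable_continuous_real continuous_intros p)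
  then have "ennreal (integral {0..L} (\<lambda>t. (p t)\<^sup>2)) = (\<integral>\<^sup>+t\<in>{0..L}. ennreal ((p t)\<^sup>2) \<partial>lborel)"
    by (intro nn_integral_has_integral_lebesgue'[symmetric]) auto
  also have "\<dots> \<le> (\<integral>\<^sup>+t. ennreal local_const * (G1 t * indicator {0..L} t + G2 t * indicator {0..L} t) \<partial>lborel)"
    using le by (intro nn_integral_mono) (auto simp: indicator_def)
  also have "\<dots> = ennreal local_const * ((\<integral>\<^sup>+t\<in>{0..L}. G1 t \<partial>lborel) + (\<integral>\<^sup>+t\<in>{0..L}. G2 t \<partial>lborel))"
    by (subst nn_integral_cmult, simp, subst nn_integral_add, auto)
  also have "\<dots> \<le> ennreal local_const * (ennreal (c / (1 - a)) * ennreal W + ennreal W)"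
    by (intro mult_left_mono add_mono nn_integral_G1 nn_integral_G2) auto
  also have "\<dots> = ennreal (increment_const * W)"
    using local_const_pos W_nonneg c_pos a_less
    by (simp add: increment_const_def ennreal_mult'[symmetric] ennreal_plus[symmetric] del: ennreal_plus)
       (simp add: algebra_simps)
  finally show ?thesis
    using local_const_pos W_nonneg c_pos a_less by (simp add: ennreal_le_iff increment_const_def)
qed

end

section \<open>Borel representatives of L^2 functions, and primitives in the range of K_H\<close>

lemma lebesgue_measurable_borel_representative:
  fixes f :: "real \<Rightarrow> 'a::euclidean_space"
  assumes f: "f \<in> borel_measurable lebesgue"
  shows "\<exists>h\<in>borel_measurable borel. AE x in lborel. f x = h x"
proof -
  have "\<exists>h\<in>borel_measurable lborel. AE x in lborel. f x \<bullet> b = h x" for b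
    by (rule completion_ex_borel_measurable_real) (use f in measurable)
  then have "\<forall>b. \<exists>h. h \<in> borel_measurable borel \<and> (AE x in lborel. f x \<bullet> b = h x)" by auto
  from choice[OF this] obtain h where h: "\<And>b. h b \<in> borel_measurable borel" "\<And>b. AE x in lborel. f x \<bullet> b = h b x"
    by auto
  show ?thesis
  proof
    show "(\<lambda>x. \<Sum>b\<in>Basis. h b x *\<^sub>R b) \<in> borel_measurable borel"
      using h(1) by measurable
    have "AE x in lborel. \<forall>b\<in>Basis. f x \<bullet> b = h b x"
      using h(2) by (intro AE_ball_countable') (auto intro: countable_finite)
    then show "AE x in lborel. f x = (\<Sum>b\<in>Basis. h b x *\<^sub>R b)"
    proof eventually_elim
      case (elim x)
      then have "(\<Sum>b\<in>Basis. h b x *\<^sub>R b) = (\<Sum>b\<in>Basis. (f x \<bullet> b) *\<^sub>R b)" by simp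
      then show ?case by (simp only: euclidean_representation)
    qed
  qed
qed

context fractional_kernel begin

text \<open>\<open>L2_on\<close> constrains u on \<open>[0,L]\<close> only, and only up to
  completion. Extension by 0 and a Borel modification put w on the whole line against
  \<open>lborel\<close>, where Tonelli's theorem is available, without changing the energy or the
  values of K_H up to time L.\<close>

lemma L2_on_representative:
  fixes u :: "real \<Rightarrow> real ^ 'n"
  assumes u: "L2_on L u"
  obtains w :: "real \<Rightarrow> real ^ 'n" where "fractional_integrand a w"
    "(\<integral>s. (norm (w s))\<^sup>2 \<partial>lborel) = (LINT t:{0..L}|lebesgue. (norm (u t))\<^sup>2)"
    "\<And>t. t \<le> L \<Longrightarrow> KH u t = KH w t"
proof -
  let ?u = "\<lambda>s. indicator {0..L} s *\<^sub>R u s"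
  have um: "?u \<in> borel_measurable lebesgue" and ui: "integrable lebesgue (\<lambda>s. (norm (?u s))\<^sup>2)"
    using u by (auto simp: L2_on_def set_borel_measurable_def set_integrable_def power_mult_distrib
        power2_eq_square indicator_inter_arith[symmetric] mult_ac elim!: back_subst[of "integrable lebesgue"])
  obtain w where w: "w \<in> borel_measurable borel" and ae: "AE s in lborel. ?u s = w s"
    using lebesgue_measurable_borel_representative[OF um] by blast
  have ae': "AE s in lebesgue. ?u s = w s" using ae by (rule AE_completion)
  have ae2: "AE s in lebesgue. (norm (?u s))\<^sup>2 = (norm (w s))\<^sup>2"
    using ae' by eventually_elim (simp only:)
  have wm: "w \<in> borel_measurable lebesgue" using w by (intro measurable_completion) simp
  have "integrable lebesgue (\<lambda>s. (norm (w s))\<^sup>2)"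
    by (rule Bochner_Integration.integrable_cong_AE_imp[OF ui _ ae2]) (use wm in measurable)
  then have wi: "integrable lborel (\<lambda>s. (norm (w s))\<^sup>2)"
    using w by (subst (asm) integrable_completion) auto
  show ?thesis
  proof
    show "fractional_integrand a w"
      using w wi by unfold_locales auto
    have "(\<integral>s. (norm (w s))\<^sup>2 \<partial>lborel) = (\<integral>s. (norm (w s))\<^sup>2 \<partial>lebesgue)"
      using w by (intro integral_completion[symmetric]) auto
    also have "\<dots> = (\<integral>s. (norm (?u s))\<^sup>2 \<partial>lebesgue)"
      using ae2 by (intro integral_cong_AE borel_measurable_power measurable_compose[OF _ borel_measurable_norm] um wm) auto
    also have "\<dots> = (LINT t:{0..L}|lebesgue. (norm (u t))\<^sup>2)"
      unfolding set_lebesgue_integral_def by (intro Bochner_Integration.integral_cong) (auto simp: indicator_def)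
    finally show "(\<integral>s. (norm (w s))\<^sup>2 \<partial>lborel) = (LINT t:{0..L}|lebesgue. (norm (u t))\<^sup>2)" .
    show "KH u t = KH w t" if t: "t \<le> L" for t
    proof -
      have km: "ker t \<in> borel_measurable lebesgue" by (intro measurable_completion) simp
      have "KH u t = (\<integral>s. ker t s *\<^sub>R ?u s \<partial>lebesgue)"
        unfolding K_H_def set_lebesgue_integral_def using t
        by (intro integral_discrete_difference[of "{0, t}"]) (auto simp: ker_def indicator_def)
      also have "\<dots> = (\<integral>s. ker t s *\<^sub>R w s \<partial>lebesgue)"
      proof (rule integral_cong_AE[OF borel_measurable_scaleR[OF km um] borel_measurable_scaleR[OF km wm]])
        show "AE s in lebesgue. ker t s *\<^sub>R ?u s = ker t s *\<^sub>R w s"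
          using ae' by eventually_elim (simp only:)
      qed
      also have "\<dots> = (\<integral>s. ker t s *\<^sub>R w s \<partial>lborel)"
        using w by (intro integral_completion) auto
      finally show ?thesis using K_H_eq[OF w] by simp
    qed
  qed
qed

text \<open>Without this, \<open>K_H_\<sigma>_inv\<close> could be applied to a path outside the range of
  \<open>K_H_\<sigma>\<close>, where \<open>SOME\<close> returns an arbitrary function.\<close>

lemma K_H_surjective_on_primitives:
  fixes \<psi> :: "real \<Rightarrow> real ^ 'n"
  assumes cont: "continuous_on {0..L} \<psi>"
  obtains v where "L2_on L v" "\<And>t. t \<in> {0..L} \<Longrightarrow> KH v t = integral {0..t} \<psi>"
proof -
  let ?B = "Beta a (1 - a)"
  have B: "0 < ?B" unfolding Beta_def using a_pos a_less
    by (intro divide_pos_pos mult_pos_pos Gamma_real_pos) auto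
  define q where "q s = indicator {0..L} s *\<^sub>R \<psi> s" for s
  have [measurable]: "q \<in> borel_measurable borel"
    unfolding q_def using borel_measurable_continuous_on_indicator[OF _ cont] by simp
  have "bounded (\<psi> ` {0..L})"
    using compact_continuous_image[OF cont] compact_imp_bounded by blast
  then obtain M where M: "0 < M" "\<And>s. s \<in> {0..L} \<Longrightarrow> norm (\<psi> s) \<le> M"
    unfolding bounded_pos by auto
  then have qM: "norm (q s) \<le> M" for s by (auto simp: q_def indicator_def)
  define z where "z s r = (if 0 < r \<and> r < s then (s - r) powr (a - 1) * r powr a else 0)" for s r :: real
  have zm [measurable]: "(\<lambda>(s, r). z s r) \<in> borel_measurable (borel \<Otimes>\<^sub>M borel)"
    unfolding z_def by measurable
  have z0: "0 \<le> z s r" for s r by (simp add: z_def)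
  \<comment> \<open>The inversion formula applied to the primitive of \<open>\<psi>\<close>;
    \<open>1 / (c * ?B)\<close> cancels the constant of \<open>nn_integral_ker_Beta\<close>.\<close>
  define v where "v s = (s powr (- a) / (c * ?B)) *\<^sub>R (\<integral>r. z s r *\<^sub>R q r \<partial>lborel)" for s
  have [measurable]: "v \<in> borel_measurable borel"
    unfolding v_def by measurable
  have zint: "(\<integral>\<^sup>+r. ennreal (norm (z s r *\<^sub>R q r)) \<partial>lborel) \<le> ennreal (M * s powr a * (s powr a / a))" for s
  proof (cases "0 \<le> s")
    case True
    have "(\<integral>\<^sup>+r. ennreal (norm (z s r *\<^sub>R q r)) \<partial>lborel) \<le>
        (\<integral>\<^sup>+r. ennreal (M * s powr a) * (ennreal ((s - r) powr (a - 1)) * indicator {0<..<s} r) \<partial>lborel)"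
    proof (rule nn_integral_mono)
      fix r
      show "ennreal (norm (z s r *\<^sub>R q r)) \<le> ennreal (M * s powr a) * (ennreal ((s - r) powr (a - 1)) * indicator {0<..<s} r)"
      proof (cases "r \<in> {0<..<s}")
        case True
        have "(s - r) powr (a - 1) * (r powr a * norm (q r)) \<le> (s - r) powr (a - 1) * (s powr a * M)"
          using True a_pos qM by (intro mult_left_mono mult_mono powr_mono2) auto
        then show ?thesis using True M(1)
          by (simp add: z_def ennreal_mult'[symmetric] ennreal_leI mult_ac)
      qed (auto simp: z_def)
    qed
    also have "\<dots> = ennreal (M * s powr a) * ennreal ((s - 0) powr (a - 1 + 1) / (a - 1 + 1))"
      using nn_integral_powr_diff(2)[OF True, of "a - 1"] a_pos by (subst nn_integral_cmult) auto
    also have "\<dots> = ennreal (M * s powr a * (s powr a / a))"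
      using M(1) by (subst ennreal_mult'[symmetric]) auto
    finally show ?thesis .
  next
    case False
    then have "z s = (\<lambda>_. 0)" by (auto simp: z_def)
    then show ?thesis by simp
  qed
  have zi: "integrable lborel (\<lambda>r. z s r *\<^sub>R q r)" for s
    by (rule integrableI_bounded) (use zint[of s] in \<open>auto intro: le_less_trans\<close>)
  \<comment> \<open>The inner integral is of order \<open>s^(2a)\<close>, which beats the prefactor
    \<open>s^-a\<close>: v is bounded on \<open>[0,L]\<close> and so lies in L^2.\<close>
  have vle: "norm (v s) \<le> M / (c * ?B * a) * L powr a" if s: "s \<in> {0..L}" for s
  proof (cases "s = 0")
    case False
    with s have s: "0 < s" "s \<le> L" by auto
    have "ennreal (norm (\<integral>r. z s r *\<^sub>R q r \<partial>lborel)) \<le> ennreal (M * s powr a * (s powr a / a))"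
      using integral_norm_bound_ennreal[OF zi] zint by (rule order_trans)
    then have "norm (\<integral>r. z s r *\<^sub>R q r \<partial>lborel) \<le> M * s powr a * (s powr a / a)"
      using M(1) a_pos by (simp add: ennreal_le_iff)
    moreover have "norm (v s) = s powr (- a) / (c * ?B) * norm (\<integral>r. z s r *\<^sub>R q r \<partial>lborel)"
      using B c_pos by (simp add: v_def)
    ultimately have "norm (v s) \<le> s powr (- a) / (c * ?B) * (M * s powr a * (s powr a / a))"
      using B c_pos by (simp only:) (intro mult_left_mono, auto)
    also have "\<dots> = M / (c * ?B * a) * s powr a * (s powr (- a) * s powr a)"
      by simp
    also have "s powr (- a) * s powr a = 1" using s by (simp add: powr_add[symmetric])
    also have "M / (c * ?B * a) * s powr a * 1 = M / (c * ?B * a) * s powr a" by simp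
    also have "\<dots> \<le> M / (c * ?B * a) * L powr a"
      using s a_pos M(1) B c_pos by (intro mult_left_mono powr_mono2) auto
    finally show ?thesis .
  qed (use M(1) B c_pos a_pos in \<open>simp add: v_def\<close>)
  have "integrable lborel (\<lambda>s. indicator {0..L} s *\<^sub>R (norm (v s))\<^sup>2)"
    using vle by (intro integrableI_bounded_set_indicator[where B = "(M / (c * ?B * a) * L powr a)\<^sup>2"])
      (auto intro!: power_mono simp: emeasure_lborel_Icc_eq)
  then have L2: "L2_on L v"
    unfolding L2_on_def set_borel_measurable_def set_integrable_def
    by (auto intro!: measurable_completion simp: integrable_completion)
  have "KH v t = integral {0..t} \<psi>" if t: "t \<in> {0..L}" for t
  proof -
    \<comment> \<open>By the Beta identity d integrates in s to 1 if \<open>0 < r < t\<close> and to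
      0 otherwise; exchanging the integrals therefore leaves the plain integral of
      \<open>\<psi>\<close> over \<open>(0,t)\<close>.\<close>
    define d where "d s r = ker t s * (s powr (- a) / (c * ?B)) * z s r" for s r
    have d0: "0 \<le> d s r" for s r using ker_nonneg z0 c_pos B by (simp add: d_def)
    have dm [measurable]: "(\<lambda>(s, r). d s r) \<in> borel_measurable (borel \<Otimes>\<^sub>M borel)"
      unfolding d_def by measurable
    have di: "(\<integral>\<^sup>+s. ennreal (d s r) \<partial>lborel) = indicator {0<..<t} r" for r
    proof (cases "r \<in> {0<..<t}")
      case True
      have "(\<integral>\<^sup>+s. ennreal (d s r) \<partial>lborel) =
          (\<integral>\<^sup>+s. ennreal (r powr a / (c * ?B)) * (ennreal (ker t s * s powr (- a) * (s - r) powr (a - 1)) * indicator {r<..} s) \<partial>lborel)"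
      proof (rule nn_integral_cong)
        fix s
        show "ennreal (d s r) = ennreal (r powr a / (c * ?B)) * (ennreal (ker t s * s powr (- a) * (s - r) powr (a - 1)) * indicator {r<..} s)"
        proof (cases "r < s")
          case s: True
          then have "d s r = r powr a / (c * ?B) * (ker t s * s powr (- a) * (s - r) powr (a - 1))"
            using True by (simp add: d_def z_def)
          then have "ennreal (d s r) = ennreal (r powr a / (c * ?B)) * ennreal (ker t s * s powr (- a) * (s - r) powr (a - 1))"
            using B c_pos by (simp only:) (rule ennreal_mult', simp)
          with s show ?thesis by simp
        qed (simp add: d_def z_def)
      qed
      also have "\<dots> = ennreal (r powr a / (c * ?B)) * ennreal (c * ?B * r powr (- a))"
        using nn_integral_ker_Beta[of r t] True by (subst nn_integral_cmult) auto
      also have "\<dots> = ennreal (r powr a / (c * ?B) * (c * ?B * r powr (- a)))"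
        using B c_pos by (subst ennreal_mult') auto
      also have "r powr a / (c * ?B) * (c * ?B * r powr (- a)) = r powr a * r powr (- a)"
        using B c_pos by simp
      also have "\<dots> = 1" using True by (simp add: powr_add[symmetric])
      finally show ?thesis using True by simp
    next
      case False
      have "d s r = 0" for s
        using False by (cases "0 < r \<and> r < s") (auto simp: d_def z_def ker_eq_0)
      then show ?thesis using False by simp
    qed
    have int: "integrable (lborel \<Otimes>\<^sub>M lborel) (\<lambda>(s, r). d s r *\<^sub>R q r)"
    proof (rule integrableI_bounded)
      have "(\<integral>\<^sup>+x. ennreal (norm (case x of (s, r) \<Rightarrow> d s r *\<^sub>R q r)) \<partial>(lborel \<Otimes>\<^sub>M lborel)) =
         (\<integral>\<^sup>+r. (\<integral>\<^sup>+s. ennreal (d s r) * ennreal (norm (q r)) \<partial>lborel) \<partial>lborel)"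
        using d0 by (subst lborel_pair.nn_integral_snd[symmetric]) (auto simp: ennreal_mult')
      also have "\<dots> = (\<integral>\<^sup>+r. indicator {0<..<t} r * ennreal (norm (q r)) \<partial>lborel)"
        by (subst nn_integral_multc) (auto simp: di)
      also have "\<dots> \<le> (\<integral>\<^sup>+r. ennreal M * indicator {0<..<t} r \<partial>lborel)"
        using qM by (intro nn_integral_mono) (auto simp: indicator_def intro!: ennreal_leI)
      also have "\<dots> < \<infinity>" using t by (simp add: nn_integral_cmult ennreal_mult_less_top)
      finally show "(\<integral>\<^sup>+x. ennreal (norm (case x of (s, r) \<Rightarrow> d s r *\<^sub>R q r)) \<partial>(lborel \<Otimes>\<^sub>M lborel)) < \<infinity>" .
    qed measurable
    have "KH v t = (\<integral>s. ker t s *\<^sub>R v s \<partial>lborel)"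
      by (rule K_H_eq) measurable
    also have "\<dots> = (\<integral>s. (\<integral>r. d s r *\<^sub>R q r \<partial>lborel) \<partial>lborel)"
      by (intro Bochner_Integration.integral_cong) (auto simp: v_def d_def mult.assoc integral_scaleR_right[symmetric] simp del: integral_scaleR_right)
    also have "\<dots> = (\<integral>r. (\<integral>s. d s r *\<^sub>R q r \<partial>lborel) \<partial>lborel)"
      by (rule lborel_pair.Fubini_integral[OF int, symmetric])
    also have "\<dots> = (\<integral>r. indicator {0<..<t} r *\<^sub>R q r \<partial>lborel)"
    proof (intro Bochner_Integration.integral_cong refl)
      fix r
      have i: "integrable lborel (\<lambda>s. d s r)"
        by (rule integrableI_bounded) (use d0 di[of r] in \<open>auto simp: indicator_def\<close>)
      have "(\<integral>s. d s r \<partial>lborel) = enn2real (indicator {0<..<t} r)"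
        using d0 by (subst integral_eq_nn_integral) (auto simp: di)
      then show "(\<integral>s. d s r *\<^sub>R q r \<partial>lborel) = indicator {0<..<t} r *\<^sub>R q r"
        using i by (simp add: indicator_def)
    qed
    also have "\<dots> = (LINT r:{0<..<t}|lborel. q r)" by (simp add: set_lebesgue_integral_def)
    also have "\<dots> = integral {0<..<t} q"
      using t by (intro set_borel_integral_eq_integral(2)) (auto simp: set_integrable_def intro!: integrableI_bounded_set_indicator[where B = M] qM)
    also have "\<dots> = integral {0..t} q" by (simp add: integral_open_interval_real)
    also have "\<dots> = integral {0..t} \<psi>" using t by (intro integral_cong) (auto simp: q_def)
    finally show ?thesis .
  qed
  with L2 show ?thesis by (rule that)
qed

end

section \<open>The Young integral\<close>

lemma norm_matrix_vector_mult_le: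
  fixes A :: "real ^ 'n ^ 'm"
  shows "norm (A *v x) \<le> norm A * norm x"
proof -
  have "norm (A *v x) = L2_set (\<lambda>i. norm (A $ i \<bullet> x)) UNIV"
    by (simp add: norm_vec_def matrix_vector_mul_component)
  also have "\<dots> \<le> L2_set (\<lambda>i. norm (A $ i) * norm x) UNIV"
    by (intro L2_set_mono) (auto simp: Cauchy_Schwarz_ineq2)
  also have "\<dots> = norm A * norm x"
    by (simp add: norm_vec_def L2_set_left_distrib)
  finally show ?thesis .
qed

lemma bounded_bilinear_matrix_vector_mult:
  "bounded_bilinear ((*v) :: real ^ 'n ^ 'm \<Rightarrow> real ^ 'n \<Rightarrow> real ^ 'm)"
  by unfold_locales
    (auto simp: matrix_vector_mult_add_rdistrib matrix_vector_right_distrib scaleR_matrix_vector_assoc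
      matrix_vector_mult_scaleR intro!: exI[of _ 1] norm_matrix_vector_mult_le)

lemmas has_vector_derivative_matrix_vector_mult =
  bounded_bilinear.has_vector_derivative[OF bounded_bilinear_matrix_vector_mult]
lemmas continuous_on_matrix_vector_mult [continuous_intros] =
  bounded_bilinear.continuous_on[OF bounded_bilinear_matrix_vector_mult]
lemmas tendsto_matrix_vector_mult [tendsto_intros] =
  bounded_bilinear.tendsto[OF bounded_bilinear_matrix_vector_mult]

text \<open>The claimed value is the increment over \<open>[a,b]\<close> of \<open>?U\<close>, which
  telescopes over a tagged division. On a cell, the Stieltjes term and the increment of
  \<open>?U\<close> differ only by integrals of \<open>F' s\<close> applied to oscillations of g,
  which are small by uniform continuity.\<close>

lemma has_young_integral_by_parts:
  fixes F F' :: "real \<Rightarrow> real ^ 'n ^ 'n"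
  assumes ab: "a \<le> b"
    and F: "\<And>t. t \<in> {a..b} \<Longrightarrow> (F has_vector_derivative F' t) (at t within {a..b})"
    and F': "continuous_on {a..b} F'" and g: "continuous_on {a..b} g"
  shows "has_young_integral F g a b (F b *v g b - F a *v g a - integral {a..b} (\<lambda>s. F' s *v g s))"
  unfolding has_young_integral_def
proof (intro allI impI)
  let ?I = "F b *v g b - F a *v g a - integral {a..b} (\<lambda>s. F' s *v g s)"
  let ?S = "\<lambda>p. \<Sum>(x, K)\<in>p. F x *v (g (Sup K) - g (Inf K))"
  fix e :: real assume e: "0 < e"
  have int: "(\<lambda>s. F' s *v h s) integrable_on {u..v}" if "{u..v} \<subseteq> {a..b}" "continuous_on {a..b} h" for u v h
    using that F' by (intro integrable_continuous_real continuous_intros) (auto elim: continuous_on_subset)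
  have "bounded (F' ` {a..b})"
    using compact_continuous_image[OF F'] compact_imp_bounded by blast
  then obtain B where B: "0 < B" "\<And>s. s \<in> {a..b} \<Longrightarrow> norm (F' s) \<le> B"
    unfolding bounded_pos by auto
  \<comment> \<open>Chosen so that the total error \<open>B * w * (b - a)\<close> stays below e; the
    \<open>+ 1\<close> covers \<open>a = b\<close>.\<close>
  define w where "w = e / (2 * B * (b - a + 1))"
  have w: "0 < w" using e B ab by (simp add: w_def)
  have "uniformly_continuous_on {a..b} g"
    by (rule compact_uniformly_continuous[OF g]) auto
  then obtain \<delta> where \<delta>: "0 < \<delta>" "\<And>s t. s \<in> {a..b} \<Longrightarrow> t \<in> {a..b} \<Longrightarrow> dist t s < \<delta> \<Longrightarrow> dist (g t) (g s) < w"
    unfolding uniformly_continuous_on_def using w by meson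
  let ?U = "\<lambda>t. F t *v g t - integral {a..t} (\<lambda>s. F' s *v g s)"
  show "\<exists>d>0. \<forall>p. p tagged_division_of {a..b} \<and> (\<lambda>x. ball x d) fine p \<longrightarrow>
    norm (?S p - ?I) < e"
  \<comment> \<open>Two points of a cell are each within \<open>\<delta> / 2\<close> of its tag,
    hence within \<open>\<delta>\<close> of each other.\<close>
  proof (intro exI[of _ "\<delta> / 2"] conjI allI impI)
    fix p assume p: "p tagged_division_of {a..b} \<and> (\<lambda>x. ball x (\<delta> / 2)) fine p"
    have tele: "(\<Sum>(x, K)\<in>p. ?U (Sup K) - ?U (Inf K)) = ?I"
      using additive_tagged_division_1[OF ab, of p ?U] p by simp
    have len: "(\<Sum>(x, K)\<in>p. Sup K - Inf K) = b - a"
      using additive_tagged_division_1[OF ab, of p "\<lambda>x. x"] p by simp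
    have loc: "norm (F x *v (g (Sup K) - g (Inf K)) - (?U (Sup K) - ?U (Inf K))) \<le> B * w * (Sup K - Inf K)"
      if xK: "(x, K) \<in> p" for x K
    proof -
      obtain u v where K: "K = {u..v}"
        using tagged_division_ofD(4)[of p "{a..b}" x K] p xK by auto
      have x: "u \<le> x" "x \<le> v" and sub: "{u..v} \<subseteq> {a..b}"
        using tagged_division_ofD(2,3)[of p "{a..b}" x K] p xK K by auto
      have xab: "a \<le> u" "v \<le> b" using sub x by auto
      have close: "dist (g s) (g t) < w" if "s \<in> {u..v}" "t \<in> {u..v}" for s t
      proof -
        have "K \<subseteq> ball x (\<delta> / 2)" using fineD[of _ p x K] p xK by blast
        then have "dist x s < \<delta> / 2" "dist x t < \<delta> / 2" using that K by auto
        then have "dist s t < \<delta>" by (metis dist_commute dist_triangle_half_l)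
        then show ?thesis using \<delta>(2)[of t s] that sub by blast
      qed
      have FTC: "((\<lambda>s. F' s *v z) has_integral F v' *v z - F u' *v z) {u'..v'}"
        if "a \<le> u'" "u' \<le> v'" "v' \<le> b" for u' v' z
      proof (rule fundamental_theorem_of_calculus)
        fix s assume "s \<in> {u'..v'}"
        then have "(F has_vector_derivative F' s) (at s within {u'..v'})"
          using F[of s] that by (auto intro: has_vector_derivative_within_subset)
        from has_vector_derivative_matrix_vector_mult[OF this has_vector_derivative_const[of z]]
        show "((\<lambda>s. F s *v z) has_vector_derivative F' s *v z) (at s within {u'..v'})" by simp
      qed (use that in auto)
      have bound: "norm (integral {u'..v'} (\<lambda>s. F' s *v (g z - g s))) \<le> B * w * (v' - u')"
        if "u \<le> u'" "u' \<le> v'" "v' \<le> v" "z \<in> {u..v}" for u' v' z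
      proof (rule integral_bound)
        show "continuous_on {u'..v'} (\<lambda>s. F' s *v (g z - g s))"
          using that xab by (intro continuous_intros continuous_on_subset[OF F'] continuous_on_subset[OF g]) auto
        fix s assume s: "s \<in> {u'..v'}"
        have "norm (F' s *v (g z - g s)) \<le> norm (F' s) * norm (g z - g s)"
          by (rule norm_matrix_vector_mult_le)
        also have "\<dots> \<le> B * w"
          using B(2)[of s] close[of z s] s that xab B(1)
          by (intro mult_mono) (auto simp: dist_norm)
        finally show "norm (F' s *v (g z - g s)) \<le> B * w" .
      qed (use that in auto)
      have split: "integral {u'..v'} (\<lambda>s. F' s *v (g z - g s)) = (F v' *v g z - F u' *v g z) - integral {u'..v'} (\<lambda>s. F' s *v g s)"
        if "u \<le> u'" "u' \<le> v'" "v' \<le> v" for u' v' z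
      proof -
        have "((\<lambda>s. F' s *v g z - F' s *v g s) has_integral (F v' *v g z - F u' *v g z) - integral {u'..v'} (\<lambda>s. F' s *v g s)) {u'..v'}"
          using that xab by (intro has_integral_diff FTC integrable_integral int g) auto
        then show ?thesis by (simp add: matrix_vector_mult_diff_distrib integral_unique)
      qed
      have "integral {a..u} (\<lambda>s. F' s *v g s) + integral {u..x} (\<lambda>s. F' s *v g s) = integral {a..x} (\<lambda>s. F' s *v g s)"
        using x xab by (intro Henstock_Kurzweil_Integration.integral_combine int g) auto
      moreover have "integral {a..x} (\<lambda>s. F' s *v g s) + integral {x..v} (\<lambda>s. F' s *v g s) = integral {a..v} (\<lambda>s. F' s *v g s)"
        using x xab by (intro Henstock_Kurzweil_Integration.integral_combine int g) auto
      ultimately have comb: "integral {a..v} (\<lambda>s. F' s *v g s) = integral {a..u} (\<lambda>s. F' s *v g s)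
          + integral {u..x} (\<lambda>s. F' s *v g s) + integral {x..v} (\<lambda>s. F' s *v g s)"
        by simp
      have "F x *v (g v - g u) - (?U v - ?U u) =
          - (integral {x..v} (\<lambda>s. F' s *v (g v - g s)) + integral {u..x} (\<lambda>s. F' s *v (g u - g s)))"
        unfolding split[OF x(1) x(2) order_refl] split[OF order_refl x(1) x(2)] comb
        by (simp add: matrix_vector_mult_diff_distrib algebra_simps)
      then have "norm (F x *v (g v - g u) - (?U v - ?U u)) \<le>
          norm (integral {x..v} (\<lambda>s. F' s *v (g v - g s))) + norm (integral {u..x} (\<lambda>s. F' s *v (g u - g s)))"
        by (simp only: norm_minus_cancel norm_triangle_ineq)
      also have "\<dots> \<le> B * w * (v - x) + B * w * (x - u)"
        using x by (intro add_mono bound) auto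
      finally show ?thesis using x K by (simp add: algebra_simps)
    qed
    have "norm (?S p - ?I)
      = norm (\<Sum>(x, K)\<in>p. F x *v (g (Sup K) - g (Inf K)) - (?U (Sup K) - ?U (Inf K)))"
      unfolding tele[symmetric] by (simp add: sum_subtractf[symmetric] case_prod_beta)
    also have "\<dots> \<le> (\<Sum>(x, K)\<in>p. B * w * (Sup K - Inf K))"
      by (rule sum_norm_le) (use loc in auto)
    also have "\<dots> = B * w * (b - a)"
      unfolding len[symmetric] by (simp add: sum_distrib_left case_prod_beta)
    also have "\<dots> = e * ((b - a) / (2 * (b - a + 1)))" using B(1) by (simp add: w_def)
    also have "\<dots> < e * 1" using e ab by (intro mult_strict_left_mono) (auto simp: field_simps)
    finally show "norm (?S p - ?I) < e"
      by simp
  qed (use \<delta> in auto)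
qed

lemma has_young_integral_unique:
  assumes I: "has_young_integral F g a b I" and J: "has_young_integral F g a b J"
  shows "I = J"
proof (rule ccontr)
  assume "I \<noteq> J"
  then have e: "0 < norm (I - J) / 2" by simp
  obtain d1 where d1: "0 < d1" "\<And>p. p tagged_division_of {a..b} \<Longrightarrow> (\<lambda>x. ball x d1) fine p \<Longrightarrow>
        norm ((\<Sum>(x, K)\<in>p. F x *v (g (Sup K) - g (Inf K))) - I) < norm (I - J) / 2"
    using I e unfolding has_young_integral_def by meson
  obtain d2 where d2: "0 < d2" "\<And>p. p tagged_division_of {a..b} \<Longrightarrow> (\<lambda>x. ball x d2) fine p \<Longrightarrow>
        norm ((\<Sum>(x, K)\<in>p. F x *v (g (Sup K) - g (Inf K))) - J) < norm (I - J) / 2"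
    using J e unfolding has_young_integral_def by meson
  obtain p where p: "p tagged_division_of {a..b}" "(\<lambda>x. ball x (min d1 d2)) fine p"
    using fine_division_exists_real[OF gauge_ball[of "min d1 d2"]] d1 d2 by auto
  then have fine: "(\<lambda>x. ball x d1) fine p" "(\<lambda>x. ball x d2) fine p"
    unfolding fine_def by fastforce+
  let ?S = "\<Sum>(x, K)\<in>p. F x *v (g (Sup K) - g (Inf K))"
  have "norm (I - J) \<le> norm (?S - J) + norm (?S - I)"
    using norm_triangle_ineq4[of "?S - J" "?S - I"] by simp
  then show False
    using d1(2)[OF p(1) fine(1)] d2(2)[OF p(1) fine(2)] by linarith
qed

lemma young_integral_eq: "has_young_integral F g a b I \<Longrightarrow> young_integral F g a b = I"
  unfolding young_integral_def using has_young_integral_unique by blast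

text \<open>Replaces the description operator in \<open>K_H_\<sigma>\<close> by a formula that is
  visibly linear in \<open>K_H H u\<close>. The boundary term at 0 drops out because K_H starts at
  0.\<close>

lemma K_H_\<sigma>_by_parts:
  fixes \<Sigma> \<Sigma>' :: "real \<Rightarrow> real ^ 'n ^ 'n"
  assumes t: "0 \<le> t"
    and \<Sigma>: "\<And>s. 0 \<le> s \<Longrightarrow> (\<Sigma> has_vector_derivative \<Sigma>' s) (at s within {0..})"
    and \<Sigma>': "continuous_on {0..} \<Sigma>'" and g: "continuous_on {0..t} (K_H H u)" "K_H H u 0 = 0"
  shows "K_H_\<sigma> H \<Sigma> u t = \<Sigma> t *v K_H H u t - integral {0..t} (\<lambda>s. \<Sigma>' s *v K_H H u s)"
proof -
  have "has_young_integral \<Sigma> (K_H H u) 0 t (\<Sigma> t *v K_H H u t - \<Sigma> 0 *v K_H H u 0 - integral {0..t} (\<lambda>s. \<Sigma>' s *v K_H H u s))"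
  proof (rule has_young_integral_by_parts[OF t])
    show "(\<Sigma> has_vector_derivative \<Sigma>' s) (at s within {0..t})" if "s \<in> {0..t}" for s
      by (rule has_vector_derivative_within_subset[OF \<Sigma>]) (use that in auto)
    show "continuous_on {0..t} \<Sigma>'" by (rule continuous_on_subset[OF \<Sigma>']) auto
  qed (rule g)
  from young_integral_eq[OF this] show ?thesis using g(2) unfolding K_H_\<sigma>_def by simp
qed

section \<open>Hyperbolic linear systems\<close>

abbreviation square_norm :: "real \<Rightarrow> (real \<Rightarrow> 'a::real_normed_vector) \<Rightarrow> real" where
  "square_norm L f \<equiv> integral {0..L} (\<lambda>t. (norm (f t))\<^sup>2)"

text \<open>A real R may have nonreal eigenvalues, and the estimate splits off one linear factor at
  a time; hence the passage to complex vectors. \<open>cvec\<close> preserves norms, so estimates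
  transfer back unchanged.\<close>

definition cmat :: "real ^ 'n ^ 'm \<Rightarrow> complex ^ 'n ^ 'm" where
  "cmat A = (\<chi> i j. complex_of_real (A $ i $ j))"

definition cvec :: "real ^ 'n \<Rightarrow> complex ^ 'n" where
  "cvec v = (\<chi> i. complex_of_real (v $ i))"

lemma norm_cvec [simp]: "norm (cvec v) = norm v"
  by (simp add: norm_vec_def cvec_def)

lemma cmat_cvec: "cmat A *v cvec v = cvec (A *v v)"
  by (simp add: cmat_def cvec_def matrix_vector_mult_def vec_eq_iff)

lemma cvec_linear: "bounded_linear cvec"
  by (rule linear_conv_bounded_linear[THEN iffD1], rule linearI) (auto simp: cvec_def vec_eq_iff scaleR_conv_of_real[where 'a = complex])

lemma complex_matrix_vector_linear: "bounded_linear ((*v) (A :: complex ^ 'n ^ 'm))"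
  by (rule linear_conv_bounded_linear[THEN iffD1], rule linearI)
     (auto simp: matrix_vector_right_distrib matrix_vector_mult_def vec_eq_iff sum_distrib_left scaleR_conv_of_real[where 'a = complex]
        sum.distrib algebra_simps)

lemma smult_complex_linear: "bounded_linear (\<lambda>y :: complex ^ 'n. \<mu> *s y)"
  by (rule linear_conv_bounded_linear[THEN iffD1], rule linearI)
     (auto simp: vec_eq_iff scaleR_conv_of_real[where 'a = complex] algebra_simps)

text \<open>The real inner product on complex vectors is the real part of the Hermitian one, so the
  rotation by the imaginary part of \<mu> does not affect the growth of the norm.\<close>

lemma inner_smult_complex: "y \<bullet> (\<mu> *s y) = Re \<mu> * (norm y)\<^sup>2" for y :: "complex ^ 'n"
proof -
  have "y $ i \<bullet> (\<mu> * y $ i) = Re \<mu> * (norm (y $ i))\<^sup>2" for i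
    by (simp only: cmod_power2 inner_complex_def) (simp add: algebra_simps power2_eq_square)
  then show ?thesis
    by (simp add: inner_vec_def norm_vec_def L2_set_def sum_nonneg sum_distrib_left)
qed

text \<open>The derivative of the squared norm is integrated with the sign of
  \<open>Re \<mu>\<close> in front, which treats growth and decay at once. The cross term is
  absorbed by \<open>2 * x * z \<le> r * x^2 + z^2 / r\<close> with
  \<open>r = \<bar>Re \<mu>\<bar>\<close>. Charging both end values, instead of propagating one of
  them, keeps L out of the constant.\<close>

lemma scalar_hyperbolic_estimate:
  fixes y f :: "real \<Rightarrow> complex ^ 'n"
  assumes L: "0 \<le> L" and re: "Re \<mu> \<noteq> 0"
    and y: "\<And>t. t \<in> {0..L} \<Longrightarrow> (y has_vector_derivative \<mu> *s y t + f t) (at t within {0..L})"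
    and f: "continuous_on {0..L} f"
  shows "square_norm L y \<le>
     (1 / (Re \<mu>)\<^sup>2) * square_norm L f
     + (1 / \<bar>Re \<mu>\<bar>) * ((norm (y 0))\<^sup>2 + (norm (y L))\<^sup>2)"
proof -
  have yc: "continuous_on {0..L} y"
    using y by (rule continuous_on_vector_derivative)
  let ?r = "\<bar>Re \<mu>\<bar>"
  have r: "0 < ?r" using re by simp
  have "((\<lambda>t. y t \<bullet> y t) has_vector_derivative 2 * (y t \<bullet> (\<mu> *s y t + f t))) (at t within {0..L})"
    if "t \<in> {0..L}" for t
    using bounded_bilinear.has_vector_derivative[OF bounded_bilinear_inner y[OF that] y[OF that]]
    by (simp add: inner_commute)
  then have 1: "((\<lambda>t. 2 * (y t \<bullet> (\<mu> *s y t + f t))) has_integral y L \<bullet> y L - y 0 \<bullet> y 0) {0..L}"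
    by (intro fundamental_theorem_of_calculus L)
  have I1: "((\<lambda>t. sgn (Re \<mu>) * (2 * (y t \<bullet> (\<mu> *s y t + f t)))) has_integral
      sgn (Re \<mu>) * (y L \<bullet> y L - y 0 \<bullet> y 0)) {0..L}"
    by (intro has_integral_mult_right 1)
  have I2: "((\<lambda>t. ?r * (norm (y t))\<^sup>2 - (1 / ?r) * (norm (f t))\<^sup>2) has_integral
      ?r * square_norm L y - (1 / ?r) * square_norm L f) {0..L}"
    by (intro has_integral_diff has_integral_mult_right integrable_integral integrable_continuous_real
        continuous_intros yc f)
  have "?r * square_norm L y - (1 / ?r) * square_norm L f
      \<le> sgn (Re \<mu>) * (y L \<bullet> y L - y 0 \<bullet> y 0)"
  proof (rule has_integral_le[OF I2 I1])
    fix t assume "t \<in> {0..L}"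
    have "\<bar>y t \<bullet> f t\<bar> \<le> norm (y t) * norm (f t)" by (rule Cauchy_Schwarz_ineq2)
    moreover have "2 * (norm (y t) * norm (f t)) \<le> ?r * (norm (y t))\<^sup>2 + (1 / ?r) * (norm (f t))\<^sup>2"
    proof -
      have "0 \<le> (?r * norm (y t) - norm (f t))\<^sup>2 / ?r" using r by (intro divide_nonneg_pos) auto
      also have "\<dots> = ?r * (norm (y t))\<^sup>2 + (1 / ?r) * (norm (f t))\<^sup>2 - 2 * (norm (y t) * norm (f t))"
        using r by (simp add: power2_eq_square field_simps)
      finally show ?thesis by simp
    qed
    moreover have "\<bar>sgn (Re \<mu>) * (y t \<bullet> f t)\<bar> \<le> \<bar>y t \<bullet> f t\<bar>"
      using re by (simp add: abs_mult)
    moreover have "sgn (Re \<mu>) * (2 * (y t \<bullet> (\<mu> *s y t + f t))) = 2 * ?r * (norm (y t))\<^sup>2 + 2 * (sgn (Re \<mu>) * (y t \<bullet> f t))"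
      by (simp add: inner_add_right inner_smult_complex algebra_simps abs_sgn)
    ultimately show "?r * (norm (y t))\<^sup>2 - (1 / ?r) * (norm (f t))\<^sup>2 \<le> sgn (Re \<mu>) * (2 * (y t \<bullet> (\<mu> *s y t + f t)))"
      by linarith
  qed
  also have "\<dots> \<le> (norm (y 0))\<^sup>2 + (norm (y L))\<^sup>2"
    using re by (cases "Re \<mu> > 0") (auto simp: power2_norm_eq_inner)
  finally have "?r * square_norm L y \<le>
     (1 / ?r) * square_norm L f + ((norm (y 0))\<^sup>2 + (norm (y L))\<^sup>2)" by linarith
  then have "square_norm L y \<le>
     ((1 / ?r) * square_norm L f + ((norm (y 0))\<^sup>2 + (norm (y L))\<^sup>2)) / ?r"
    by (simp only: pos_le_divide_eq[OF r] mult.commute[of _ ?r])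
  also have "\<dots> = (1 / (Re \<mu>)\<^sup>2) * square_norm L f
     + (1 / \<bar>Re \<mu>\<bar>) * ((norm (y 0))\<^sup>2 + (norm (y L))\<^sup>2)"
    by (simp add: add_divide_distrib power2_eq_square algebra_simps)
  finally show ?thesis .
qed

section \<open>Annihilating polynomials and reduction to scalar equations\<close>

definition poly_act :: "complex poly \<Rightarrow> complex ^ 'n ^ 'n \<Rightarrow> complex ^ 'n \<Rightarrow> complex ^ 'n" where
  "poly_act p A y = (\<Sum>i\<le>degree p. coeff p i *s (((*v) A ^^ i) y))"

lemma poly_act_eq:
  assumes "degree p \<le> n"
  shows "poly_act p A y = (\<Sum>i\<le>n. coeff p i *s (((*v) A ^^ i) y))"
  unfolding poly_act_def using assms
  by (intro sum.mono_neutral_left) (auto simp: coeff_eq_0)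

lemma poly_act_linear_factor:
  "poly_act ([:- \<mu>, 1:] * q) A y = poly_act q A (A *v y - \<mu> *s y)"
proof -
  let ?T = "(*v) A" and ?n = "degree q"
  have pow_diff: "(?T ^^ i) (A *v y - \<mu> *s y) = (?T ^^ Suc i) y - \<mu> *s (?T ^^ i) y" for i
    by (induction i) (auto simp: matrix_vector_mult_diff_distrib vector_scalar_commute)
  have deg: "degree ([:- \<mu>, 1:] * q) \<le> Suc ?n"
    using degree_mult_le[of "[:- \<mu>, 1:]" q] by simp
  have co: "coeff ([:- \<mu>, 1:] * q) i = (case i of 0 \<Rightarrow> 0 | Suc j \<Rightarrow> coeff q j) - \<mu> * coeff q i" for i
    by (cases i) auto
  have "poly_act ([:- \<mu>, 1:] * q) A y =
      (\<Sum>i\<le>Suc ?n. (case i of 0 \<Rightarrow> 0 | Suc j \<Rightarrow> coeff q j) *s (?T ^^ i) y) - (\<Sum>i\<le>Suc ?n. (\<mu> * coeff q i) *s (?T ^^ i) y)"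
    unfolding poly_act_eq[OF deg] co by (simp only: vector_sub_rdistrib sum_subtractf)
  also have "(\<Sum>i\<le>Suc ?n. (case i of 0 \<Rightarrow> 0 | Suc j \<Rightarrow> coeff q j) *s (?T ^^ i) y) = (\<Sum>i\<le>?n. coeff q i *s (?T ^^ Suc i) y)"
    by (subst sum.atMost_Suc_shift) simp
  also have "(\<Sum>i\<le>Suc ?n. (\<mu> * coeff q i) *s (?T ^^ i) y) = (\<Sum>i\<le>?n. (\<mu> * coeff q i) *s (?T ^^ i) y)"
    by (simp add: coeff_eq_0)
  also have "(\<Sum>i\<le>?n. coeff q i *s (?T ^^ Suc i) y) - (\<Sum>i\<le>?n. (\<mu> * coeff q i) *s (?T ^^ i) y) =
      (\<Sum>i\<le>?n. coeff q i *s (?T ^^ i) (A *v y - \<mu> *s y))"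
    unfolding pow_diff by (simp add: sum_subtractf[symmetric] vector_ssub_ldistrib vector_smult_assoc mult.commute)
  finally show ?thesis by (simp add: poly_act_def)
qed

text \<open>One more power of A than the real dimension of the matrix space must be linearly
  dependent. The roots of p need not be eigenvalues, because the induction on the degree copes with
  an arbitrary root.\<close>

lemma ex_annihilating_poly:
  fixes A :: "complex ^ 'n ^ 'n"
  shows "\<exists>p. p \<noteq> 0 \<and> (\<forall>y. poly_act p A y = 0)"
proof -
  define M where "M i = ((**) A ^^ i) (mat 1)" for i
  have M: "M i *v y = ((*v) A ^^ i) y" for i y
    by (induction i) (auto simp: M_def matrix_vector_mul_assoc[symmetric])
  let ?N = "DIM(complex ^ 'n ^ 'n)"
  have "\<exists>c. (\<exists>i\<le>?N. c i \<noteq> 0) \<and> (\<Sum>i\<le>?N. c i *\<^sub>R M i) = 0"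
  proof (cases "inj_on M {..?N}")
    case True
    then have "card (M ` {..?N}) = Suc ?N" by (simp add: card_image)
    then have "dependent (M ` {..?N})" by (intro dependent_biggerset) auto
    then obtain u where u: "\<exists>v\<in>M ` {..?N}. u v \<noteq> 0" "(\<Sum>v\<in>M ` {..?N}. u v *\<^sub>R v) = 0"
      by (auto simp: dependent_finite)
    then have "(\<Sum>i\<le>?N. u (M i) *\<^sub>R M i) = 0" using True by (simp add: sum.reindex)
    with u(1) show ?thesis by (intro exI[of _ "\<lambda>i. u (M i)"]) auto
  next
    \<comment> \<open>If two powers coincide, the set of powers is too small for the dimension
      count, but their difference is already a relation.\<close>
    case False
    then obtain i j where ij: "i \<le> ?N" "j \<le> ?N" "i \<noteq> j" "M i = M j" by (auto simp: inj_on_def)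
    have "(\<Sum>m\<le>?N. ((if m = i then 1 else 0) - (if m = j then 1 else 0)) *\<^sub>R M m) = M i - M j"
      using ij by (simp add: scaleR_left_diff_distrib sum_subtractf if_distrib[of "\<lambda>x. x *\<^sub>R _"] sum.delta cong: if_cong)
    with ij show ?thesis
      by (intro exI[of _ "\<lambda>m. (if m = i then 1 else 0) - (if m = j then 1 else 0)"]) auto
  qed
  then obtain c where c: "\<exists>i\<le>?N. c i \<noteq> 0" "(\<Sum>i\<le>?N. c i *\<^sub>R M i) = 0" by blast
  define p where "p = (\<Sum>i\<le>?N. monom (complex_of_real (c i)) i)"
  have cp: "coeff p m = (if m \<le> ?N then complex_of_real (c m) else 0)" for m
    by (simp add: p_def coeff_sum)
  have "p \<noteq> 0" using c(1) cp by (metis coeff_0 of_real_eq_0_iff)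
  moreover have "poly_act p A y = 0" for y
  proof -
    have "degree p \<le> ?N" using cp by (intro degree_le) auto
    then have "poly_act p A y = (\<Sum>i\<le>?N. complex_of_real (c i) *s (M i *v y))"
      by (simp add: poly_act_eq cp M)
    also have "\<dots> = (\<Sum>i\<le>?N. c i *\<^sub>R M i) *v y"
      by (simp add: vec_eq_iff matrix_vector_mult_def sum_distrib_left sum_distrib_right scaleR_conv_of_real[where 'a = complex] sum.swap[of _ UNIV "{..?N}"] mult.assoc del: DIM_cart DIM_complex)
    finally show ?thesis by (simp only: c(2) matrix_vector_mult_0)
  qed
  ultimately show ?thesis by blast
qed

lemma integral_norm_square_mono:
  fixes u v :: "real \<Rightarrow> 'a::euclidean_space"
  assumes "continuous_on {0..L} u" "continuous_on {0..L} v"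
    and "\<And>t. t \<in> {0..L} \<Longrightarrow> norm (u t) \<le> K * norm (v t)"
  shows "square_norm L u \<le> K\<^sup>2 * square_norm L v"
proof -
  have "square_norm L u \<le> integral {0..L} (\<lambda>t. K\<^sup>2 * (norm (v t))\<^sup>2)"
  proof (rule integral_le)
    show "(norm (u t))\<^sup>2 \<le> K\<^sup>2 * (norm (v t))\<^sup>2" if "t \<in> {0..L}" for t
      using power_mono[OF assms(3)[OF that], of 2] by (simp add: power_mult_distrib)
  qed (intro integrable_continuous_real continuous_intros assms)+
  then show ?thesis by simp
qed

lemma norm_add_square_le:
  fixes x y :: "'a::real_normed_vector"
  shows "(norm (x + y))\<^sup>2 \<le> 2 * (norm x)\<^sup>2 + 2 * (norm y)\<^sup>2"
proof -
  have "(norm (x + y))\<^sup>2 \<le> (norm x + norm y)\<^sup>2"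
    by (intro power_mono norm_triangle_ineq) auto
  also have "\<dots> \<le> 2 * (norm x)\<^sup>2 + 2 * (norm y)\<^sup>2"
    using sum_squares_bound[of "norm x" "norm y"] by (simp add: power2_sum)
  finally show ?thesis .
qed

lemma integral_norm_square_add:
  fixes u v :: "real \<Rightarrow> 'a::euclidean_space"
  assumes "continuous_on {0..L} u" "continuous_on {0..L} v"
  shows "integral {0..L} (\<lambda>t. (norm (u t + v t))\<^sup>2) \<le>
    2 * square_norm L u + 2 * square_norm L v"
proof -
  have "integral {0..L} (\<lambda>t. (norm (u t + v t))\<^sup>2) \<le> integral {0..L} (\<lambda>t. 2 * (norm (u t))\<^sup>2 + 2 * (norm (v t))\<^sup>2)"
  proof (rule integral_le)
    show "(norm (u t + v t))\<^sup>2 \<le> 2 * (norm (u t))\<^sup>2 + 2 * (norm (v t))\<^sup>2" for t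
      by (rule norm_add_square_le)
  qed (intro integrable_continuous_real continuous_intros assms)+
  also have "\<dots> = integral {0..L} (\<lambda>t. 2 * (norm (u t))\<^sup>2) + integral {0..L} (\<lambda>t. 2 * (norm (v t))\<^sup>2)"
    by (intro Henstock_Kurzweil_Integration.integral_add integrable_continuous_real continuous_intros assms)
  finally show ?thesis by simp
qed

abbreviation annihilated_solution where
  "annihilated_solution V p A L y f \<equiv> \<forall>t\<in>{0..L}. y t \<in> V \<and> poly_act p A (y t) = 0 \<and> (y has_vector_derivative A *v y t + f t) (at t within {0..L})"

text \<open>Induction on the degree of a polynomial that annihilates \<open>y\<close>: for a root \<open>\<mu>\<close>, the function
  \<open>z = (A - \<mu>) y\<close> is annihilated by a polynomial of smaller degree, and \<open>y\<close> is recovered from \<open>z\<close>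
  either from \<open>y' = \<mu> y + z + f\<close> if \<open>Re \<mu> \<noteq> 0\<close>, or by injectivity of \<open>A - \<mu>\<close> on \<open>V\<close>
  otherwise.\<close>

lemma hyperbolic_estimate_complex:
  fixes A :: "complex ^ 'n ^ 'n" and V :: "(complex ^ 'n) set"
  assumes V: "subspace V" "\<And>v \<mu>. v \<in> V \<Longrightarrow> \<mu> *s v \<in> V" "\<And>v. v \<in> V \<Longrightarrow> A *v v \<in> V"
    and hyp: "\<And>v \<mu>. v \<in> V \<Longrightarrow> A *v v = \<mu> *s v \<Longrightarrow> Re \<mu> = 0 \<Longrightarrow> v = 0"
    and p: "p \<noteq> 0"
  shows "\<exists>C\<ge>0. \<forall>L\<ge>0. \<forall>y f. continuous_on {0..L} f \<and>
      annihilated_solution V p A L y f \<longrightarrow>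
      square_norm L y \<le>
        C * (square_norm L f + (norm (y 0))\<^sup>2 + (norm (y L))\<^sup>2)"
  using p
proof (induction "degree p" arbitrary: p)
  case 0
  then obtain c where c: "p = [:c:]" "c \<noteq> 0" by (metis degree_eq_zeroE pCons_0_0)
  show ?case
  proof (intro exI[of _ 0] conjI allI impI)
    fix L :: real and y f :: "real \<Rightarrow> complex ^ 'n"
    assume *: "continuous_on {0..L} f \<and>
      annihilated_solution V p A L y f"
    have "y t = 0" if "t \<in> {0..L}" for t
      using * that c by (auto simp: poly_act_def vec_eq_iff)
    then have "square_norm L y = integral {0..L} (\<lambda>t. 0)"
      by (intro integral_cong) auto
    then show "square_norm L y \<le>
        0 * (square_norm L f + (norm (y 0))\<^sup>2 + (norm (y L))\<^sup>2)" by simp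
  qed auto
next
  case (Suc d)
  obtain \<mu> where "poly p \<mu> = 0"
    using fundamental_theorem_of_algebra[of p] Suc.hyps(2) constant_degree[of p] by auto
  then obtain q where q: "p = [:- \<mu>, 1:] * q" using poly_eq_0_iff_dvd by blast
  then have q0: "q \<noteq> 0" using Suc.prems by auto
  have "degree p = Suc (degree q)" unfolding q using q0 by (subst degree_mult_eq) auto
  then have "d = degree q" using Suc.hyps(2) by simp
  from Suc.hyps(1)[OF this q0] obtain C where C: "0 \<le> C"
    "\<And>L y f. 0 \<le> L \<Longrightarrow> continuous_on {0..L} f \<Longrightarrow>
      (\<And>t. t \<in> {0..L} \<Longrightarrow> y t \<in> V \<and> poly_act q A (y t) = 0 \<and> (y has_vector_derivative A *v y t + f t) (at t within {0..L})) \<Longrightarrow>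
      square_norm L y \<le>
        C * (square_norm L f + (norm (y 0))\<^sup>2 + (norm (y L))\<^sup>2)"
    by blast
  define D where "D v = A *v v - \<mu> *s v" for v
  have D: "bounded_linear D" unfolding D_def
    by (intro bounded_linear_sub complex_matrix_vector_linear smult_complex_linear)
  obtain K where K: "0 < K" "\<And>v. norm (D v) \<le> norm v * K"
    using bounded_linear.pos_bounded[OF D] by blast
  have pq: "poly_act p A v = poly_act q A (D v)" for v
    unfolding q D_def by (rule poly_act_linear_factor)
  have DV: "D v \<in> V" if "v \<in> V" for v
    unfolding D_def using V that by (intro subspace_diff) auto
  have DA: "D (A *v v) = A *v D v" for v
    by (simp add: D_def matrix_vector_mult_diff_distrib vector_scalar_commute)
  \<comment> \<open>D commutes with A and preserves V, so \<open>D (y t)\<close> solves the same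
    kind of equation with forcing \<open>D (f t)\<close>; each square on the right costs a factor of
    at most \<open>K^2\<close>.\<close>
  define C' where "C' = C * (K\<^sup>2 + 1)"
  have z_le: "integral {0..L} (\<lambda>t. (norm (D (y t)))\<^sup>2) \<le>
        C' * (square_norm L f + (norm (y 0))\<^sup>2 + (norm (y L))\<^sup>2)"
    if L: "0 \<le> L" and f: "continuous_on {0..L} f" and
      y: "\<And>t. t \<in> {0..L} \<Longrightarrow> y t \<in> V \<and> poly_act p A (y t) = 0 \<and> (y has_vector_derivative A *v y t + f t) (at t within {0..L})"
    for L y f
  proof -
    have If: "0 \<le> square_norm L f" by (intro integral_nonneg integrable_continuous_real continuous_intros f) auto
    have "integral {0..L} (\<lambda>t. (norm (D (y t)))\<^sup>2) \<le>
        C * (integral {0..L} (\<lambda>t. (norm (D (f t)))\<^sup>2) + (norm (D (y 0)))\<^sup>2 + (norm (D (y L)))\<^sup>2)"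
    proof (rule C(2)[OF L])
      show "continuous_on {0..L} (\<lambda>t. D (f t))" by (rule bounded_linear.continuous_on[OF D f])
      fix t assume t: "t \<in> {0..L}"
      have "((\<lambda>t. D (y t)) has_vector_derivative D (A *v y t + f t)) (at t within {0..L})"
        by (rule bounded_linear.has_vector_derivative[OF D]) (use y[OF t] in auto)
      moreover have "D (A *v y t + f t) = A *v D (y t) + D (f t)"
        by (simp add: linear_add[OF bounded_linear.linear[OF D]] DA)
      ultimately show "D (y t) \<in> V \<and> poly_act q A (D (y t)) = 0 \<and> ((\<lambda>t. D (y t)) has_vector_derivative A *v D (y t) + D (f t)) (at t within {0..L})"
        using y[OF t] DV pq by simp
    qed
    also have "\<dots> \<le> C * (K\<^sup>2 * square_norm L f + K\<^sup>2 * (norm (y 0))\<^sup>2 + K\<^sup>2 * (norm (y L))\<^sup>2)"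
    proof (intro mult_left_mono add_mono C(1))
      show "integral {0..L} (\<lambda>t. (norm (D (f t)))\<^sup>2) \<le> K\<^sup>2 * square_norm L f"
        by (rule integral_norm_square_mono[OF bounded_linear.continuous_on[OF D f] f]) (use K(2) in \<open>simp add: mult.commute\<close>)
      have sq: "(norm (D v))\<^sup>2 \<le> K\<^sup>2 * (norm v)\<^sup>2" for v
        using power_mono[OF K(2)[of v], of 2] by (simp add: power_mult_distrib mult.commute)
      show "(norm (D (y 0)))\<^sup>2 \<le> K\<^sup>2 * (norm (y 0))\<^sup>2" "(norm (D (y L)))\<^sup>2 \<le> K\<^sup>2 * (norm (y L))\<^sup>2"
        by (rule sq)+
    qed
    also have "\<dots> = C * K\<^sup>2 * (square_norm L f + (norm (y 0))\<^sup>2 + (norm (y L))\<^sup>2)"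
      by (simp add: algebra_simps)
    also have "\<dots> \<le> C' * (square_norm L f + (norm (y 0))\<^sup>2 + (norm (y L))\<^sup>2)"
      unfolding C'_def using C(1) If by (intro mult_right_mono mult_left_mono) auto
    finally show ?thesis .
  qed
  have C'0: "0 \<le> C'" using C(1) by (simp add: C'_def)
  show ?case
  proof (cases "Re \<mu> = 0")
    case True
    \<comment> \<open>V is finite-dimensional and closed, so injectivity of D on V upgrades to a
      lower bound \<open>e * norm v\<close>.\<close>
    have "\<forall>x\<in>V. D x = 0 \<longrightarrow> x = 0" using hyp True by (auto simp: D_def)
    from injective_imp_isometric[OF closed_subspace[OF V(1)] V(1) D this]
    obtain e where e: "0 < e" "\<And>v. v \<in> V \<Longrightarrow> e * norm v \<le> norm (D v)" by blast
    show ?thesis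
    proof (intro exI[of _ "(1/e)\<^sup>2 * C'"] conjI allI impI)
      fix L :: real and y f :: "real \<Rightarrow> complex ^ 'n"
      assume L: "0 \<le> L" and *: "continuous_on {0..L} f \<and>
        annihilated_solution V p A L y f"
      have yc: "continuous_on {0..L} y"
        using * by (intro continuous_on_vector_derivative) auto
      have "square_norm L y \<le> (1/e)\<^sup>2 * integral {0..L} (\<lambda>t. (norm (D (y t)))\<^sup>2)"
      proof (rule integral_norm_square_mono[OF yc bounded_linear.continuous_on[OF D yc]])
        show "norm (y t) \<le> 1 / e * norm (D (y t))" if "t \<in> {0..L}" for t
          using e(2)[of "y t"] e(1) * that by (simp add: field_simps)
      qed
      also have "\<dots> \<le> (1/e)\<^sup>2 * (C' * (square_norm L f + (norm (y 0))\<^sup>2 + (norm (y L))\<^sup>2))"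
        using * by (intro mult_left_mono z_le L) auto
      finally show "square_norm L y \<le>
        (1/e)\<^sup>2 * C' * (square_norm L f + (norm (y 0))\<^sup>2 + (norm (y L))\<^sup>2)" by (simp only: mult.assoc)
    qed (use C'0 in auto)
  next
    case False
    define m where "m = 1 / (Re \<mu>)\<^sup>2"
    define n where "n = 1 / \<bar>Re \<mu>\<bar>"
    have mn: "0 \<le> m" "0 \<le> n" by (auto simp: m_def n_def)
    show ?thesis
    proof (intro exI[of _ "m * (2 * C' + 2) + n"] conjI allI impI)
      fix L :: real and y f :: "real \<Rightarrow> complex ^ 'n"
      assume L: "0 \<le> L" and *: "continuous_on {0..L} f \<and>
        annihilated_solution V p A L y f"
      then have f: "continuous_on {0..L} f" by blast
      have yc: "continuous_on {0..L} y"
        using * by (intro continuous_on_vector_derivative) auto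
      let ?If = "square_norm L f"
      have If: "0 \<le> ?If" by (intro integral_nonneg integrable_continuous_real continuous_intros f) auto
      let ?S = "?If + (norm (y 0))\<^sup>2 + (norm (y L))\<^sup>2"
      have "square_norm L y \<le> m * integral {0..L} (\<lambda>t. (norm (D (y t) + f t))\<^sup>2)
         + n * ((norm (y 0))\<^sup>2 + (norm (y L))\<^sup>2)"
        unfolding m_def n_def
      proof (rule scalar_hyperbolic_estimate[OF L False])
        show "(y has_vector_derivative \<mu> *s y t + (D (y t) + f t)) (at t within {0..L})" if "t \<in> {0..L}" for t
          using * that by (simp add: D_def)
        show "continuous_on {0..L} (\<lambda>t. D (y t) + f t)"
          by (intro continuous_on_add bounded_linear.continuous_on[OF D yc] f)
      qed
      also have "\<dots> \<le> m * (2 * (C' * ?S) + 2 * ?If) + n * ((norm (y 0))\<^sup>2 + (norm (y L))\<^sup>2)"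
      proof (intro add_mono mult_left_mono mn order_refl)
        have "integral {0..L} (\<lambda>t. (norm (D (y t) + f t))\<^sup>2) \<le> 2 * integral {0..L} (\<lambda>t. (norm (D (y t)))\<^sup>2) + 2 * ?If"
          by (rule integral_norm_square_add[OF bounded_linear.continuous_on[OF D yc] f])
        also have "\<dots> \<le> 2 * (C' * ?S) + 2 * ?If"
          using z_le[OF L f, of y] * by simp
        finally show "integral {0..L} (\<lambda>t. (norm (D (y t) + f t))\<^sup>2) \<le> 2 * (C' * ?S) + 2 * ?If" .
      qed
      also have "\<dots> \<le> m * (2 * (C' * ?S) + 2 * ?S) + n * ?S"
        using If by (intro add_mono mult_left_mono mn C'0) auto
      also have "\<dots> = (m * (2 * C' + 2) + n) * ?S" by (simp add: algebra_simps)
      finally show "square_norm L y \<le> (m * (2 * C' + 2) + n) * ?S" .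
    qed (use C'0 mn in \<open>auto intro!: add_nonneg_nonneg mult_nonneg_nonneg\<close>)
  qed
qed

text \<open>The zero row makes the hyperplane \<open>v $ k = 0\<close> invariant under R.
  Restricting to it removes the neutral eigenvalue and leaves exactly the eigenvalues of the
  transversal block, to which the hypothesis applies.\<close>

lemma hyperbolic_estimate:
  fixes R :: "real ^ 'n ^ 'n" and k :: 'n
  assumes row: "\<And>i. R $ k $ i = 0"
    and hyp: "\<And>z. eigenvalue_on (- {k}) R z \<Longrightarrow> Re z \<noteq> 0"
  obtains C where "0 \<le> C" "\<And>L y f. 0 \<le> L \<Longrightarrow> continuous_on {0..L} f \<Longrightarrow>
      (\<And>t. t \<in> {0..L} \<Longrightarrow> y t $ k = 0) \<Longrightarrow>
      (\<And>t. t \<in> {0..L} \<Longrightarrow> (y has_vector_derivative R *v y t + f t) (at t within {0..L})) \<Longrightarrow>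
      square_norm L y \<le>
        C * (square_norm L f + (norm (y 0))\<^sup>2 + (norm (y L))\<^sup>2)"
proof -
  let ?A = "cmat R" and ?V = "{v :: complex ^ 'n. v $ k = 0}"
  obtain p where p: "p \<noteq> 0" "\<And>y. poly_act p ?A y = 0" using ex_annihilating_poly by blast
  have "\<exists>C\<ge>0. \<forall>L\<ge>0. \<forall>y f. continuous_on {0..L} f \<and>
      (\<forall>t\<in>{0..L}. y t \<in> ?V \<and> poly_act p ?A (y t) = 0 \<and> (y has_vector_derivative ?A *v y t + f t) (at t within {0..L})) \<longrightarrow>
      square_norm L y \<le>
        C * (square_norm L f + (norm (y 0))\<^sup>2 + (norm (y L))\<^sup>2)"
  proof (rule hyperbolic_estimate_complex[OF _ _ _ _ p(1)])
    show "subspace ?V" by (auto simp: subspace_def)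
    show "?A *v v \<in> ?V" for v by (simp add: matrix_vector_mult_def cmat_def row)
    fix v \<mu> assume v: "v \<in> ?V" "?A *v v = \<mu> *s v" "Re \<mu> = 0"
    show "v = 0"
    proof (rule ccontr)
      assume "v \<noteq> 0"
      have "(\<Sum>j\<in>- {k}. complex_of_real (R $ i $ j) * v $ j) = \<mu> * v $ i" for i
      proof -
        have "(\<Sum>j\<in>- {k}. complex_of_real (R $ i $ j) * v $ j) = (\<Sum>j\<in>UNIV. complex_of_real (R $ i $ j) * v $ j)"
          using v(1) by (intro sum.mono_neutral_left) auto
        also have "\<dots> = (?A *v v) $ i" by (simp add: matrix_vector_mult_def cmat_def)
        finally show ?thesis using v(2) by simp
      qed
      then have "eigenvalue_on (- {k}) R \<mu>"
        unfolding eigenvalue_on_def using v(1) \<open>v \<noteq> 0\<close> by (intro exI[of _ v]) auto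
      with hyp v(3) show False by blast
    qed
  qed auto
  then obtain C where C: "0 \<le> C" "\<And>L y f. 0 \<le> L \<Longrightarrow> continuous_on {0..L} f \<Longrightarrow>
      (\<And>t. t \<in> {0..L} \<Longrightarrow> y t \<in> ?V \<and> poly_act p ?A (y t) = 0 \<and> (y has_vector_derivative ?A *v y t + f t) (at t within {0..L})) \<Longrightarrow>
      square_norm L y \<le>
        C * (square_norm L f + (norm (y 0))\<^sup>2 + (norm (y L))\<^sup>2)"
    by blast
  show ?thesis
  proof (rule that[OF C(1)])
    fix L :: real and y f :: "real \<Rightarrow> real ^ 'n"
    assume L: "0 \<le> L" and f: "continuous_on {0..L} f" and y: "\<And>t. t \<in> {0..L} \<Longrightarrow> y t $ k = 0"
      "\<And>t. t \<in> {0..L} \<Longrightarrow> (y has_vector_derivative R *v y t + f t) (at t within {0..L})"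
    have "integral {0..L} (\<lambda>t. (norm (cvec (y t)))\<^sup>2) \<le>
        C * (integral {0..L} (\<lambda>t. (norm (cvec (f t)))\<^sup>2) + (norm (cvec (y 0)))\<^sup>2 + (norm (cvec (y L)))\<^sup>2)"
    proof (rule C(2)[OF L])
      show "continuous_on {0..L} (\<lambda>t. cvec (f t))" by (rule bounded_linear.continuous_on[OF cvec_linear f])
      fix t assume t: "t \<in> {0..L}"
      have "((\<lambda>t. cvec (y t)) has_vector_derivative cvec (R *v y t + f t)) (at t within {0..L})"
        by (rule bounded_linear.has_vector_derivative[OF cvec_linear y(2)[OF t]])
      moreover have "cvec (R *v y t + f t) = ?A *v cvec (y t) + cvec (f t)"
        by (simp add: linear_add[OF bounded_linear.linear[OF cvec_linear]] cmat_cvec)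
      ultimately show "cvec (y t) \<in> ?V \<and> poly_act p ?A (cvec (y t)) = 0 \<and>
          ((\<lambda>t. cvec (y t)) has_vector_derivative ?A *v cvec (y t) + cvec (f t)) (at t within {0..L})"
        using y(1)[OF t] p(2) by (simp add: cvec_def)
    qed
    then show "square_norm L y \<le>
        C * (square_norm L f + (norm (y 0))\<^sup>2 + (norm (y L))\<^sup>2)" by simp
  qed
qed

section \<open>Matrix inverses and second derivatives\<close>

text \<open>Compactness of one period and induction on the number of periods. This is how the
  coefficients get bounds that hold on \<open>[0, N T]\<close> for all N.\<close>

lemma bounded_of_periodic:
  fixes f :: "real \<Rightarrow> 'a::real_normed_vector"
  assumes cont: "continuous_on {0..} f" and T: "0 < T" and per: "\<And>t. 0 \<le> t \<Longrightarrow> f (t + T) = f t"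
  obtains B where "0 < B" "\<And>t. 0 \<le> t \<Longrightarrow> norm (f t) \<le> B"
proof -
  have "compact (f ` {0..T})"
    by (intro compact_continuous_image continuous_on_subset[OF cont]) auto
  then have "bounded (f ` {0..T})" by (rule compact_imp_bounded)
  then obtain B where B: "0 < B" "\<And>t. t \<in> {0..T} \<Longrightarrow> norm (f t) \<le> B"
    unfolding bounded_pos by auto
  have "norm (f t) \<le> B" if "0 \<le> t" "t \<le> real n * T" for n t
    using that
  proof (induction n arbitrary: t)
    case (Suc n)
    show ?case
    proof (cases "t \<le> T")
      case False
      then have "norm (f (t - T)) \<le> B" using Suc.prems by (intro Suc.IH) (auto simp: algebra_simps)
      then show ?thesis using per[of "t - T"] False by simp
    qed (use B Suc.prems in auto)
  qed (use B T in auto)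
  moreover have "\<exists>n. t \<le> real n * T" for t
    using real_arch_simple[of "t / T"] T by (auto simp: field_simps)
  ultimately show ?thesis using B(1) that by metis
qed

lemma matrix_inv_inverse:
  fixes A :: "real ^ 'n ^ 'n"
  assumes "invertible A"
  shows "A *v (matrix_inv A *v v) = v" "matrix_inv A *v (A *v v) = v"
proof -
  have "A ** matrix_inv A = mat 1 \<and> matrix_inv A ** A = mat 1"
    unfolding matrix_inv_def using assms unfolding invertible_def by (rule someI_ex)
  then show "A *v (matrix_inv A *v v) = v" "matrix_inv A *v (A *v v) = v"
    by (simp_all add: matrix_vector_mul_assoc)
qed

text \<open>Perturbation instead of Cramer's rule: if \<open>P x\<close> is within
  \<open>1 / (2 * K)\<close> of \<open>P s\<close>, with K above the norm of the inverse at s, half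
  of \<open>norm u\<close> can be absorbed and \<open>norm u \<le> 2 * K * norm (P x *v u)\<close>.
  This is applied to the difference of the two inverses at a vector, and the columns reassemble the
  matrix.\<close>

lemma continuous_on_matrix_inv:
  fixes P :: "real \<Rightarrow> real ^ 'n ^ 'n"
  assumes cont: "continuous_on S P" and inv: "\<And>t. t \<in> S \<Longrightarrow> invertible (P t)"
  shows "continuous_on S (\<lambda>t. matrix_inv (P t))"
proof -
  have vec: "((\<lambda>x. matrix_inv (P x) *v v) \<longlongrightarrow> matrix_inv (P s) *v v) (at s within S)" if s: "s \<in> S" for s v
  proof -
    define K where "K = norm (matrix_inv (P s)) + 1"
    have K: "0 < K" by (simp add: K_def add_nonneg_pos)
    have lim: "(P \<longlongrightarrow> P s) (at s within S)" using cont s by (simp add: continuous_on_def)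
    have ev: "eventually (\<lambda>x. x \<in> S \<and> dist (P x) (P s) < 1 / (2 * K)) (at s within S)"
      using tendstoD[OF lim, of "1 / (2 * K)"] K by (auto simp: eventually_at_filter elim: eventually_mono)
    have "((\<lambda>x. matrix_inv (P x) *v v - matrix_inv (P s) *v v) \<longlongrightarrow> 0) (at s within S)"
    proof (rule Lim_null_comparison)
      show "eventually (\<lambda>x. norm (matrix_inv (P x) *v v - matrix_inv (P s) *v v)
         \<le> 2 * K * norm (P s - P x) * norm (matrix_inv (P s) *v v)) (at s within S)"
        using ev
      proof eventually_elim
        case (elim x)
        have small: "norm u \<le> 2 * K * norm (P x *v u)" for u
        proof -
          have "norm u = norm (matrix_inv (P s) *v (P s *v u))" using matrix_inv_inverse inv[OF s] by metis
          also have "\<dots> \<le> K * norm (P s *v u)"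
            by (rule order_trans[OF norm_matrix_vector_mult_le]) (auto simp: K_def intro!: mult_right_mono)
          also have "P s *v u = P x *v u + (P s - P x) *v u" by (simp add: matrix_vector_mult_diff_rdistrib)
          also have "norm \<dots> \<le> norm (P x *v u) + norm (P s - P x) * norm u"
            by (rule order_trans[OF norm_triangle_ineq]) (intro add_mono order_refl norm_matrix_vector_mult_le)
          also have "norm (P s - P x) * norm u \<le> 1 / (2 * K) * norm u"
            using elim by (intro mult_right_mono) (auto simp: dist_norm norm_minus_commute)
          finally have "norm u \<le> K * (norm (P x *v u) + 1 / (2 * K) * norm u)"
            using K by (simp add: mult_left_mono)
          also have "\<dots> = K * norm (P x *v u) + norm u / 2" using K by (simp add: field_simps)
          finally show ?thesis by simp
        qed
        let ?u = "matrix_inv (P x) *v v - matrix_inv (P s) *v v"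
        have "P x *v ?u = (P s - P x) *v (matrix_inv (P s) *v v)"
          using matrix_inv_inverse(1)[OF inv] elim s
          by (simp add: matrix_vector_mult_diff_distrib matrix_vector_mult_diff_rdistrib)
        then have "norm ?u \<le> 2 * K * norm ((P s - P x) *v (matrix_inv (P s) *v v))"
          using small[of ?u] by simp
        also have "\<dots> \<le> 2 * K * (norm (P s - P x) * norm (matrix_inv (P s) *v v))"
          using K by (intro mult_left_mono norm_matrix_vector_mult_le) auto
        finally show ?case by (simp add: mult.assoc)
      qed
      have "((\<lambda>x. 2 * K * norm (P s - P x) * norm (matrix_inv (P s) *v v)) \<longlongrightarrow>
          2 * K * norm (P s - P s) * norm (matrix_inv (P s) *v v)) (at s within S)"
        by (intro tendsto_intros lim)
      then show "((\<lambda>x. 2 * K * norm (P s - P x) * norm (matrix_inv (P s) *v v)) \<longlongrightarrow> 0) (at s within S)" by simp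
    qed
    then show ?thesis by (rule LIM_zero_cancel)
  qed
  have "((\<lambda>x. \<chi> i j. (matrix_inv (P x) *v axis j 1) $ i) \<longlongrightarrow> (\<chi> i j. (matrix_inv (P s) *v axis j 1) $ i)) (at s within S)"
    if "s \<in> S" for s
    by (intro tendsto_vec_lambda tendsto_vec_nth vec that)
  moreover have "(\<chi> i j. (A *v axis j 1) $ i) = A" for A :: "real ^ 'n ^ 'n"
    by (simp add: matrix_vector_mult_basis column_def vec_eq_iff)
  ultimately show ?thesis by (simp add: continuous_on_def)
qed

text \<open>With \<open>y = Q t *v E t\<close>, the increment of \<open>Q x *v E x\<close> equals
  \<open>Q x *v (E x - P x *v y)\<close>, and the bracket is differentiable and vanishes at t.
  Continuity of Q thus suffices, and the inverse is never differentiated. rE and rP are the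
  normalized Taylor remainders.\<close>

lemma has_vector_derivative_matrix_inv_mult:
  fixes P Q :: "real \<Rightarrow> real ^ 'n ^ 'n" and E :: "real \<Rightarrow> real ^ 'n"
  assumes P: "(P has_vector_derivative P') (at t within S)" and E: "(E has_vector_derivative E') (at t within S)"
    and Q: "(Q \<longlongrightarrow> Q t) (at t within S)" and inv: "\<And>x v. x \<in> S \<Longrightarrow> P x *v (Q x *v v) = v" "\<And>x v. x \<in> S \<Longrightarrow> Q x *v (P x *v v) = v"
    and t: "t \<in> S"
  shows "((\<lambda>x. Q x *v E x) has_vector_derivative Q t *v (E' - P' *v (Q t *v E t))) (at t within S)"
proof -
  define y where "y = Q t *v E t"
  define D where "D = E' - P' *v y"
  define rE where "rE x = (1 / norm (x - t)) *\<^sub>R (E x - (E t + (x - t) *\<^sub>R E'))" for x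
  define rP where "rP x = (1 / norm (x - t)) *\<^sub>R (P x - (P t + (x - t) *\<^sub>R P'))" for x
  have rE: "(rE \<longlongrightarrow> 0) (at t within S)" and rP: "(rP \<longlongrightarrow> 0) (at t within S)"
    using P E unfolding has_vector_derivative_def Deriv.has_derivative_within rE_def rP_def by auto
  have "((\<lambda>x. Q x *v (rE x - rP x *v y)) \<longlongrightarrow> Q t *v (0 - 0 *v y)) (at t within S)"
    by (intro tendsto_intros Q rE rP)
  moreover have "((\<lambda>x. ((x - t) / norm (x - t)) *\<^sub>R ((Q x - Q t) *v D)) \<longlongrightarrow> 0) (at t within S)"
  proof (rule Lim_null_comparison)
    show "eventually (\<lambda>x. norm (((x - t) / norm (x - t)) *\<^sub>R ((Q x - Q t) *v D)) \<le> norm ((Q x - Q t) *v D)) (at t within S)"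
      by (intro always_eventually allI) (auto simp: mult_left_le_one_le)
    have "((\<lambda>x. norm ((Q x - Q t) *v D)) \<longlongrightarrow> norm ((Q t - Q t) *v D)) (at t within S)"
      by (intro tendsto_intros Q)
    then show "((\<lambda>x. norm ((Q x - Q t) *v D)) \<longlongrightarrow> 0) (at t within S)" by simp
  qed
  ultimately have "((\<lambda>x. Q x *v (rE x - rP x *v y) + ((x - t) / norm (x - t)) *\<^sub>R ((Q x - Q t) *v D)) \<longlongrightarrow> 0) (at t within S)"
    using tendsto_add by fastforce
  moreover have "eventually (\<lambda>x. Q x *v (rE x - rP x *v y) + ((x - t) / norm (x - t)) *\<^sub>R ((Q x - Q t) *v D)
     = (1 / norm (x - t)) *\<^sub>R (Q x *v E x - (y + (x - t) *\<^sub>R (Q t *v D)))) (at t within S)"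
  proof -
    have eq: "Q x *v (rE x - rP x *v y) + ((x - t) / norm (x - t)) *\<^sub>R ((Q x - Q t) *v D)
     = (1 / norm (x - t)) *\<^sub>R (Q x *v E x - (y + (x - t) *\<^sub>R (Q t *v D)))" if x: "x \<in> S" for x
    proof -
      have Py: "P t *v y = E t" unfolding y_def by (rule inv(1)[OF t])
      have "rE x - rP x *v y = (1 / norm (x - t)) *\<^sub>R ((E x - (E t + (x - t) *\<^sub>R E')) - (P x - (P t + (x - t) *\<^sub>R P')) *v y)"
        by (simp add: rE_def rP_def scaleR_diff_right scaleR_matrix_vector_assoc)
      also have "(E x - (E t + (x - t) *\<^sub>R E')) - (P x - (P t + (x - t) *\<^sub>R P')) *v y = E x - P x *v y - (x - t) *\<^sub>R D"
        by (simp add: D_def matrix_vector_mult_diff_rdistrib matrix_vector_mult_add_rdistrib Py scaleR_matrix_vector_assoc[symmetric] algebra_simps)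
      finally have "Q x *v (rE x - rP x *v y) = (1 / norm (x - t)) *\<^sub>R (Q x *v E x - y - (x - t) *\<^sub>R (Q x *v D))"
        using inv(2)[OF x] by (simp add: matrix_vector_mult_scaleR matrix_vector_mult_diff_distrib)
      moreover have "((x - t) / norm (x - t)) *\<^sub>R ((Q x - Q t) *v D) = (1 / norm (x - t)) *\<^sub>R ((x - t) *\<^sub>R (Q x *v D) - (x - t) *\<^sub>R (Q t *v D))"
        by (simp add: matrix_vector_mult_diff_rdistrib scaleR_diff_right)
      ultimately show ?thesis by (simp add: scaleR_add_right scaleR_diff_right)
    qed
    then show ?thesis by (auto simp: eventually_at_filter intro!: always_eventually)
  qed
  ultimately have "((\<lambda>x. (1 / norm (x - t)) *\<^sub>R (Q x *v E x - (y + (x - t) *\<^sub>R (Q t *v D)))) \<longlongrightarrow> 0) (at t within S)"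
    by (rule Lim_transform_eventually)
  then show ?thesis
    unfolding has_vector_derivative_def Deriv.has_derivative_within y_def[symmetric] D_def[symmetric]
    by (auto intro: bounded_linear_scaleR_left)
qed

text \<open>The mean value theorem in direction u for the increment of f along
  \<open>s *\<^sub>R v\<close>, followed by differentiability of G at the single point x, which
  compares the two gradients with their linearization.\<close>

lemma second_difference_estimate:
  fixes f :: "'a::euclidean_space \<Rightarrow> real" and G Q :: "'a \<Rightarrow> 'a"
  assumes f: "\<And>z. (f has_derivative (\<lambda>h. G z \<bullet> h)) (at z)"
    and G: "(G has_derivative Q) (at x)" and e: "0 < e"
  obtains d where "0 < d" "\<And>s. 0 < s \<Longrightarrow> s < d \<Longrightarrow>
     \<bar>f (x + s *\<^sub>R u + s *\<^sub>R v) - f (x + s *\<^sub>R u) - f (x + s *\<^sub>R v) + f x - s\<^sup>2 * (Q v \<bullet> u)\<bar>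
       \<le> e * s\<^sup>2 * (2 * (norm u + norm v + 1) * (norm u + 1))"
proof -
  obtain d where d: "0 < d" "\<And>h. norm h < d \<Longrightarrow> norm (G (x + h) - G x - Q h) \<le> e * norm h"
  proof -
    obtain d where "0 < d" "\<And>y. norm (y - x) < d \<Longrightarrow> norm (G y - G x - Q (y - x)) \<le> e * norm (y - x)"
      using G e unfolding has_derivative_at_alt by blast
    then show ?thesis using that[of d] by (metis add_diff_cancel_left')
  qed
  have Ql: "linear Q" using G has_derivative_linear by blast
  let ?N = "norm u + norm v + 1"
  have N: "0 < ?N" by (simp add: add_nonneg_pos)
  show ?thesis
  proof (rule that[of "d / ?N"])
    fix s :: real assume s: "0 < s" "s < d / ?N"
    then have sN: "s * ?N < d" using N by (simp add: pos_less_divide_eq)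
    let ?\<phi> = "\<lambda>r. f (x + r *\<^sub>R u + s *\<^sub>R v) - f (x + r *\<^sub>R u)"
    have der: "(?\<phi> has_real_derivative (G (x + r *\<^sub>R u + s *\<^sub>R v) - G (x + r *\<^sub>R u)) \<bullet> u) (at r)" for r
    proof -
      have "(?\<phi> has_derivative (\<lambda>h. G (x + r *\<^sub>R u + s *\<^sub>R v) \<bullet> (h *\<^sub>R u) - G (x + r *\<^sub>R u) \<bullet> (h *\<^sub>R u))) (at r)"
        by (intro has_derivative_diff has_derivative_compose[OF _ f]) (auto intro!: derivative_eq_intros)
      moreover have "(\<lambda>h. G (x + r *\<^sub>R u + s *\<^sub>R v) \<bullet> (h *\<^sub>R u) - G (x + r *\<^sub>R u) \<bullet> (h *\<^sub>R u)) =
          (*) ((G (x + r *\<^sub>R u + s *\<^sub>R v) - G (x + r *\<^sub>R u)) \<bullet> u)"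
        by (simp add: fun_eq_iff inner_diff_left algebra_simps)
      ultimately show ?thesis by (simp only: has_field_derivative_def)
    qed
    obtain r where r: "0 < r" "r < s" "?\<phi> s - ?\<phi> 0 = (s - 0) * ((G (x + r *\<^sub>R u + s *\<^sub>R v) - G (x + r *\<^sub>R u)) \<bullet> u)"
      using MVT2[OF s(1) der] by blast
    let ?h1 = "r *\<^sub>R u + s *\<^sub>R v" and ?h2 = "r *\<^sub>R u"
    have n1: "norm ?h1 \<le> s * ?N"
    proof -
      have "norm ?h1 \<le> r * norm u + s * norm v"
        using norm_triangle_ineq[of "r *\<^sub>R u" "s *\<^sub>R v"] r s by simp
      also have "\<dots> \<le> s * norm u + s * norm v + s" using r s by (simp add: mult_right_mono add_increasing2)
      finally show ?thesis by (simp add: algebra_simps)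
    qed
    have n2: "norm ?h2 \<le> s * ?N"
    proof -
      have "r * norm u \<le> s * norm u" using r by (intro mult_right_mono) auto
      moreover have "0 \<le> s * norm v" using s by simp
      ultimately have "r * norm u \<le> s * norm u + s * norm v + s" using s by linarith
      then show ?thesis using r(1) by (simp add: algebra_simps)
    qed
    define r1 where "r1 = G (x + ?h1) - G x - Q ?h1"
    define r2 where "r2 = G (x + ?h2) - G x - Q ?h2"
    have r1: "norm r1 \<le> e * (s * ?N)" unfolding r1_def
      by (rule order_trans[OF d(2)]) (use n1 sN e in \<open>auto intro!: mult_left_mono\<close>)
    have r2: "norm r2 \<le> e * (s * ?N)" unfolding r2_def
      by (rule order_trans[OF d(2)]) (use n2 sN e in \<open>auto intro!: mult_left_mono\<close>)
    have "G (x + r *\<^sub>R u + s *\<^sub>R v) - G (x + r *\<^sub>R u) = s *\<^sub>R Q v + (r1 - r2)"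
      unfolding r1_def r2_def by (simp add: linear_add[OF Ql] linear_scale[OF Ql] add.assoc)
    then have inc: "?\<phi> s - ?\<phi> 0 = s * ((s *\<^sub>R Q v + (r1 - r2)) \<bullet> u)"
      using r(3) by (simp only: diff_zero)
    have "?\<phi> s - ?\<phi> 0 - s\<^sup>2 * (Q v \<bullet> u) = s * ((r1 - r2) \<bullet> u)"
      unfolding inc by (simp add: inner_add_left power2_eq_square algebra_simps)
    then have "\<bar>?\<phi> s - ?\<phi> 0 - s\<^sup>2 * (Q v \<bullet> u)\<bar> = s * \<bar>(r1 - r2) \<bullet> u\<bar>" using s by (simp add: abs_mult)
    also have "\<dots> \<le> s * ((2 * (e * (s * ?N))) * (norm u + 1))"
    proof (intro mult_left_mono)
      have "\<bar>(r1 - r2) \<bullet> u\<bar> \<le> norm (r1 - r2) * norm u" by (rule Cauchy_Schwarz_ineq2)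
      also have "\<dots> \<le> (2 * (e * (s * ?N))) * (norm u + 1)"
        using r1 r2 norm_triangle_ineq4[of r1 r2] e s N by (intro mult_mono) auto
      finally show "\<bar>(r1 - r2) \<bullet> u\<bar> \<le> (2 * (e * (s * ?N))) * (norm u + 1)" .
    qed (use s in auto)
    also have "\<dots> = e * s\<^sup>2 * (2 * ?N * (norm u + 1))" by (simp add: power2_eq_square)
    finally show "\<bar>f (x + s *\<^sub>R u + s *\<^sub>R v) - f (x + s *\<^sub>R u) - f (x + s *\<^sub>R v) + f x - s\<^sup>2 * (Q v \<bullet> u)\<bar>
       \<le> e * s\<^sup>2 * (2 * ?N * (norm u + 1))" by (simp add: algebra_simps)
  qed (use d N in auto)
qed

text \<open>The mixed second difference does not change when u and v are exchanged, yet divided by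
  \<open>s^2\<close> it approximates both \<open>Q v \<bullet> u\<close> and
  \<open>Q u \<bullet> v\<close>.\<close>

lemma second_derivative_symmetric:
  fixes f :: "'a::euclidean_space \<Rightarrow> real" and G Q :: "'a \<Rightarrow> 'a"
  assumes f: "\<And>z. (f has_derivative (\<lambda>h. G z \<bullet> h)) (at z)" and G: "(G has_derivative Q) (at x)"
  shows "Q v \<bullet> u = Q u \<bullet> v"
proof (rule ccontr)
  assume "Q v \<bullet> u \<noteq> Q u \<bullet> v"
  then have pos: "0 < \<bar>Q v \<bullet> u - Q u \<bullet> v\<bar>" by simp
  define K where "K = 2 * (norm u + norm v + 1) * (norm u + 1) + 2 * (norm v + norm u + 1) * (norm v + 1)"
  have K: "0 < K" unfolding K_def by (intro add_pos_pos mult_pos_pos add_nonneg_pos add_nonneg_nonneg) auto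
  \<comment> \<open>With this e the two errors add up to half of the gap times \<open>s^2\<close>,
    which is a contradiction.\<close>
  define e where "e = \<bar>Q v \<bullet> u - Q u \<bullet> v\<bar> / (2 * K)"
  have e: "0 < e" using pos K by (simp add: e_def)
  obtain d1 where d1: "0 < d1" "\<And>s. 0 < s \<Longrightarrow> s < d1 \<Longrightarrow>
     \<bar>f (x + s *\<^sub>R u + s *\<^sub>R v) - f (x + s *\<^sub>R u) - f (x + s *\<^sub>R v) + f x - s\<^sup>2 * (Q v \<bullet> u)\<bar>
       \<le> e * s\<^sup>2 * (2 * (norm u + norm v + 1) * (norm u + 1))"
    using second_difference_estimate[OF f G e, of u v] by blast
  obtain d2 where d2: "0 < d2" "\<And>s. 0 < s \<Longrightarrow> s < d2 \<Longrightarrow>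
     \<bar>f (x + s *\<^sub>R v + s *\<^sub>R u) - f (x + s *\<^sub>R v) - f (x + s *\<^sub>R u) + f x - s\<^sup>2 * (Q u \<bullet> v)\<bar>
       \<le> e * s\<^sup>2 * (2 * (norm v + norm u + 1) * (norm v + 1))"
    using second_difference_estimate[OF f G e, of v u] by blast
  define s where "s = min d1 d2 / 2"
  have s: "0 < s" "s < d1" "s < d2" using d1(1) d2(1) by (auto simp: s_def)
  have sw: "x + s *\<^sub>R v + s *\<^sub>R u = x + s *\<^sub>R u + s *\<^sub>R v" by simp
  have "\<bar>s\<^sup>2 * (Q v \<bullet> u) - s\<^sup>2 * (Q u \<bullet> v)\<bar> \<le> e * s\<^sup>2 * (2 * (norm u + norm v + 1) * (norm u + 1)) + e * s\<^sup>2 * (2 * (norm v + norm u + 1) * (norm v + 1))"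
    using d1(2)[OF s(1,2)] d2(2)[OF s(1,3)] unfolding sw by linarith
  also have "\<dots> = s\<^sup>2 * (e * K)" by (simp add: K_def algebra_simps)
  also have "e * K = \<bar>Q v \<bullet> u - Q u \<bullet> v\<bar> / 2" using K by (simp add: e_def)
  also have "\<bar>s\<^sup>2 * (Q v \<bullet> u) - s\<^sup>2 * (Q u \<bullet> v)\<bar> = s\<^sup>2 * \<bar>Q v \<bullet> u - Q u \<bullet> v\<bar>"
    by (simp add: abs_mult right_diff_distrib[symmetric])
  finally show False using pos s by simp
qed

section \<open>Gradient and Hessian of the divergence\<close>

lemma vec_lambda_eq_sum: "(\<chi> j. x j) = (\<Sum>j\<in>UNIV. x j *\<^sub>R axis j (1::real))"
  by (simp add: vec_eq_iff axis_def if_distrib[of "\<lambda>y. _ * y"] cong: if_cong)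

lemma jacobian_entry: "jacobian f (at x) $ i $ j = frechet_derivative f (at x) (axis j 1) $ i"
  by (simp add: jacobian_def matrix_def)

lemma jacobian_eqI:
  assumes "(f has_derivative D) (at x)"
  shows "jacobian f (at x) $ i $ j = D (axis j 1) $ i"
  using frechet_derivative_at[OF assms] by (simp add: jacobian_entry)

lemma has_derivative_gradient:
  fixes f :: "real ^ 'n \<Rightarrow> real"
  assumes "(f has_derivative D) (at x)"
  shows "gradient f x = (\<chi> j. D (axis j 1))" "(f has_derivative (\<lambda>h. gradient f x \<bullet> h)) (at x)"
proof -
  show eq: "gradient f x = (\<chi> j. D (axis j 1))"
    unfolding gradient_def using frechet_derivative_at[OF assms] by simp
  have "D h = gradient f x \<bullet> h" for h
  proof -
    have "D h = D (\<Sum>j\<in>UNIV. (h $ j) *\<^sub>R axis j 1)"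
      by (simp add: vec_lambda_eq_sum[symmetric])
    also have "\<dots> = (\<Sum>j\<in>UNIV. (h $ j) *\<^sub>R D (axis j 1))"
      using has_derivative_linear[OF assms] by (simp add: linear_sum linear_scale)
    finally show ?thesis by (simp add: eq inner_vec_def mult.commute)
  qed
  then have "D = (\<lambda>h. gradient f x \<bullet> h)" by (simp add: fun_eq_iff)
  with assms show "(f has_derivative (\<lambda>h. gradient f x \<bullet> h)) (at x)" by simp
qed

lemma has_derivative_trace:
  fixes F :: "'i::finite \<Rightarrow> real ^ 'n \<Rightarrow> real ^ 'i"
  assumes "\<And>i. F i differentiable (at x)"
  shows "((\<lambda>x. \<Sum>i\<in>UNIV. F i x $ i) has_derivative (\<lambda>h. \<Sum>i\<in>UNIV. frechet_derivative (F i) (at x) h $ i)) (at x)"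
  by (intro has_derivative_sum bounded_linear.has_derivative[OF bounded_linear_vec_nth])
    (rule frechet_derivative_works[THEN iffD1, OF assms])

lemma C_b_continuous: "C_b k f \<Longrightarrow> continuous_on UNIV f"
  by (cases k) auto

lemma C_b_partial: "C_b (Suc k) f \<Longrightarrow> C_b k (\<lambda>x. frechet_derivative f (at x) (axis j 1))" for f :: "real ^ 'n \<Rightarrow> 'b::real_normed_vector"
  by (auto simp: axis_in_Basis_iff)

lemma jacobian_continuous:
  fixes f :: "real ^ 'n \<Rightarrow> real ^ 'm"
  assumes "C_b (Suc k) f"
  shows "continuous_on UNIV (\<lambda>x. jacobian f (at x))"
proof -
  have "continuous_on UNIV (\<lambda>x. \<chi> i j. frechet_derivative f (at x) (axis j 1) $ i)"
    by (intro continuous_intros C_b_continuous[OF C_b_partial[OF assms]])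
  also have "(\<lambda>x. \<chi> i j. frechet_derivative f (at x) (axis j 1) $ i) = (\<lambda>x. jacobian f (at x))"
    by (simp add: fun_eq_iff vec_eq_iff jacobian_entry)
  finally show ?thesis .
qed

text \<open>The divergence consumes one of the three derivatives of b, its gradient and Hessian the
  other two. Since \<open>C_b\<close> speaks of iterated partial derivatives, everything is written
  through D1, D2 and D3; of D3 only continuity is left.\<close>

lemma divergence_C2:
  fixes b :: "real ^ 'n \<Rightarrow> real ^ 'n"
  assumes b: "C_b 3 b"
  shows "\<And>x. (divergence b has_derivative (\<lambda>h. gradient (divergence b) x \<bullet> h)) (at x)"
    and "\<And>x. (gradient (divergence b) has_derivative (\<lambda>h. hessian (divergence b) x *v h)) (at x)"
    and "continuous_on UNIV (hessian (divergence b))"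
proof -
  define D1 where "D1 i x = frechet_derivative b (at x) (axis i 1)" for i x
  define D2 where "D2 i j x = frechet_derivative (D1 i) (at x) (axis j 1)" for i j x
  define D3 where "D3 i j l x = frechet_derivative (D2 i j) (at x) (axis l 1)" for i j l x
  have c3: "C_b (Suc (Suc (Suc 0))) b" using b by (simp add: numeral_3_eq_3)
  have c2: "C_b (Suc (Suc 0)) (D1 i)" for i unfolding D1_def by (rule C_b_partial[OF c3])
  have c1: "C_b (Suc 0) (D2 i j)" for i j unfolding D2_def by (rule C_b_partial[OF c2])
  have c0: "C_b 0 (D3 i j l)" for i j l unfolding D3_def by (rule C_b_partial[OF c1])
  have div: "divergence b = (\<lambda>x. \<Sum>i\<in>UNIV. D1 i x $ i)"
    by (simp add: fun_eq_iff divergence_def trace_def jacobian_entry D1_def)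
  have d1: "(divergence b has_derivative (\<lambda>h. \<Sum>i\<in>UNIV. frechet_derivative (D1 i) (at x) h $ i)) (at x)" for x
    unfolding div using c2 by (intro has_derivative_trace) auto
  show "(divergence b has_derivative (\<lambda>h. gradient (divergence b) x \<bullet> h)) (at x)" for x
    by (rule has_derivative_gradient(2)[OF d1])
  have grad: "gradient (divergence b) = (\<lambda>x. \<chi> j. \<Sum>i\<in>UNIV. D2 i j x $ i)"
    using has_derivative_gradient(1)[OF d1] by (simp add: fun_eq_iff D2_def)
  have d2: "(gradient (divergence b) has_derivative
      (\<lambda>h. \<chi> j. \<Sum>i\<in>UNIV. frechet_derivative (D2 i j) (at x) h $ i)) (at x)" for x
    unfolding grad vec_lambda_eq_sum using c1
    by (intro has_derivative_sum has_derivative_scaleR_left has_derivative_trace) auto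
  have hess: "hessian (divergence b) x = (\<chi> j l. \<Sum>i\<in>UNIV. D3 i j l x $ i)" for x
    unfolding hessian_def by (simp add: vec_eq_iff jacobian_eqI[OF d2] D3_def)
  show "(gradient (divergence b) has_derivative (\<lambda>h. hessian (divergence b) x *v h)) (at x)" for x
  proof -
    have "gradient (divergence b) differentiable (at x)" using d2 by (auto simp: differentiable_def)
    then show ?thesis unfolding hessian_def by (rule jacobian_works[THEN iffD1])
  qed
  have hess': "(\<lambda>x. \<chi> j l. \<Sum>i\<in>UNIV. D3 i j l x $ i) = hessian (divergence b)"
    by (rule ext) (rule hess[symmetric])
  have "continuous_on UNIV (\<lambda>x. \<chi> j l. \<Sum>i\<in>UNIV. D3 i j l x $ i)"
    by (intro continuous_intros C_b_continuous[OF c0])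
  then show "continuous_on UNIV (hessian (divergence b))" by (simp only: hess')
qed

text \<open>The transversal coordinates stay in the full vector type, with 0 at k, so that R acts on
  them directly.\<close>

definition perp :: "'n \<Rightarrow> real ^ 'n \<Rightarrow> real ^ 'n" where
  "perp k v = (\<chi> i. if i = k then 0 else v $ i)"

lemma bounded_linear_perp: "bounded_linear (perp k)"
  by (rule linear_conv_bounded_linear[THEN iffD1], rule linearI) (auto simp: perp_def vec_eq_iff)

lemma norm_perp_le: "norm (perp k v) \<le> norm v"
  unfolding norm_vec_def by (rule L2_set_mono) (auto simp: perp_def)

lemma perp_nth [simp]: "perp k v $ k = 0"
  by (simp add: perp_def)

lemma matrix_vector_mult_perp: "A *v v = v $ k *\<^sub>R column k A + A *v perp k v"
  for A :: "real ^ 'n ^ 'm"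
proof -
  have "v = v $ k *\<^sub>R axis k 1 + perp k v" by (simp add: vec_eq_iff perp_def axis_def)
  then have "A *v v = A *v (v $ k *\<^sub>R axis k 1 + perp k v)" by simp
  then show ?thesis
    by (simp only: matrix_vector_right_distrib matrix_vector_mult_scaleR matrix_vector_mult_basis)
qed

text \<open>The coordinate \<open>z $ k\<close> multiplies column k of P, the tangent of the orbit.
  Differentiating the vanishing gradient along X kills the tangent in the right factor of the form,
  and symmetry of the Hessian kills it in the left one.\<close>

lemma hessian_form_along_orbit:
  fixes b :: "real ^ 'n \<Rightarrow> real ^ 'n" and P :: "real ^ 'n ^ 'n"
  assumes b: "C_b 3 b" and X: "\<And>t. (X has_vector_derivative b (X t)) (at t)"
    and grad: "\<And>t. gradient (divergence b) (X t) = 0"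
    and col: "column k P = b (X t)"
  defines "Q \<equiv> hessian (divergence b) (X t)"
  shows "(P *v z) \<bullet> (Q *v (P *v z)) = (P *v perp k z) \<bullet> (Q *v (P *v perp k z))"
proof -
  have sym: "(Q *v v) \<bullet> u = (Q *v u) \<bullet> v" for u v
    unfolding Q_def by (rule second_derivative_symmetric[OF divergence_C2(1)[OF b] divergence_C2(2)[OF b]])
  have "((\<lambda>t. gradient (divergence b) (X t)) has_vector_derivative Q *v b (X t)) (at t)"
    unfolding has_vector_derivative_def
    using has_derivative_compose[OF X[of t, unfolded has_vector_derivative_def] divergence_C2(2)[OF b, of "X t"]]
    by (simp add: Q_def matrix_vector_mult_scaleR)
  moreover have "((\<lambda>t. gradient (divergence b) (X t)) has_vector_derivative 0) (at t)"
    unfolding grad by (rule has_vector_derivative_const)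
  ultimately have Qb: "Q *v b (X t) = 0" by (rule vector_derivative_unique_at)
  let ?u = "P *v perp k z" and ?b = "b (X t)"
  have "P *v z = z $ k *\<^sub>R ?b + ?u" using matrix_vector_mult_perp[of P z k] col by simp
  then have "(P *v z) \<bullet> (Q *v (P *v z)) = (z $ k *\<^sub>R ?b + ?u) \<bullet> (Q *v ?u)"
    by (simp add: matrix_vector_right_distrib matrix_vector_mult_scaleR Qb)
  also have "?b \<bullet> (Q *v ?u) = 0" using sym[of ?u ?b] Qb by (simp add: inner_commute)
  then have "(z $ k *\<^sub>R ?b + ?u) \<bullet> (Q *v ?u) = ?u \<bullet> (Q *v ?u)" by (simp add: inner_add_left)
  finally show ?thesis .
qed

section \<open>The variational equation\<close>

context fractional_kernel begin

lemma L2_kernel_integrable: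
  fixes u :: "real \<Rightarrow> real ^ 'n"
  assumes u: "L2_on L u" and t: "t \<le> L"
  shows "set_integrable lebesgue {0..t} (\<lambda>s. k t s *\<^sub>R u s)"
proof -
  define U where "U s = indicator {0..L} s *\<^sub>R u s" for s
  have um: "U \<in> borel_measurable lebesgue"
    using u by (simp add: L2_on_def set_borel_measurable_def U_def[abs_def])
  have ui: "integrable lebesgue (\<lambda>s. (norm (U s))\<^sup>2)"
  proof -
    have "(\<lambda>s. (norm (U s))\<^sup>2) = (\<lambda>s. indicator {0..L} s *\<^sub>R (norm (u s))\<^sup>2)"
      by (auto simp: fun_eq_iff indicator_def U_def)
    then show ?thesis using u by (simp only: L2_on_def set_integrable_def)
  qed
  have km: "ker t \<in> borel_measurable lebesgue" by (intro measurable_completion) simp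
  have ki: "integrable lebesgue (\<lambda>s. (ker t s)\<^sup>2)"
    using ker_square_integrable by (subst integrable_completion) auto
  have "integrable lebesgue (\<lambda>s. ker t s *\<^sub>R U s)"
  proof (rule Bochner_Integration.integrable_bound[OF Bochner_Integration.integrable_add[OF ki ui]])
    show "(\<lambda>s. ker t s *\<^sub>R U s) \<in> borel_measurable lebesgue"
      by (rule borel_measurable_scaleR[OF km um])
    show "AE s in lebesgue. norm (ker t s *\<^sub>R U s) \<le> norm ((ker t s)\<^sup>2 + (norm (U s))\<^sup>2)"
    proof (intro AE_I2)
      fix s
      have "ker t s * norm (U s) \<le> (ker t s)\<^sup>2 + (norm (U s))\<^sup>2"
        using sum_squares_bound[of "ker t s" "norm (U s)"] mult_nonneg_nonneg[OF ker_nonneg norm_ge_zero, of t s "U s"]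
        by linarith
      moreover have "norm (ker t s *\<^sub>R U s) = ker t s * norm (U s)" using ker_nonneg[of t s] by simp
      ultimately show "norm (ker t s *\<^sub>R U s) \<le> norm ((ker t s)\<^sup>2 + (norm (U s))\<^sup>2)" by (simp only: real_norm_def)
    qed
  qed
  then show ?thesis unfolding set_integrable_def
    by (rule integrable_discrete_difference[of "{0, t}", THEN iffD1, rotated 4])
       (use t in \<open>auto simp: ker_def indicator_def U_def\<close>)
qed

lemma K_H_diff:
  fixes u v :: "real \<Rightarrow> real ^ 'n"
  assumes "L2_on L u" "L2_on L v" "t \<le> L"
  shows "KH (\<lambda>s. u s - v s) t = KH u t - KH v t"
  unfolding K_H_def scaleR_diff_right
  by (intro set_integral_diff L2_kernel_integrable[OF assms(1,3)] L2_kernel_integrable[OF assms(2,3)])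

lemma L2_on_diff:
  fixes u v :: "real \<Rightarrow> real ^ 'n"
  assumes u: "L2_on L u" and v: "L2_on L v"
  shows "L2_on L (\<lambda>s. u s - v s)"
proof -
  let ?i = "indicator {0..L} :: real \<Rightarrow> real"
  have m: "(\<lambda>s. ?i s *\<^sub>R u s - ?i s *\<^sub>R v s) \<in> borel_measurable lebesgue"
    using u v by (intro borel_measurable_diff) (auto simp: L2_on_def set_borel_measurable_def)
  have "integrable lebesgue (\<lambda>s. 2 * (?i s *\<^sub>R (norm (u s))\<^sup>2) + 2 * (?i s *\<^sub>R (norm (v s))\<^sup>2))"
    using u v by (intro Bochner_Integration.integrable_add Bochner_Integration.integrable_mult_right)
      (auto simp: L2_on_def set_integrable_def)
  then have "integrable lebesgue (\<lambda>s. (norm (?i s *\<^sub>R u s - ?i s *\<^sub>R v s))\<^sup>2)"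
  proof (rule Bochner_Integration.integrable_bound)
    show "(\<lambda>s. (norm (?i s *\<^sub>R u s - ?i s *\<^sub>R v s))\<^sup>2) \<in> borel_measurable lebesgue"
      by (intro borel_measurable_power measurable_compose[OF m borel_measurable_norm])
    show "AE s in lebesgue. norm ((norm (?i s *\<^sub>R u s - ?i s *\<^sub>R v s))\<^sup>2) \<le>
        norm (2 * (?i s *\<^sub>R (norm (u s))\<^sup>2) + 2 * (?i s *\<^sub>R (norm (v s))\<^sup>2))"
    proof (intro AE_I2)
      fix s
      have "(norm (u s - v s))\<^sup>2 \<le> 2 * (norm (u s))\<^sup>2 + 2 * (norm (v s))\<^sup>2"
        using norm_add_square_le[of "u s" "- v s"] by simp
      then show "norm ((norm (?i s *\<^sub>R u s - ?i s *\<^sub>R v s))\<^sup>2) \<le>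
        norm (2 * (?i s *\<^sub>R (norm (u s))\<^sup>2) + 2 * (?i s *\<^sub>R (norm (v s))\<^sup>2))"
        by (simp add: indicator_def)
    qed
  qed
  moreover have "(\<lambda>s. (norm (?i s *\<^sub>R u s - ?i s *\<^sub>R v s))\<^sup>2) = (\<lambda>s. ?i s *\<^sub>R (norm (u s - v s))\<^sup>2)"
    by (auto simp: fun_eq_iff indicator_def)
  ultimately show ?thesis using m
    by (simp only: L2_on_def set_borel_measurable_def set_integrable_def scaleR_diff_right simp_thms)
qed

end

text \<open>Gronwall in differential form:
  \<open>exp (- 2 * B * s) * (\<eta> s \<bullet> \<eta> s)\<close> is nonincreasing and starts at
  0.\<close>

lemma linear_integral_equation_zero:
  fixes A :: "real \<Rightarrow> real ^ 'n ^ 'n"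
  assumes A: "continuous_on {0..L} A" "\<And>t. t \<in> {0..L} \<Longrightarrow> norm (A t) \<le> B"
    and \<eta>: "continuous_on {0..L} \<eta>" "\<And>t. t \<in> {0..L} \<Longrightarrow> \<eta> t = integral {0..t} (\<lambda>s. A s *v \<eta> s)"
    and t: "t \<in> {0..L}"
  shows "\<eta> t = 0"
proof -
  have c: "continuous_on {0..L} (\<lambda>s. A s *v \<eta> s)" by (intro continuous_intros A \<eta>)
  have d: "(\<eta> has_vector_derivative A s *v \<eta> s) (at s within {0..L})" if "s \<in> {0..L}" for s
    by (rule has_vector_derivative_transform[OF that _ integral_has_vector_derivative[OF c that]])
       (use \<eta>(2) in auto)
  let ?f = "\<lambda>s. exp (- 2 * B * s) * (\<eta> s \<bullet> \<eta> s)"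
  have "?f t \<le> ?f 0"
  proof (rule DERIV_nonpos_imp_decreasing_open[where f = ?f and a = 0 and b = t])
    show "continuous_on {0..t} ?f"
      using t by (intro continuous_intros continuous_on_subset[OF \<eta>(1)]) auto
    fix s assume s: "0 < s" "s < t"
    then have sL: "s \<in> {0..L}" "s \<in> interior {0..L}" using t by (auto simp: interior_atLeastAtMost_real)
    have ds: "(\<eta> has_vector_derivative A s *v \<eta> s) (at s)"
      using d[OF sL(1)] at_within_interior[OF sL(2)] by simp
    have "((\<lambda>s. \<eta> s \<bullet> \<eta> s) has_vector_derivative \<eta> s \<bullet> (A s *v \<eta> s) + (A s *v \<eta> s) \<bullet> \<eta> s) (at s)"
      by (rule bounded_bilinear.has_vector_derivative[OF bounded_bilinear_inner ds ds])
    then have "((\<lambda>s. \<eta> s \<bullet> \<eta> s) has_real_derivative 2 * (\<eta> s \<bullet> (A s *v \<eta> s))) (at s)"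
      by (simp add: has_real_derivative_iff_has_vector_derivative inner_commute)
    then have "(?f has_real_derivative exp (- 2 * B * s) * (- 2 * B) * (\<eta> s \<bullet> \<eta> s)
        + exp (- 2 * B * s) * (2 * (\<eta> s \<bullet> (A s *v \<eta> s)))) (at s)"
      by (auto intro!: derivative_eq_intros)
    moreover have "exp (- 2 * B * s) * (- 2 * B) * (\<eta> s \<bullet> \<eta> s)
        + exp (- 2 * B * s) * (2 * (\<eta> s \<bullet> (A s *v \<eta> s))) \<le> 0"
    proof -
      have "\<eta> s \<bullet> (A s *v \<eta> s) \<le> norm (\<eta> s) * norm (A s *v \<eta> s)" by (rule norm_cauchy_schwarz)
      also have "\<dots> \<le> norm (\<eta> s) * (B * norm (\<eta> s))"
        using A(2)[OF sL(1)]
        by (intro mult_left_mono order_trans[OF norm_matrix_vector_mult_le] mult_right_mono) auto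
      also have "\<dots> = B * (\<eta> s \<bullet> \<eta> s)" by (simp add: power2_norm_eq_inner[symmetric] power2_eq_square)
      finally have "exp (- 2 * B * s) * (2 * (\<eta> s \<bullet> (A s *v \<eta> s) - B * (\<eta> s \<bullet> \<eta> s))) \<le> 0"
        by (intro mult_nonneg_nonpos) auto
      then show ?thesis by (simp add: algebra_simps)
    qed
    ultimately show "\<exists>y. (?f has_real_derivative y) (at s) \<and> y \<le> 0" by blast
  qed (use t in auto)
  moreover have "\<eta> 0 = 0" using \<eta>(2)[of 0] t by simp
  ultimately have "\<eta> t \<bullet> \<eta> t \<le> 0" by (simp add: mult_le_0_iff)
  then show ?thesis by (metis inner_gt_zero_iff not_le)
qed

text \<open>Periodicity survives only as the common bound B over the half-line, so the length of an
  interval cannot enter any constant built here. Derivatives are taken within \<open>{0..}\<close>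
  because \<Sigma> is given for nonnegative times.\<close>

locale floquet_system = fractional_kernel +
  fixes \<Sigma> \<Sigma>' A P :: "real \<Rightarrow> real ^ 'n ^ 'n" and R :: "real ^ 'n ^ 'n" and ix :: 'n and B :: real
  assumes \<Sigma>: "\<And>t. 0 \<le> t \<Longrightarrow> (\<Sigma> has_vector_derivative \<Sigma>' t) (at t within {0..})"
    and \<Sigma>': "continuous_on {0..} \<Sigma>'" and A: "continuous_on {0..} A"
    and P: "\<And>t. 0 \<le> t \<Longrightarrow> (P has_vector_derivative A t ** P t - P t ** R) (at t within {0..})"
    and \<Sigma>_inv: "\<And>t. 0 \<le> t \<Longrightarrow> invertible (\<Sigma> t)" and P_inv: "\<And>t. 0 \<le> t \<Longrightarrow> invertible (P t)"
    and B: "0 < B" and \<Sigma>_le: "\<And>t. 0 \<le> t \<Longrightarrow> norm (\<Sigma> t) \<le> B" and \<Sigma>'_le: "\<And>t. 0 \<le> t \<Longrightarrow> norm (\<Sigma>' t) \<le> B"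
    and A_le: "\<And>t. 0 \<le> t \<Longrightarrow> norm (A t) \<le> B" and Pinv_le: "\<And>t. 0 \<le> t \<Longrightarrow> norm (matrix_inv (P t)) \<le> B"
    and R_row: "\<And>i. R $ ix $ i = 0" and R_col: "\<And>i. R $ i $ ix = 0"
    and R_hyp: "\<And>z. eigenvalue_on (- {ix}) R z \<Longrightarrow> Re z \<noteq> 0"
begin

abbreviation Q :: "real \<Rightarrow> real ^ 'n ^ 'n" where "Q t \<equiv> matrix_inv (P t)"

abbreviation KS :: "(real \<Rightarrow> real ^ 'n) \<Rightarrow> real \<Rightarrow> real ^ 'n" where "KS \<equiv> K_H_\<sigma> (1/2 - a) \<Sigma>"

abbreviation drift :: "(real \<Rightarrow> real ^ 'n) \<Rightarrow> real \<Rightarrow> real ^ 'n" where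
  "drift \<eta> t \<equiv> integral {0..t} (\<lambda>s. A s *v \<eta> s)"

lemma \<Sigma>_cont: "continuous_on {0..} \<Sigma>"
  using \<Sigma> by (intro continuous_on_vector_derivative) auto

lemma P_cont: "continuous_on {0..} P"
  using P by (intro continuous_on_vector_derivative) auto

lemma Pinv_cont: "continuous_on {0..} (\<lambda>t. Q t)"
  by (rule continuous_on_matrix_inv[OF P_cont]) (use P_inv in auto)

lemma K_H_continuous:
  assumes "L2_on L u"
  shows "continuous_on {0..L} (KH u)" "0 \<le> L \<Longrightarrow> KH u 0 = 0"
proof -
  obtain w where w: "fractional_integrand a w" "\<And>t. t \<le> L \<Longrightarrow> KH u t = KH w t"
    using L2_on_representative[OF assms] by blast
  have "continuous_on {0..L} (KH w)"
    by (rule continuous_on_subset[OF fractional_integrand.g_continuous[OF w(1)]]) auto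
  then show "continuous_on {0..L} (KH u)"
    using w(2) by (auto elim!: continuous_on_eq)
  show "KH u 0 = 0" if "0 \<le> L"
    using w(2)[OF that] fractional_integrand.g_0[OF w(1)] by simp
qed

lemma K_H_\<sigma>_eq:
  assumes "L2_on L u" and t: "t \<in> {0..L}"
  shows "KS u t = \<Sigma> t *v KH u t - integral {0..t} (\<lambda>s. \<Sigma>' s *v KH u s)"
  using t K_H_continuous[OF assms(1)] 
  by (intro K_H_\<sigma>_by_parts[OF _ \<Sigma> \<Sigma>']) (auto elim: continuous_on_subset)

lemma K_H_\<sigma>_continuous:
  assumes "L2_on L u"
  shows "continuous_on {0..L} (KS u)"
proof -
  have "continuous_on {0..L} (\<lambda>t. \<Sigma> t *v KH u t - integral {0..t} (\<lambda>s. \<Sigma>' s *v KH u s))"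
    by (intro continuous_intros indefinite_integral_continuous_1 integrable_continuous_real
        continuous_on_subset[OF \<Sigma>_cont] continuous_on_subset[OF \<Sigma>'] K_H_continuous(1)[OF assms]) auto
  then show ?thesis
    by (rule continuous_on_eq) (use K_H_\<sigma>_eq[OF assms] in auto)
qed

text \<open>Only the drift needs a preimage, as \<open>\<eta>\<close> already has the preimage u. If
  \<open>KH v\<close> is the primitive of the inverse of \<Sigma> applied to
  \<open>A s *v \<eta> s\<close>, then integrating \<Sigma> against it returns the drift, and
  \<open>u - v\<close> is the preimage sought.\<close>

lemma variational_preimage_exists:
  assumes u: "L2_on L u" and \<eta>: "\<And>t. t \<in> {0..L} \<Longrightarrow> \<eta> t = KS u t"
  shows "\<exists>v. L2_on L v \<and> (\<forall>t\<in>{0..L}. KS v t = \<eta> t - drift \<eta> t)"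
proof -
  have \<eta>c: "continuous_on {0..L} \<eta>"
    by (rule continuous_on_eq[OF K_H_\<sigma>_continuous[OF u]]) (use \<eta> in auto)
  define \<psi> where "\<psi> s = matrix_inv (\<Sigma> s) *v (A s *v \<eta> s)" for s
  have \<psi>c: "continuous_on {0..L} \<psi>" unfolding \<psi>_def
    by (intro continuous_intros \<eta>c continuous_on_subset[OF A] continuous_on_matrix_inv continuous_on_subset[OF \<Sigma>_cont])
       (use \<Sigma>_inv in auto)
  obtain v where v: "L2_on L v" "\<And>t. t \<in> {0..L} \<Longrightarrow> KH v t = integral {0..t} \<psi>"
    using K_H_surjective_on_primitives[OF \<psi>c] by blast
  have Kv: "KS v t = drift \<eta> t" if t: "t \<in> {0..L}" for t
  proof -
    let ?p = "\<lambda>t. integral {0..t} \<psi>"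
    have h1: "((\<lambda>s. \<Sigma> s *v \<psi> s + \<Sigma>' s *v ?p s) has_integral \<Sigma> t *v ?p t - \<Sigma> 0 *v ?p 0) {0..t}"
    proof (rule fundamental_theorem_of_calculus)
      fix s assume s: "s \<in> {0..t}"
      have sub: "{0..t} \<subseteq> {0..}" "{0..t} \<subseteq> {0..L}" using t by auto
      show "((\<lambda>s. \<Sigma> s *v ?p s) has_vector_derivative \<Sigma> s *v \<psi> s + \<Sigma>' s *v ?p s) (at s within {0..t})"
        by (rule has_vector_derivative_matrix_vector_mult[OF has_vector_derivative_within_subset[OF \<Sigma> sub(1)]
              integral_has_vector_derivative[OF continuous_on_subset[OF \<psi>c sub(2)]]]) (use s in auto)
    qed (use t in auto)
    have h2: "((\<lambda>s. \<Sigma>' s *v ?p s) has_integral integral {0..t} (\<lambda>s. \<Sigma>' s *v ?p s)) {0..t}"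
      using t by (intro integrable_integral integrable_continuous_real continuous_intros continuous_on_subset[OF \<Sigma>']
          indefinite_integral_continuous_1 continuous_on_subset[OF \<psi>c]) auto
    have "((\<lambda>s. \<Sigma> s *v \<psi> s) has_integral \<Sigma> t *v ?p t - \<Sigma> 0 *v ?p 0 - integral {0..t} (\<lambda>s. \<Sigma>' s *v ?p s)) {0..t}"
      using has_integral_diff[OF h1 h2] by simp
    then have "integral {0..t} (\<lambda>s. \<Sigma> s *v \<psi> s) = \<Sigma> t *v ?p t - integral {0..t} (\<lambda>s. \<Sigma>' s *v ?p s)"
      by (simp add: integral_unique)
    moreover have "integral {0..t} (\<lambda>s. \<Sigma> s *v \<psi> s) = drift \<eta> t"
      by (intro integral_cong) (use \<Sigma>_inv matrix_inv_inverse(1) in \<open>auto simp: \<psi>_def\<close>)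
    moreover have "integral {0..t} (\<lambda>s. \<Sigma>' s *v KH v s) = integral {0..t} (\<lambda>s. \<Sigma>' s *v ?p s)"
      by (intro integral_cong) (use t v(2) in auto)
    ultimately show ?thesis using K_H_\<sigma>_eq[OF v(1) t] v(2)[OF t] by simp
  qed
  let ?w = "\<lambda>s. u s - v s"
  have w: "L2_on L ?w" by (rule L2_on_diff[OF u v(1)])
  have "KS ?w t = \<eta> t - drift \<eta> t" if t: "t \<in> {0..L}" for t
  proof -
    have Kd: "KH ?w s = KH u s - KH v s" if "s \<le> L" for s
      by (rule K_H_diff[OF u v(1) that])
    have i: "(\<lambda>s. \<Sigma>' s *v KH x s) integrable_on {0..t}" if "L2_on L x" for x
      using t by (intro integrable_continuous_real continuous_intros continuous_on_subset[OF \<Sigma>']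
          continuous_on_subset[OF K_H_continuous(1)[OF that]]) auto
    have "integral {0..t} (\<lambda>s. \<Sigma>' s *v KH ?w s) =
        integral {0..t} (\<lambda>s. \<Sigma>' s *v KH u s - \<Sigma>' s *v KH v s)"
      by (intro integral_cong) (use t Kd in \<open>auto simp: matrix_vector_mult_diff_distrib\<close>)
    also have "\<dots> = integral {0..t} (\<lambda>s. \<Sigma>' s *v KH u s) - integral {0..t} (\<lambda>s. \<Sigma>' s *v KH v s)"
      by (rule Henstock_Kurzweil_Integration.integral_diff[OF i[OF u] i[OF v(1)]])
    finally have "KS ?w t = KS u t - KS v t"
      using t Kd[of t] by (simp add: K_H_\<sigma>_eq[OF w t] K_H_\<sigma>_eq[OF u t] K_H_\<sigma>_eq[OF v(1) t] matrix_vector_mult_diff_distrib)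
    then show ?thesis using Kv[OF t] \<eta>[OF t] by simp
  qed
  with w show ?thesis by blast
qed

text \<open>Zero energy forces \<open>KH u = 0\<close> by the Hoelder bound, and
  \<open>\<eta>\<close> then solves a homogeneous Volterra equation. This makes the second variation
  strictly positive instead of merely nonnegative.\<close>

lemma variational_equation_nondegenerate:
  assumes u: "L2_on L u" and zero: "(LINT t:{0..L}|lebesgue. (norm (u t))\<^sup>2) = 0"
    and \<eta>: "continuous_on {0..L} \<eta>"
    and eq: "\<And>t. t \<in> {0..L} \<Longrightarrow> KS u t = \<eta> t - drift \<eta> t"
    and t: "t \<in> {0..L}"
  shows "\<eta> t = 0"
proof -
  obtain w where w: "fractional_integrand a w"
    "(\<integral>s. (norm (w s))\<^sup>2 \<partial>lborel) = (LINT t:{0..L}|lebesgue. (norm (u t))\<^sup>2)"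
    "\<And>t. t \<le> L \<Longrightarrow> KH u t = KH w t"
    using L2_on_representative[OF u] by blast
  interpret w: fractional_integrand a w by (rule w(1))
  have "w.W = 0" using w(2) zero by (simp add: w.W_def)
  then have "w.g s = 0" if "0 \<le> s" for s
    using w.g_Hoelder[of 0 s] that by (simp add: w.g_0)
  then have g0: "KH u s = 0" if "s \<in> {0..L}" for s using w(3) that by simp
  have "\<eta> s = integral {0..s} (\<lambda>s. A s *v \<eta> s)" if s: "s \<in> {0..L}" for s
  proof -
    have "integral {0..s} (\<lambda>s. \<Sigma>' s *v KH u s) = integral {0..s} (\<lambda>s. 0)"
      by (intro integral_cong) (use s g0 in auto)
    then have "KS u s = 0" using K_H_\<sigma>_eq[OF u s] g0[OF s] by simp
    then show ?thesis using eq[OF s] by simp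
  qed
  then show ?thesis
    by (intro linear_integral_equation_zero[OF continuous_on_subset[OF A] A_le \<eta> _ t]) auto
qed

lemma R_mult_perp: "R *v v = R *v perp ix v" "perp ix (R *v v) = R *v perp ix v"
proof -
  have "column ix R = 0" by (simp add: column_def vec_eq_iff R_col)
  then show 1: "R *v v = R *v perp ix v" using matrix_vector_mult_perp[of R v ix] by simp
  have "(R *v v) $ ix = 0" by (simp add: matrix_vector_mult_def R_row)
  then have "perp ix (R *v v) = R *v v" by (simp add: perp_def vec_eq_iff)
  with 1 show "perp ix (R *v v) = R *v perp ix v" by simp
qed

text \<open>Bounds the transformed forcing \<open>Q t *v h t\<close> of
  \<open>transversal_estimate\<close> when l and D are at most 1: the outer B stands for the inverse
  of P, \<open>B * B\<close> for the term with A and \<Sigma>, and one B each for the terms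
  \<open>\<Sigma>' t *v l t\<close> and \<open>\<Sigma> t *v D t\<close>.\<close>

definition forcing_const :: real where "forcing_const = B * (B * B + 2 * B)"

text \<open>The order of quantifiers is the point: C precedes L, u and \<open>\<eta>\<close>, being
  built from a, B and the constant of \<open>hyperbolic_estimate\<close> only.\<close>

lemma transversal_estimate:
  obtains C where "0 \<le> C"
    "\<And>L u \<eta>. 0 \<le> L \<Longrightarrow> L2_on L u \<Longrightarrow> continuous_on {0..L} \<eta> \<Longrightarrow> \<eta> 0 = 0 \<Longrightarrow> \<eta> L = 0 \<Longrightarrow>
      (\<And>t. t \<in> {0..L} \<Longrightarrow> KS u t = \<eta> t - drift \<eta> t) \<Longrightarrow>
      integral {0..L} (\<lambda>t. (norm (perp ix (Q t *v \<eta> t)))\<^sup>2) \<le>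
        C * (LINT t:{0..L}|lebesgue. (norm (u t))\<^sup>2)"
proof -
  obtain Ch where Ch: "0 \<le> Ch" "\<And>L y f. 0 \<le> L \<Longrightarrow> continuous_on {0..L} f \<Longrightarrow>
      (\<And>t. t \<in> {0..L} \<Longrightarrow> y t $ ix = 0) \<Longrightarrow>
      (\<And>t. t \<in> {0..L} \<Longrightarrow> (y has_vector_derivative R *v y t + f t) (at t within {0..L})) \<Longrightarrow>
      square_norm L y \<le>
        Ch * (square_norm L f + (norm (y 0))\<^sup>2 + (norm (y L))\<^sup>2)"
    using hyperbolic_estimate[OF R_row R_hyp] by blast
  have forcing_const: "0 < forcing_const" using B by (simp add: forcing_const_def add_pos_pos)
  \<comment> \<open>Ch multiplies the forcing and the two end values of z, the last summand is the
    rough part q, and the outer factors 2 come from splitting \<open>z + q\<close>.\<close>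
  let ?C = "2 * (Ch * (forcing_const\<^sup>2 * increment_const + 2 * ((B * B)\<^sup>2 * Hoelder_const))) + 2 * ((B * B)\<^sup>2 * increment_const)"
  have "0 \<le> ?C" using Ch(1) Hoelder_const_pos increment_const_pos by (auto intro!: add_nonneg_nonneg mult_nonneg_nonneg)
  moreover have "integral {0..L} (\<lambda>t. (norm (perp ix (Q t *v \<eta> t)))\<^sup>2) \<le>
        ?C * (LINT t:{0..L}|lebesgue. (norm (u t))\<^sup>2)"
    if L: "0 \<le> L" and u: "L2_on L u" and \<eta>: "continuous_on {0..L} \<eta>" "\<eta> 0 = 0" "\<eta> L = 0"
      and eq: "\<And>t. t \<in> {0..L} \<Longrightarrow> KS u t = \<eta> t - drift \<eta> t"
    for L u \<eta>
  proof -
    obtain w where w: "fractional_integrand a w"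
      "(\<integral>s. (norm (w s))\<^sup>2 \<partial>lborel) = (LINT t:{0..L}|lebesgue. (norm (u t))\<^sup>2)"
      "\<And>t. t \<le> L \<Longrightarrow> KH u t = KH w t"
      using L2_on_representative[OF u] by blast
    interpret w: fractional_integrand a w by (rule w(1))
    define g where "g = w.g"
    have gc: "continuous_on {0..} g" unfolding g_def by (rule w.g_continuous)
    define \<Gamma> where "\<Gamma> t = integral {0..t} g" for t
    \<comment> \<open>The moving average of g over \<open>[t, t + 1]\<close>. For t near L it reads
      g beyond L, where g no longer represents \<open>KH u\<close> but still obeys the same
      estimates.\<close>
    define gt where "gt t = \<Gamma> (t + 1) - \<Gamma> t" for t
    define l where "l t = g t - gt t" for t
    define D where "D t = g (t + 1) - g t" for t
    have sub: "{0..M} \<subseteq> {0..}" for M :: real by auto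
    have d\<Gamma>: "(\<Gamma> has_vector_derivative g t) (at t within {0..M})" if "t \<in> {0..M}" for t M
      unfolding \<Gamma>_def by (rule integral_has_vector_derivative[OF continuous_on_subset[OF gc sub] that])
    have dgt: "(gt has_vector_derivative D t) (at t within {0..L})" if t: "t \<in> {0..L}" for t
    proof -
      have "((\<lambda>t. t + 1) has_vector_derivative 1) (at t within {0..L})"
        by (auto intro!: derivative_eq_intros)
      moreover have "(\<Gamma> has_vector_derivative g (t + 1)) (at (t + 1) within (\<lambda>t. t + 1) ` {0..L})"
        by (rule has_vector_derivative_within_subset[OF d\<Gamma>[of _ "L + 1"]]) (use t in auto)
      ultimately have "((\<lambda>t. \<Gamma> (t + 1)) has_vector_derivative g (t + 1)) (at t within {0..L})"
        using vector_diff_chain_within[of "\<lambda>t. t + 1" 1 t "{0..L}" \<Gamma> "g (t + 1)"] by (simp add: o_def)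
      from has_vector_derivative_diff[OF this d\<Gamma>[OF t]] show ?thesis
        unfolding gt_def[abs_def] D_def by simp
    qed
    have gtc: "continuous_on {0..L} gt"
      using dgt by (rule continuous_on_vector_derivative)
    have gcL: "continuous_on {0..L} g" by (rule continuous_on_subset[OF gc sub])
    have lc: "continuous_on {0..L} l" unfolding l_def by (intro continuous_intros gcL gtc)
    have g1c: "continuous_on {0..L} (\<lambda>t. g (t + 1))"
      by (rule continuous_on_compose2[OF gc]) (auto intro!: continuous_intros)
    have Dc: "continuous_on {0..L} D" unfolding D_def by (intro continuous_intros gcL g1c)
    have l_le: "norm (l t) \<le> m" if t: "0 \<le> t" and m: "\<And>h. 0 \<le> h \<Longrightarrow> h \<le> 1 \<Longrightarrow> norm (g (t + h) - g t) \<le> m" for t m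
    proof -
      have c: "continuous_on {x..y} g" if "0 \<le> x" for x y
        by (rule continuous_on_subset[OF gc]) (use that in auto)
      have "\<Gamma> t + integral {t..t+1} g = \<Gamma> (t + 1)" unfolding \<Gamma>_def
        using t by (intro Henstock_Kurzweil_Integration.integral_combine integrable_continuous_real c) auto
      then have gt: "gt t = integral {t..t+1} g" unfolding gt_def by (metis add_diff_cancel_left')
      have "((\<lambda>s. g t - g s) has_integral (t + 1 - t) *\<^sub>R g t - integral {t..t+1} g) {t..t+1}"
        using t by (intro has_integral_diff has_integral_const_real[THEN has_integral_eq_rhs] integrable_integral
            integrable_continuous_real c) auto
      \<comment> \<open>As a mean of \<open>g t - g s\<close> over a unit interval, l inherits every
        bound on the increments of lag at most 1.\<close>
      then have li: "l t = integral {t..t+1} (\<lambda>s. g t - g s)" unfolding l_def gt by (simp add: integral_unique)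
      have "norm (integral {t..t+1} (\<lambda>s. g t - g s)) \<le> m * (t + 1 - t)"
      proof (rule integral_bound)
        show "continuous_on {t..t+1} (\<lambda>s. g t - g s)" by (intro continuous_intros c t)
        show "norm (g t - g s) \<le> m" if "s \<in> {t..t+1}" for s
          using m[of "s - t"] that by (auto simp: norm_minus_commute)
      qed auto
      then show ?thesis unfolding li by simp
    qed
    have l_pt: "(norm (l t))\<^sup>2 \<le> Hoelder_const * w.W" if t: "0 \<le> t" for t
    proof -
      have "norm (g (t + h) - g t) \<le> sqrt (Hoelder_const * w.W)" if h: "0 \<le> h" "h \<le> 1" for h
      proof (rule real_le_rsqrt)
        have "(norm (g (t + h) - g t))\<^sup>2 \<le> Hoelder_const * h powr (1 - 2 * a) * w.W"
          unfolding g_def by (rule w.g_Hoelder[OF t h(1)])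
        also have "\<dots> \<le> Hoelder_const * 1 * w.W"
          using h a_less Hoelder_const_pos w.W_nonneg by (intro mult_right_mono mult_left_mono powr_le1) auto
        finally show "(norm (g (t + h) - g t))\<^sup>2 \<le> Hoelder_const * w.W" by simp
      qed
      from l_le[OF t this] have "norm (l t) \<le> sqrt (Hoelder_const * w.W)" .
      from power_mono[OF this, of 2] show ?thesis using Hoelder_const_pos w.W_nonneg by simp
    qed
    \<comment> \<open>This is \<open>\<eta>\<close> with g replaced by its average in the boundary
      term of the by-parts formula; the integral of \<open>\<Sigma>' s *v g s\<close> is already C^1
      and keeps g.\<close>
    define E where "E t = drift \<eta> t - integral {0..t} (\<lambda>s. \<Sigma>' s *v g s) + \<Sigma> t *v gt t" for t
    have Ac: "continuous_on {0..L} A" and \<Sigma>c: "continuous_on {0..L} \<Sigma>" and \<Sigma>'c: "continuous_on {0..L} \<Sigma>'"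
      and Qc: "continuous_on {0..L} (\<lambda>t. Q t)"
      by (rule continuous_on_subset[OF _ sub], rule A \<Sigma>_cont \<Sigma>' Pinv_cont)+
    have E_eq: "\<eta> t = E t + \<Sigma> t *v l t" if t: "t \<in> {0..L}" for t
    proof -
      have "integral {0..t} (\<lambda>s. \<Sigma>' s *v KH u s) = integral {0..t} (\<lambda>s. \<Sigma>' s *v g s)"
        unfolding g_def by (intro integral_cong) (use t w(3) in auto)
      then have "\<eta> t - drift \<eta> t = \<Sigma> t *v g t - integral {0..t} (\<lambda>s. \<Sigma>' s *v g s)"
        using eq[OF t] K_H_\<sigma>_eq[OF u t] w(3)[of t] t by (simp add: g_def)
      then show ?thesis by (simp add: E_def l_def matrix_vector_mult_diff_distrib algebra_simps)
    qed
    \<comment> \<open>What is left of the derivative of E after subtracting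
      \<open>A t *v E t\<close>: the drift acts on \<open>E t + \<Sigma> t *v l t\<close>, and the
      terms of \<open>\<Sigma>'\<close> with g and gt combine into one with l. Only l and D
      occur.\<close>
    define h where "h t = A t *v (\<Sigma> t *v l t) - \<Sigma>' t *v l t + \<Sigma> t *v D t" for t
    have hc: "continuous_on {0..L} h" unfolding h_def by (intro continuous_intros Ac \<Sigma>c \<Sigma>'c lc Dc)
    have dE: "(E has_vector_derivative A t *v E t + h t) (at t within {0..L})" if t: "t \<in> {0..L}" for t
    proof -
      have "(E has_vector_derivative A t *v \<eta> t - \<Sigma>' t *v g t + (\<Sigma> t *v D t + \<Sigma>' t *v gt t)) (at t within {0..L})"
        unfolding E_def[abs_def]
        by (intro has_vector_derivative_add has_vector_derivative_diff integral_has_vector_derivative t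
            has_vector_derivative_matrix_vector_mult dgt has_vector_derivative_within_subset[OF \<Sigma> sub]
            continuous_intros Ac \<Sigma>'c \<eta> gcL) (use t in auto)
      also have "A t *v \<eta> t - \<Sigma>' t *v g t + (\<Sigma> t *v D t + \<Sigma>' t *v gt t) = A t *v E t + h t"
        unfolding E_eq[OF t] h_def l_def by (simp add: matrix_vector_right_distrib matrix_vector_mult_diff_distrib)
      finally show ?thesis .
    qed
    define y where "y t = Q t *v E t" for t
    have dy: "(y has_vector_derivative R *v y t + Q t *v h t) (at t within {0..L})" if t: "t \<in> {0..L}" for t
    proof -
      have inv: "P x *v (matrix_inv (P x) *v v) = v" "matrix_inv (P x) *v (P x *v v) = v" if "x \<in> {0..L}" for x v
        using matrix_inv_inverse[OF P_inv] that by auto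
      have "((\<lambda>x. matrix_inv (P x) *v E x) has_vector_derivative
          Q t *v ((A t *v E t + h t) - (A t ** P t - P t ** R) *v (Q t *v E t))) (at t within {0..L})"
      proof (rule has_vector_derivative_matrix_inv_mult[OF _ dE[OF t] _ inv t])
        show "(P has_vector_derivative A t ** P t - P t ** R) (at t within {0..L})"
          by (rule has_vector_derivative_within_subset[OF P sub]) (use t in auto)
        show "((\<lambda>t. Q t) \<longlongrightarrow> Q t) (at t within {0..L})"
          using Qc t by (simp add: continuous_on_def)
      qed
      also have "Q t *v ((A t *v E t + h t) - (A t ** P t - P t ** R) *v (Q t *v E t))
         = R *v y t + Q t *v h t"
        using inv[OF t]
        by (simp add: y_def matrix_vector_mult_diff_rdistrib matrix_vector_mul_assoc[symmetric]
            matrix_vector_right_distrib matrix_vector_mult_diff_distrib)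
      finally show ?thesis unfolding y_def .
    qed
    \<comment> \<open>Row and column ix of R vanish, so the projection commutes with R and z solves
      a closed system with forcing f.\<close>
    define z where "z t = perp ix (y t)" for t
    define f where "f t = perp ix (Q t *v h t)" for t
    define q where "q t = perp ix (Q t *v (\<Sigma> t *v l t))" for t
    have fc: "continuous_on {0..L} f" and qc: "continuous_on {0..L} q" and zc: "continuous_on {0..L} z"
    proof -
      show "continuous_on {0..L} f" "continuous_on {0..L} q" unfolding f_def q_def
        by (intro bounded_linear.continuous_on[OF bounded_linear_perp] continuous_intros Qc hc \<Sigma>c lc)+
      have "continuous_on {0..L} y" using dy by (rule continuous_on_vector_derivative)
      then show "continuous_on {0..L} z" unfolding z_def
        by (rule bounded_linear.continuous_on[OF bounded_linear_perp])
    qed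
    have dz: "(z has_vector_derivative R *v z t + f t) (at t within {0..L})" if t: "t \<in> {0..L}" for t
    proof -
      have "(z has_vector_derivative perp ix (R *v y t + Q t *v h t)) (at t within {0..L})"
        unfolding z_def[abs_def] by (rule bounded_linear.has_vector_derivative[OF bounded_linear_perp dy[OF t]])
      then show ?thesis
        by (simp add: linear_add[OF bounded_linear.linear[OF bounded_linear_perp]] R_mult_perp(2) z_def f_def)
    qed
    have Q\<Sigma>_le: "norm (Q t *v (\<Sigma> t *v v)) \<le> B * B * norm v" if "0 \<le> t" for t v
    proof -
      have "norm (Q t *v (\<Sigma> t *v v)) \<le> norm (Q t) * (norm (\<Sigma> t) * norm v)"
        by (intro order_trans[OF norm_matrix_vector_mult_le] mult_left_mono norm_matrix_vector_mult_le) auto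
      also have "\<dots> \<le> B * (B * norm v)"
        using Pinv_le[OF that] \<Sigma>_le[OF that] B by (intro mult_mono) auto
      finally show ?thesis by (simp add: mult.assoc)
    qed
    \<comment> \<open>Where \<open>\<eta>\<close> vanishes, \<open>E t\<close> equals
      \<open>- (\<Sigma> t *v l t)\<close>, and the pointwise bound of l applies.\<close>
    have z_end: "(norm (z t))\<^sup>2 \<le> (B * B)\<^sup>2 * Hoelder_const * w.W" if t: "t \<in> {0..L}" and "\<eta> t = 0" for t
    proof -
      have "E t = - (\<Sigma> t *v l t)" using E_eq[OF t] that(2) by (simp add: eq_neg_iff_add_eq_0)
      then have "y t = - (Q t *v (\<Sigma> t *v l t))"
        unfolding y_def by (simp add: linear_neg[OF matrix_vector_mul_linear])
      then have "norm (z t) \<le> B * B * norm (l t)"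
        unfolding z_def using norm_perp_le[of ix "y t"] Q\<Sigma>_le[of t "l t"] t by simp
      from power_mono[OF this, of 2] have "(norm (z t))\<^sup>2 \<le> (B * B)\<^sup>2 * (norm (l t))\<^sup>2"
        by (simp add: power_mult_distrib)
      also have "\<dots> \<le> (B * B)\<^sup>2 * (Hoelder_const * w.W)" using l_pt[of t] t by (intro mult_left_mono) auto
      finally show ?thesis by (simp add: mult.assoc)
    qed
    have If: "square_norm L f \<le> forcing_const\<^sup>2 * increment_const * w.W"
    proof -
      \<comment> \<open>Division by \<open>forcing_const\<close> normalizes f to be dominated by the
        increments with constant 1.\<close>
      have "integral {0..L} (\<lambda>t. (norm (f t) / forcing_const)\<^sup>2) \<le> increment_const * w.W"
      proof (rule w.integral_dominated_by_increments)
        show "continuous_on {0..L} (\<lambda>t. norm (f t) / forcing_const)" using forcing_const by (intro continuous_intros fc) auto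
        show "0 \<le> norm (f t) / forcing_const" for t using forcing_const by simp
        fix t m assume t: "t \<in> {0..L}" and m: "\<And>h. 0 \<le> h \<Longrightarrow> h \<le> 1 \<Longrightarrow> norm (w.g (t + h) - w.g t) \<le> m"
        have t0: "0 \<le> t" using t by simp
        have l: "norm (l t) \<le> m" using l_le[OF t0] m by (simp add: g_def)
        have Dm: "norm (D t) \<le> m" using m[of 1] by (simp add: D_def g_def)
        have m0: "0 \<le> m" using l norm_ge_zero order_trans by blast
        have "norm (h t) \<le> norm (A t *v (\<Sigma> t *v l t)) + norm (\<Sigma>' t *v l t) + norm (\<Sigma> t *v D t)"
          unfolding h_def by (intro order_trans[OF norm_triangle_ineq] add_mono norm_triangle_ineq4 order_refl)
        also have "\<dots> \<le> B * (B * m) + B * m + B * m"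
        proof (intro add_mono)
          show "norm (A t *v (\<Sigma> t *v l t)) \<le> B * (B * m)"
            using A_le[OF t0] \<Sigma>_le[OF t0] B l m0
            by (intro order_trans[OF norm_matrix_vector_mult_le] mult_mono) auto
          show "norm (\<Sigma>' t *v l t) \<le> B * m"
            using \<Sigma>'_le[OF t0] B l by (intro order_trans[OF norm_matrix_vector_mult_le] mult_mono) auto
          show "norm (\<Sigma> t *v D t) \<le> B * m"
            using \<Sigma>_le[OF t0] B Dm by (intro order_trans[OF norm_matrix_vector_mult_le] mult_mono) auto
        qed
        finally have hm: "norm (h t) \<le> B * (B * m) + B * m + B * m" .
        have "norm (f t) \<le> norm (Q t) * norm (h t)"
          unfolding f_def by (intro order_trans[OF norm_perp_le] norm_matrix_vector_mult_le)
        also have "\<dots> \<le> B * (B * (B * m) + B * m + B * m)"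
          using Pinv_le[OF t0] B hm by (intro mult_mono) auto
        also have "\<dots> = forcing_const * m" by (simp add: forcing_const_def algebra_simps)
        finally show "norm (f t) / forcing_const \<le> m" using forcing_const by (simp add: pos_divide_le_eq mult.commute)
      qed
      moreover have "integral {0..L} (\<lambda>t. (norm (f t) / forcing_const)\<^sup>2) = square_norm L f / forcing_const\<^sup>2"
        by (simp add: power_divide)
      ultimately show ?thesis using forcing_const by (simp add: pos_divide_le_eq mult_ac)
    qed
    have Iq: "square_norm L q \<le> (B * B)\<^sup>2 * increment_const * w.W"
    proof -
      have i1: "square_norm L l \<le> increment_const * w.W"
      proof (rule w.integral_dominated_by_increments)
        show "continuous_on {0..L} (\<lambda>t. norm (l t))" by (intro continuous_intros lc)
        fix t m assume t: "t \<in> {0..L}" and m: "\<And>h. 0 \<le> h \<Longrightarrow> h \<le> 1 \<Longrightarrow> norm (w.g (t + h) - w.g t) \<le> m"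
        then show "norm (l t) \<le> m" using l_le[of t m] by (simp add: g_def)
      qed auto
      have "square_norm L q \<le> (B * B)\<^sup>2 * square_norm L l"
        by (rule integral_norm_square_mono[OF qc lc])
           (use Q\<Sigma>_le in \<open>auto simp: q_def intro!: order_trans[OF norm_perp_le]\<close>)
      also have "\<dots> \<le> (B * B)\<^sup>2 * (increment_const * w.W)" by (rule mult_left_mono[OF i1]) simp
      finally show ?thesis by (simp only: mult.assoc)
    qed
    have "square_norm L z \<le>
        Ch * (square_norm L f + (norm (z 0))\<^sup>2 + (norm (z L))\<^sup>2)"
      by (rule Ch(2)[OF L fc _ dz]) (auto simp: z_def)
    also have "\<dots> \<le> Ch * (forcing_const\<^sup>2 * increment_const * w.W + (B * B)\<^sup>2 * Hoelder_const * w.W + (B * B)\<^sup>2 * Hoelder_const * w.W)"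
      by (intro mult_left_mono add_mono If z_end Ch(1)) (use L \<eta> in auto)
    also have "\<dots> = Ch * (forcing_const\<^sup>2 * increment_const + 2 * ((B * B)\<^sup>2 * Hoelder_const)) * w.W" by (simp add: algebra_simps)
    finally have Iz: "square_norm L z \<le> Ch * (forcing_const\<^sup>2 * increment_const + 2 * ((B * B)\<^sup>2 * Hoelder_const)) * w.W" .
    have "integral {0..L} (\<lambda>t. (norm (perp ix (Q t *v \<eta> t)))\<^sup>2) = integral {0..L} (\<lambda>t. (norm (z t + q t))\<^sup>2)"
    proof (intro integral_cong)
      fix t assume t: "t \<in> {0..L}"
      show "(norm (perp ix (Q t *v \<eta> t)))\<^sup>2 = (norm (z t + q t))\<^sup>2"
        unfolding E_eq[OF t] z_def y_def q_def matrix_vector_right_distrib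
        by (simp only: linear_add[OF bounded_linear.linear[OF bounded_linear_perp]])
    qed
    also have "\<dots> \<le> 2 * square_norm L z + 2 * square_norm L q"
      by (rule integral_norm_square_add[OF zc qc])
    also have "\<dots> \<le> 2 * (Ch * (forcing_const\<^sup>2 * increment_const + 2 * ((B * B)\<^sup>2 * Hoelder_const)) * w.W) + 2 * ((B * B)\<^sup>2 * increment_const * w.W)"
      by (intro add_mono mult_left_mono Iz Iq) auto
    also have "\<dots> = ?C * w.W" by (simp add: algebra_simps)
    finally show ?thesis unfolding w.W_def w(2) .
  qed
  ultimately show ?thesis by (rule that)
qed

end

section \<open>Positivity of the second variation\<close>

lemma bounded_linear_diag_matrix: "bounded_linear diag_matrix"
  by (rule linear_conv_bounded_linear[THEN iffD1], rule linearI) (auto simp: diag_matrix_def vec_eq_iff)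

lemma invertible_diag_matrix:
  fixes v :: "real ^ 'n"
  assumes "\<And>i. v $ i \<noteq> 0"
  shows "invertible (diag_matrix v)"
proof -
  have "diag_matrix x ** diag_matrix y = diag_matrix (\<chi> i. x $ i * y $ i)" for x y :: "real ^ 'n"
    by (simp add: diag_matrix_def matrix_matrix_mult_def vec_eq_iff if_distrib[of "\<lambda>z. _ * z"]
        if_distrib[of "\<lambda>z. z * _"] cong: if_cong)
  moreover have "diag_matrix (\<chi> i. 1) = (mat 1 :: real ^ 'n ^ 'n)" by (simp add: diag_matrix_def mat_def vec_eq_iff)
  ultimately show ?thesis
    unfolding invertible_def using assms by (intro exI[of _ "diag_matrix (\<chi> i. 1 / v $ i)"]) simp
qed

lemma LINT_eq_integral:
  fixes f :: "real \<Rightarrow> 'a::euclidean_space"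
  assumes "continuous_on {x..y} f"
  shows "(LINT t:{x..y}|lebesgue. f t) = integral {x..y} f"
  using absolutely_integrable_continuous_real[OF assms] by (rule set_lebesgue_integral_eq_integral(2))

text \<open>At \<open>t = 0\<close> only a right derivative is available, so uniqueness is argued
  within \<open>{0..}\<close>: the shift maps this set into itself, and the filter is nontrivial
  because \<open>at_right t\<close> lies below it.\<close>

lemma periodic_right_derivative:
  fixes f :: "real \<Rightarrow> 'a::real_normed_vector"
  assumes d: "\<And>t. 0 \<le> t \<Longrightarrow> (f has_vector_derivative f' t) (at t within {0..})"
    and per: "\<And>t. 0 \<le> t \<Longrightarrow> f (t + T) = f t" and T: "0 \<le> T" and t: "0 \<le> t"
  shows "f' (t + T) = f' t"
proof -
  have "((\<lambda>s. s + T) has_vector_derivative 1) (at t within {0..})" by (auto intro!: derivative_eq_intros)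
  moreover have "(f has_vector_derivative f' (t + T)) (at (t + T) within (\<lambda>s. s + T) ` {0..})"
    by (rule has_vector_derivative_within_subset[OF d]) (use t T in auto)
  ultimately have "((\<lambda>s. f (s + T)) has_vector_derivative f' (t + T)) (at t within {0..})"
    using vector_diff_chain_within[of "\<lambda>s. s + T" 1 t "{0..}" f "f' (t + T)"] by (simp add: o_def)
  then have "(f has_vector_derivative f' (t + T)) (at t within {0..})"
    by (rule has_vector_derivative_transform[rotated 2]) (use t per in auto)
  moreover have "at t within {0..} \<noteq> bot"
  proof
    assume "at t within {0..} = bot"
    moreover have "at_right t \<le> at t within {0..}" using t by (intro at_le) auto
    ultimately have "at_right t = bot" by (simp add: bot_unique)
    then show False using trivial_limit_at_right_real[of t] by (simp add: trivial_limit_def)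
  qed
  ultimately show ?thesis using vector_derivative_unique_within d[OF t] by blast
qed

theorem theorem5p8:
  fixes H \<alpha> T r :: real
    and b :: "real ^ 'n \<Rightarrow> real ^ 'n"
    and \<sigma> :: "real \<Rightarrow> real ^ 'n"
    and m M x0 :: "real ^ 'n"
    and X :: "real \<Rightarrow> real ^ 'n"
    and P :: "real \<Rightarrow> real ^ 'n ^ 'n"
    and R :: "real ^ 'n ^ 'n"
    and k :: 'n
    and \<Sigma> :: "real \<Rightarrow> real ^ 'n ^ 'n"
  assumes H: "1/4 < H" "H < 1/2" and \<alpha>: "\<alpha> = 1/2 - H"
    and \<Sigma>: "\<Sigma> = (\<lambda>t. diag_matrix (\<sigma> t))"
    and n: "CARD('n) \<ge> 2"
    and T: "0 < T"
    and b: "C_b 3 b"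
    and \<sigma>_C1: "\<exists>\<sigma>'. continuous_on {0..} \<sigma>' \<and>
                  (\<forall>t\<ge>0. (\<sigma> has_vector_derivative \<sigma>' t) (at t within {0..}))"
    and \<sigma>_periodic: "\<forall>t\<ge>0. \<sigma> (t + T) = \<sigma> t"
    and \<sigma>_bounds: "\<forall>i. 0 < m $ i \<and> (\<forall>t\<ge>0. m $ i \<le> \<sigma> t $ i \<and> \<sigma> t $ i \<le> M $ i)"
    and X_solution: "\<forall>t. (X has_vector_derivative b (X t)) (at t)"
    and X_periodic: "\<forall>t. X (t + T) = X t"
    and X_init: "X 0 = x0"
    and X_nonconstant: "\<exists>s t. X s \<noteq> X t"
    and hyperbolic: "transversally_hyperbolic T b X"
    and grad_div: "\<forall>t. gradient (divergence b) (X t) = 0"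
    and P: "floquet_matrix T (\<lambda>t. jacobian b (at (X t))) k P R"
    and P_first: "\<forall>t. column k (P t) = vector_derivative X (at t)"
    and r: "r > \<alpha> + 1/2"
    and sobolev: "periodic_sobolev_matrix T r (\<lambda>t. matrix_inv (\<Sigma> t) ** P t)"
                 "periodic_sobolev_matrix T r (\<lambda>t. matrix_inv (P t) ** \<Sigma> t)"
  shows "\<exists>\<epsilon>\<^sub>0>0. \<forall>N::nat. N \<ge> 1 \<longrightarrow> (\<forall>\<epsilon>. 0 < \<epsilon> \<and> \<epsilon> < \<epsilon>\<^sub>0 \<longrightarrow>
           (\<forall>\<eta> \<in> \<H>_H_\<sigma>_0 H \<Sigma> (real N * T). (\<exists>t\<in>{0..real N * T}. \<eta> t \<noteq> 0) \<longrightarrow>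
              second_variation H \<Sigma> b X \<epsilon> (real N * T) \<eta> > 0))"
proof -
  define A where "A t = jacobian b (at (X t))" for t
  have Heq: "H = 1/2 - \<alpha>" using \<alpha> by simp
  obtain \<sigma>' where \<sigma>': "continuous_on {0..} \<sigma>'" "\<And>t. 0 \<le> t \<Longrightarrow> (\<sigma> has_vector_derivative \<sigma>' t) (at t within {0..})"
    using \<sigma>_C1 by blast
  define \<Sigma>' where "\<Sigma>' t = diag_matrix (\<sigma>' t)" for t
  have d\<Sigma>: "(\<Sigma> has_vector_derivative \<Sigma>' t) (at t within {0..})" if "0 \<le> t" for t
    unfolding \<Sigma> \<Sigma>'_def by (rule bounded_linear.has_vector_derivative[OF bounded_linear_diag_matrix \<sigma>'(2)[OF that]])
  have \<Sigma>'c: "continuous_on {0..} \<Sigma>'"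
    unfolding \<Sigma>'_def by (rule bounded_linear.continuous_on[OF bounded_linear_diag_matrix \<sigma>'(1)])
  have \<Sigma>per: "\<Sigma> (t + T) = \<Sigma> t" if "0 \<le> t" for t using \<sigma>_periodic that by (simp add: \<Sigma>)
  have \<Sigma>'per: "\<Sigma>' (t + T) = \<Sigma>' t" if "0 \<le> t" for t
    by (rule periodic_right_derivative[OF d\<Sigma> \<Sigma>per less_imp_le[OF T] that])
  have Xc: "continuous_on S X" for S
    using X_solution by (intro continuous_on_vector_derivative[of _ _ "\<lambda>t. b (X t)"]) (auto intro: has_vector_derivative_at_within)
  have bS: "C_b (Suc 2) b" using b by (simp add: numeral_3_eq_3 numeral_2_eq_2)
  have Ac: "continuous_on S A" for S
    unfolding A_def by (rule continuous_on_compose2[OF jacobian_continuous[OF bS] Xc]) auto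
  have Aper: "A (t + T) = A t" for t using X_periodic by (simp add: A_def)
  define Q where "Q t = hessian (divergence b) (X t)" for t
  have Qc: "continuous_on S Q" for S
    unfolding Q_def by (rule continuous_on_compose2[OF divergence_C2(3)[OF b] Xc]) auto
  have Qper: "Q (t + T) = Q t" for t using X_periodic by (simp add: Q_def)
  have Pper: "P (t + T) = P t" and Pinv: "invertible (P t)"
    and dP: "(P has_vector_derivative (A t ** P t - P t ** R)) (at t)"
    and R0: "R $ i $ k = 0" "R $ k $ i = 0" and Rh: "eigenvalue_on (- {k}) R z \<Longrightarrow> Re z \<noteq> 0" for t i z
    using P unfolding floquet_matrix_def A_def by auto
  have Pc: "continuous_on S P" for S
    using dP by (intro continuous_on_vector_derivative) (auto intro: has_vector_derivative_at_within)
  have \<Sigma>c: "continuous_on {0..} \<Sigma>"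
    using d\<Sigma> by (intro continuous_on_vector_derivative) auto
  obtain B1 where B1: "0 < B1" "\<And>t. 0 \<le> t \<Longrightarrow> norm (\<Sigma> t) \<le> B1"
    using bounded_of_periodic[OF \<Sigma>c T \<Sigma>per] by blast
  obtain B2 where B2: "0 < B2" "\<And>t. 0 \<le> t \<Longrightarrow> norm (\<Sigma>' t) \<le> B2"
    using bounded_of_periodic[OF \<Sigma>'c T \<Sigma>'per] by blast
  obtain B3 where B3: "0 < B3" "\<And>t. 0 \<le> t \<Longrightarrow> norm (A t) \<le> B3"
    using bounded_of_periodic[OF Ac T Aper] by blast
  have "continuous_on {0..} (\<lambda>t. matrix_inv (P t))" by (rule continuous_on_matrix_inv[OF Pc Pinv])
  then obtain B4 where B4: "0 < B4" "\<And>t. 0 \<le> t \<Longrightarrow> norm (matrix_inv (P t)) \<le> B4"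
    using bounded_of_periodic[of "\<lambda>t. matrix_inv (P t)", OF _ T] Pper by metis
  obtain BP where BP: "0 < BP" "\<And>t. 0 \<le> t \<Longrightarrow> norm (P t) \<le> BP"
    using bounded_of_periodic[OF Pc T Pper] by blast
  obtain BQ where BQ: "0 < BQ" "\<And>t. 0 \<le> t \<Longrightarrow> norm (Q t) \<le> BQ"
    using bounded_of_periodic[OF Qc T Qper] by blast
  have \<Sigma>inv: "invertible (\<Sigma> t)" if "0 \<le> t" for t
    unfolding \<Sigma> using \<sigma>_bounds that by (intro invertible_diag_matrix) (metis less_le_trans less_irrefl)
  interpret fs: floquet_system \<alpha> \<Sigma> \<Sigma>' A P R k "B1 + B2 + B3 + B4"
  proof unfold_locales
    show "0 < \<alpha>" "\<alpha> < 1/2" using H \<alpha> by auto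
    fix t :: real assume t: "0 \<le> t"
    show "norm (\<Sigma> t) \<le> B1 + B2 + B3 + B4" "norm (\<Sigma>' t) \<le> B1 + B2 + B3 + B4"
      "norm (A t) \<le> B1 + B2 + B3 + B4" "norm (matrix_inv (P t)) \<le> B1 + B2 + B3 + B4"
      using B1(2)[OF t] B2(2)[OF t] B3(2)[OF t] B4(2)[OF t] B1(1) B2(1) B3(1) B4(1) by linarith+
  qed (use d\<Sigma> \<Sigma>'c Ac \<Sigma>inv Pinv R0 Rh B1(1) B2(1) B3(1) B4(1) in \<open>auto intro: has_vector_derivative_at_within[OF dP]\<close>)
  obtain C where C: "0 \<le> C"
    "\<And>L u \<eta>. 0 \<le> L \<Longrightarrow> L2_on L u \<Longrightarrow> continuous_on {0..L} \<eta> \<Longrightarrow> \<eta> 0 = 0 \<Longrightarrow> \<eta> L = 0 \<Longrightarrow>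
      (\<And>t. t \<in> {0..L} \<Longrightarrow> K_H_\<sigma> H \<Sigma> u t = \<eta> t - integral {0..t} (\<lambda>s. A s *v \<eta> s)) \<Longrightarrow>
      integral {0..L} (\<lambda>t. (norm (perp k (matrix_inv (P t) *v \<eta> t)))\<^sup>2) \<le>
        C * (LINT t:{0..L}|lebesgue. (norm (u t))\<^sup>2)"
    using fs.transversal_estimate unfolding Heq by blast
  \<comment> \<open>\<open>BQ * BP^2\<close> bounds the Hessian form by the squared transversal
    norm, and C bounds the integral of the latter by the energy. None of them depends on N; the
    modulus avoids a discussion of the sign of d_H.\<close>
  define K where "K = \<bar>d_H H\<bar> / 2 * (BQ * BP\<^sup>2 * C)"
  have K0: "0 \<le> K" using BQ(1) C(1) by (simp add: K_def)
  show ?thesis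
  \<comment> \<open>The summand 1 keeps the threshold positive for \<open>K = 0\<close>, where
    \<open>1 / K\<close> would be 0.\<close>
  proof (intro exI[of _ "1 / (K + 1)"] conjI allI impI ballI)
    show "0 < 1 / (K + 1)" using K0 by simp
    fix N :: nat and \<epsilon> :: real and \<eta>
    assume "1 \<le> N" and \<epsilon>: "0 < \<epsilon> \<and> \<epsilon> < 1 / (K + 1)" and \<eta>: "\<eta> \<in> \<H>_H_\<sigma>_0 H \<Sigma> (real N * T)"
      and nz: "\<exists>t\<in>{0..real N * T}. \<eta> t \<noteq> 0"
    define L where "L = real N * T"
    have L: "0 \<le> L" using T by (simp add: L_def)
    obtain u where u: "L2_on L u" "\<And>t. t \<in> {0..L} \<Longrightarrow> \<eta> t = K_H_\<sigma> H \<Sigma> u t" and bc: "\<eta> 0 = 0" "\<eta> L = 0"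
      using \<eta> unfolding \<H>_H_\<sigma>_0_def \<H>_H_\<sigma>_def L_def by blast
    have \<eta>c: "continuous_on {0..L} \<eta>"
      by (rule continuous_on_eq[OF fs.K_H_\<sigma>_continuous[OF u(1)]]) (use u(2) Heq in auto)
    let ?V = "\<lambda>t. LINT s:{0..t}|lebesgue. jacobian b (at (X s)) *v \<eta> s"
    have A\<eta>: "?V t = integral {0..t} (\<lambda>s. A s *v \<eta> s)"
      if "t \<in> {0..L}" for t
      unfolding A_def[symmetric] using that
      by (intro LINT_eq_integral continuous_intros Ac continuous_on_subset[OF \<eta>c]) auto
    define w where "w = K_H_\<sigma>_inv H \<Sigma> L (\<lambda>t. \<eta> t - ?V t)"
    have "\<exists>v. L2_on L v \<and> (\<forall>t\<in>{0..L}. K_H_\<sigma> H \<Sigma> v t = \<eta> t - ?V t)"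
      using fs.variational_preimage_exists[OF u(1), of \<eta>] u(2) A\<eta> unfolding Heq by simp
    then have "L2_on L w \<and> (\<forall>t\<in>{0..L}. K_H_\<sigma> H \<Sigma> w t = \<eta> t - ?V t)"
      unfolding w_def K_H_\<sigma>_inv_def by (rule someI_ex)
    then have w: "L2_on L w" "\<And>t. t \<in> {0..L} \<Longrightarrow> K_H_\<sigma> H \<Sigma> w t = \<eta> t - integral {0..t} (\<lambda>s. A s *v \<eta> s)"
      using A\<eta> by auto
    define W where "W = (LINT t:{0..L}|lebesgue. (norm (w t))\<^sup>2)"
    have "W \<noteq> 0"
    proof
      assume "W = 0"
      then have "\<eta> t = 0" if "t \<in> {0..L}" for t
        using fs.variational_equation_nondegenerate[OF w(1) _ \<eta>c _ that] w(2) unfolding W_def Heq by blast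
      with nz show False unfolding L_def by blast
    qed
    moreover have "0 \<le> W" unfolding W_def set_lebesgue_integral_def by (rule Bochner_Integration.integral_nonneg) auto
    ultimately have W: "0 < W" by simp
    define z where "z t = perp k (matrix_inv (P t) *v \<eta> t)" for t
    have zc: "continuous_on {0..L} z" unfolding z_def
      by (intro bounded_linear.continuous_on[OF bounded_linear_perp] continuous_intros continuous_on_matrix_inv[OF Pc Pinv] \<eta>c)
    have pw: "\<bar>\<eta> t \<bullet> (Q t *v \<eta> t)\<bar> \<le> BQ * BP\<^sup>2 * (norm (z t))\<^sup>2" if t: "t \<in> {0..L}" for t
    proof -
      have t0: "0 \<le> t" using t by simp
      have col: "column k (P t) = b (X t)"
        using P_first vector_derivative_at[of X "b (X t)" t] X_solution by simp
      have "\<eta> t \<bullet> (Q t *v \<eta> t) = (P t *v z t) \<bullet> (Q t *v (P t *v z t))"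
        using hessian_form_along_orbit[where b = b and X = X and t = t and k = k and P = "P t" and z = "matrix_inv (P t) *v \<eta> t"]
          b X_solution grad_div col matrix_inv_inverse(1)[OF Pinv] by (simp add: z_def Q_def)
      also have "\<bar>\<dots>\<bar> \<le> norm (P t *v z t) * norm (Q t *v (P t *v z t))" by (rule Cauchy_Schwarz_ineq2)
      also have "\<dots> \<le> (BP * norm (z t)) * (BQ * (BP * norm (z t)))"
        using BP(2)[OF t0] BQ(2)[OF t0] BP(1) BQ(1)
        by (intro mult_mono order_trans[OF norm_matrix_vector_mult_le]) auto
      finally show ?thesis by (simp add: power2_eq_square mult_ac)
    qed
    have Ic: "continuous_on {0..L} (\<lambda>t. \<eta> t \<bullet> (Q t *v \<eta> t))" by (intro continuous_intros \<eta>c Qc)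
    define I where "I = (LINT t:{0..L}|lebesgue. \<eta> t \<bullet> (hessian (divergence b) (X t) *v \<eta> t))"
    have "I = integral {0..L} (\<lambda>t. \<eta> t \<bullet> (Q t *v \<eta> t))"
      unfolding I_def Q_def[symmetric] by (rule LINT_eq_integral[OF Ic])
    also have "norm \<dots> \<le> integral {0..L} (\<lambda>t. BQ * BP\<^sup>2 * (norm (z t))\<^sup>2)"
      using pw by (intro integral_norm_bound_integral integrable_continuous_real continuous_intros Ic zc \<eta>c Qc) auto
    also have "\<dots> \<le> BQ * BP\<^sup>2 * (C * W)"
    proof -
      have "integral {0..L} (\<lambda>t. (norm (z t))\<^sup>2) \<le> C * W"
        unfolding z_def W_def by (rule C(2)[OF L w(1) \<eta>c bc w(2)])
      then have "BQ * BP\<^sup>2 * integral {0..L} (\<lambda>t. (norm (z t))\<^sup>2) \<le> BQ * BP\<^sup>2 * (C * W)"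
        using BQ(1) by (intro mult_left_mono) auto
      then show ?thesis by simp
    qed
    finally have I: "\<bar>I\<bar> \<le> BQ * BP\<^sup>2 * C * W" by (simp add: mult.assoc)
    have "\<bar>d_H H / 2 * I\<bar> \<le> \<bar>d_H H\<bar> / 2 * (BQ * BP\<^sup>2 * C * W)"
      using mult_left_mono[OF I, of "\<bar>d_H H\<bar> / 2"] by (simp add: abs_mult)
    then have "\<bar>d_H H / 2 * I\<bar> \<le> K * W" by (simp add: K_def mult.assoc)
    moreover have "K * W < 1 / \<epsilon> * W"
    proof (rule mult_strict_right_mono[OF _ W])
      have "\<epsilon> * (K + 1) < 1" using \<epsilon> K0 by (simp add: pos_less_divide_eq)
      then have "K + 1 < 1 / \<epsilon>" using \<epsilon> by (simp add: pos_less_divide_eq mult.commute)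
      then show "K < 1 / \<epsilon>" by simp
    qed
    ultimately have "0 < 1 / \<epsilon> * W + d_H H / 2 * I" by linarith
    then show "0 < second_variation H \<Sigma> b X \<epsilon> (real N * T) \<eta>"
      unfolding second_variation_def W_def I_def w_def L_def .
  qed
qed

end
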